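(* Let $G=\mathrm{SO}(2,n)$ with $n\ge3$, realized as in the context. A closed, connected subgroup $H$ of $N$, with Lie algebra $\mathfrak h$, is not a Cartan-decomposition subgroup of $G$ if and only if at least one of the following holds: (1) $\dim H\le1$; (2) for every nonzero element of $\mathfrak h$, we have $\phi=0$ and $\dim\langle x,y\rangle\ne1$ (i.e. $\dim\langle x,y\rangle\in\{0,2\}$); (3) for every nonzero element of $\mathfrak h$, we have $\phi=0$ and $\dim\langle x,y\rangle=1$; (4) there exist a subspace $X_0$ of $\mathbb{R}^{n-2}$, $b\in X_0$, $c\in X_0^\perp$, and $p\in\mathbb{R}$ with $\|b\|^2-\|c\|^2-2p<0$, such that for every element of $\mathfrak h$ we have $y=0$, $x\in\phi c+X_0$, and $\eta=p\phi+b\cdot x$ (Euclidean dot product).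
   Context: A closed subgroup $H$ of $G$ is a Cartan-decomposition subgroup of $G$ if $H$ is connected and there is a compact subset $C$ of $G$ with $CHC=G$. $\mathrm{SO}(2,n)$ is the group of determinant-one linear isometries of the quadratic form $\langle v\mid v\rangle=2v_1v_{n+2}+2v_2v_{n+1}+\sum_{i=3}^n v_i^2$ on $\mathbb{R}^{n+2}$. $N$ is the group of upper-triangular matrices in $\mathrm{SO}(2,n)$ with all diagonal entries $1$. Its Lie algebra $\mathfrak n$ consists of the matrices (block sizes $1,1,n-2,1,1$) $$\begin{pmatrix}0&\phi&x&\eta&0\\0&0&y&0&-\eta\\0&0&0&-y^T&-x^T\\0&0&0&0&-\phi\\0&0&0&0&0\end{pmatrix},\qquad \phi,\eta\in\mathbb{R},\ x,y\in\mathbb{R}^{n-2}\text{ (row vectors)},$$ so each element of $\mathfrak n$ determines values of $\phi,x,y,\eta$. $\langle x,y\rangle$ denotes the linear span of $x$ and $y$ in $\mathbb{R}^{n-2}$, $\|\cdot\|$ is the Euclidean norm, and $X_0^\perp$ the Euclidean orthogonal complement. *)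

theory Defs
  imports "HOL-Analysis.Analysis" "HOL-Algebra.Coset"
begin

text \<open>
  The coordinates \<open>1, \<dots>, n+2\<close> are indexed by the type \<open>'k idx\<close>, split according to the block sizes
  \<open>1, 1, n-2, 1, 1\<close>. The type \<open>'k\<close> indexes the middle block, so \<open>n = CARD('k) + 2\<close>, and \<open>n \<ge> 3\<close> holds
  automatically because types are nonempty. The order on the indices, needed for "upper triangular",
  is the order in which the constructors are listed, refined by the order of \<open>'k\<close> within
  the middle block.
\<close>

datatype 'k idx = First | Second | Mid 'k | Penult | Last

lemma UNIV_idx: "(UNIV :: 'k idx set) = {First, Second, Penult, Last} \<union> range Mid"
  by (auto intro: idx.exhaust)

instance idx :: (finite) finite
  by standard (simp add: UNIV_idx)

lemma card_idx: "CARD('k::finite idx) = CARD('k) + 4"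
proof -
  have "card (range (Mid :: 'k \<Rightarrow> 'k idx)) = CARD('k)"
    by (simp add: card_image inj_on_def)
  moreover have "{First, Second, Penult, Last} \<inter> range (Mid :: 'k \<Rightarrow> 'k idx) = {}"
    by auto
  ultimately show ?thesis
    by (simp add: UNIV_idx card_Un_disjoint)
qed

fun block :: "'k idx \<Rightarrow> nat" where
  "block First = 1"
| "block Second = 2"
| "block (Mid k) = 3"
| "block Penult = 4"
| "block Last = 5"

instantiation idx :: (linorder) linorder
begin

definition less_eq_idx :: "'a idx \<Rightarrow> 'a idx \<Rightarrow> bool" where
  "i \<le> j \<longleftrightarrow> block i < block j \<or> i = j \<or> (\<exists>a b. i = Mid a \<and> j = Mid b \<and> a \<le> b)"

definition less_idx :: "'a idx \<Rightarrow> 'a idx \<Rightarrow> bool" where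
  "(i :: 'a idx) < j \<longleftrightarrow> i \<le> j \<and> i \<noteq> j"

instance
proof
  fix i j k :: "'a idx"
  show "i < j \<longleftrightarrow> i \<le> j \<and> \<not> j \<le> i"
    by (cases i; cases j) (auto simp: less_idx_def less_eq_idx_def)
  show "i \<le> i"
    by (simp add: less_eq_idx_def)
  show "i \<le> k" if "i \<le> j" "j \<le> k"
    using that unfolding less_eq_idx_def by (elim disjE exE conjE) auto
  show "i = j" if "i \<le> j" "j \<le> i"
    using that by (cases i; cases j) (auto simp: less_eq_idx_def)
  show "i \<le> j \<or> j \<le> i"
    by (cases i; cases j) (auto simp: less_eq_idx_def)
qed

end

definition qform :: "real^('k::finite idx) \<Rightarrow> real" where
  "qform v = 2 * v $ First * v $ Last + 2 * v $ Second * v $ Penult + (\<Sum>k\<in>UNIV. (v $ Mid k)\<^sup>2)"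

definition SO2n :: "(real^('k::finite idx)^('k idx)) monoid" where
  "SO2n = \<lparr>carrier = {A. det A = 1 \<and> (\<forall>v. qform (A *v v) = qform v)}, mult = (**), one = mat 1\<rparr>"

definition unipotent_N :: "(real^('k::{finite,linorder} idx)^('k idx)) set" where
  "unipotent_N = {A \<in> carrier SO2n. (\<forall>i j. j < i \<longrightarrow> A $ i $ j = 0) \<and> (\<forall>i. A $ i $ i = 1)}"

definition cartan_decomposition_subgroup ::
    "(real^'m::finite^'m) monoid \<Rightarrow> (real^'m^'m) set \<Rightarrow> bool" where
  "cartan_decomposition_subgroup G H \<longleftrightarrow>
     subgroup H G \<and> closedin (top_of_set (carrier G)) H \<and> connected H \<and>
     (\<exists>C. compact C \<and> C \<subseteq> carrier G \<and> C <#>\<^bsub>G\<^esub> H <#>\<^bsub>G\<^esub> C = carrier G)"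

text \<open>
  The multiplication \<open>*\<close> that HOL-Analysis provides on \<open>real^'m^'m\<close> is componentwise, so neither \<open>^\<close> nor
  \<open>exp\<close> is available for matrices with the product \<open>**\<close>.
\<close>

definition matrix_exp :: "real^'m::finite^'m \<Rightarrow> real^'m^'m" where
  "matrix_exp A = (\<Sum>k. (1 / fact k) *\<^sub>R (((**) A ^^ k) (mat 1)))"

text \<open>
  For a closed subgroup \<open>H\<close> of a matrix group this is the Lie algebra of \<open>H\<close>; its dimension as a real
  vector space is the dimension of \<open>H\<close> as a Lie group.
\<close>

definition lie_algebra :: "(real^'m::finite^'m) set \<Rightarrow> (real^'m^'m) set" where
  "lie_algebra H = {X. \<forall>t::real. matrix_exp (t *\<^sub>R X) \<in> H}"

text \<open>
  \<open>n_matrix \<phi> x y \<eta>\<close> is the general element of the Lie algebra of \<open>unipotent_N\<close>. The functions after it read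
  off its four parameters.
\<close>

definition n_matrix ::
    "real \<Rightarrow> real^'k \<Rightarrow> real^'k \<Rightarrow> real \<Rightarrow> real^('k::finite idx)^('k idx)" where
  "n_matrix \<phi> x y \<eta> = (\<chi> i j. case (i, j) of
       (First, Second) \<Rightarrow> \<phi>
     | (First, Mid k) \<Rightarrow> x $ k
     | (First, Penult) \<Rightarrow> \<eta>
     | (Second, Mid k) \<Rightarrow> y $ k
     | (Second, Last) \<Rightarrow> - \<eta>
     | (Mid k, Penult) \<Rightarrow> - (y $ k)
     | (Mid k, Last) \<Rightarrow> - (x $ k)
     | (Penult, Last) \<Rightarrow> - \<phi>
     | _ \<Rightarrow> 0)"

definition phi_of :: "real^('k::finite idx)^('k idx) \<Rightarrow> real" where
  "phi_of X = X $ First $ Second"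

definition x_of :: "real^('k::finite idx)^('k idx) \<Rightarrow> real^'k" where
  "x_of X = (\<chi> k. X $ First $ Mid k)"

definition y_of :: "real^('k::finite idx)^('k idx) \<Rightarrow> real^'k" where
  "y_of X = (\<chi> k. X $ Second $ Mid k)"

definition eta_of :: "real^('k::finite idx)^('k idx) \<Rightarrow> real" where
  "eta_of X = X $ First $ Penult"

lemma n_matrix_parameters [simp]:
  "phi_of (n_matrix \<phi> x y \<eta>) = \<phi>"
  "x_of (n_matrix \<phi> x y \<eta>) = x"
  "y_of (n_matrix \<phi> x y \<eta>) = y"
  "eta_of (n_matrix \<phi> x y \<eta>) = \<eta>"
  by (simp_all add: n_matrix_def phi_of_def x_of_def y_of_def eta_of_def vec_eq_iff)

end

(* Every element of G = SO(2,n) is k a l with k, l in the maximal compact subgroup and a = torus a b in the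
   Weyl chamber a >= b >= 1, and H is a Cartan-decomposition subgroup as soon as the chamber components of its
   elements come within bounded distance of every point of the chamber. As H is the exponential of its Lie
   algebra, the invariants that determine the chamber component are explicit polynomials on the Lie algebra.

   If G = C H C, then suitable rescaled sequences in H converge to a matrix of rank one (from the wall b = 1) and
   to one of larger rank (from the wall a = b); each of the four conditions rules out one of the two.

   Conversely, a curve in H that stays close to the wall b = 1 and a curve that stays close to the wall a = b can
   be joined by a two-parameter family in H, and by the Poincare-Miranda theorem this family covers the chamber up
   to a bounded error. If none of the four conditions holds, both curves exist: they are one-parameter subgroups
   unless phi and y are both nonzero on the Lie algebra, where they may have to be bent. *)

theory Submission
  imports Defs
begin


subsection \<open>The form, its group and the adjoint\<close>

text \<open>The obstacle is the case where \<open>\<phi>\<close> and \<open>y\<close> are both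
  nonzero on one ray \<open>t v\<close>. There \<open>nE\<close> has degree 8 in t and
  \<open>nF\<close> has degree 6, so the chamber coordinates a and b grow like t^4 and t^2: the ray
  runs through the interior of the chamber and stays near neither wall. Bending it by a second
  vector of the Lie algebra, available because the dimension is at least two, cancels a leading
  term: \<open>wall1_curve\<close> lowers the degree of \<open>nF\<close>,
  \<open>wall2_curve\<close> that of the matrix entry which makes \<open>nE\<close> too large.

  The chamber component is read off from a 2 x 2 block, that of the matrix on a maximal negative
  plane: its squared norm and its determinant determine a and b, and on the unipotent group both are
  polynomials of low degree. For two elements to differ by bounded factors it is enough that the
  first invariant agrees and the second agrees up to a constant factor, so one exact and one
  approximate equation have to be solved.

  In the other direction the rank of a rescaled limit replaces the position in the chamber:
  multiplication by the limits of the compact factors, which are invertible, does not change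
  it.\<close>

lemma sum_idx:
  fixes f :: "'k::finite idx \<Rightarrow> 'a::comm_monoid_add"
  shows "sum f UNIV = f First + f Second + (\<Sum>k\<in>UNIV. f (Mid k)) + f Penult + f Last"
proof -
  have "sum f UNIV = sum f {First, Second, Penult, Last} + sum f (range Mid)"
    unfolding UNIV_idx by (rule sum.union_disjoint) auto
  moreover have "sum f (range Mid) = (\<Sum>k\<in>UNIV. f (Mid k))"
    by (simp add: sum.reindex inj_on_def)
  ultimately show ?thesis
    by (simp add: ac_simps)
qed

lemma prod_idx:
  fixes f :: "'k::finite idx \<Rightarrow> 'a::comm_monoid_mult"
  shows "prod f UNIV = f First * f Second * (\<Prod>k\<in>UNIV. f (Mid k)) * f Penult * f Last"
proof -
  have "prod f UNIV = prod f {First, Second, Penult, Last} * prod f (range Mid)"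
    unfolding UNIV_idx by (rule prod.union_disjoint) auto
  moreover have "prod f (range Mid) = (\<Prod>k\<in>UNIV. f (Mid k))"
    by (simp add: prod.reindex inj_on_def)
  ultimately show ?thesis
    by (simp add: ac_simps)
qed

lemma less_idx_simps [simp]:
  "First < Second" "First < Mid k" "First < Penult" "First < (Last :: 'k::linorder idx)"
  "Second < Mid k" "Second < Penult" "Second < (Last :: 'k idx)"
  "Mid k < Penult" "Mid k < Last" "Penult < (Last :: 'k idx)"
  by (auto simp: less_idx_def less_eq_idx_def)

fun flip :: "'k idx \<Rightarrow> 'k idx" where
  "flip First = Last"
| "flip Second = Penult"
| "flip (Mid k) = Mid k"
| "flip Penult = Second"
| "flip Last = First"

lemma flip_flip [simp]: "flip (flip i) = i"
  by (cases i) auto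

lemma flip_inject [simp]: "flip i = flip j \<longleftrightarrow> i = j"
  by (metis flip_flip)

lemma bij_flip: "bij flip"
  by (rule involuntory_imp_bij) simp

definition bform :: "real^('k::finite idx) \<Rightarrow> real^('k idx) \<Rightarrow> real" where
  "bform v w = (\<Sum>i\<in>UNIV. v $ flip i * w $ i)"

text \<open>The adjoint for \<open>bform\<close>, not the Euclidean one: the transpose conjugated by
  \<open>flip_matrix\<close>, the Gram matrix of the form. Membership in the group becomes the
  matrix equation \<open>adj A ** A = mat 1\<close>, which also exhibits the inverse.\<close>

definition adj :: "real^('k::finite idx)^('k idx) \<Rightarrow> real^('k idx)^('k idx)" where
  "adj A = (\<chi> i j. A $ flip j $ flip i)"

definition flip_matrix :: "real^('k::finite idx)^('k idx)" where
  "flip_matrix = (\<chi> i j. if j = flip i then 1 else 0)"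

lemma bform_expand:
  "bform v w = v $ Last * w $ First + v $ Penult * w $ Second + (\<Sum>k\<in>UNIV. v $ Mid k * w $ Mid k)
     + v $ Second * w $ Penult + v $ First * w $ Last"
  by (simp add: bform_def sum_idx)

lemma qform_bform: "qform v = bform v v"
  by (simp add: qform_def bform_expand power2_eq_square algebra_simps)

lemma bform_commute: "bform v w = bform w v"
  by (simp add: bform_expand algebra_simps)

lemma bform_add: "bform (u + v) w = bform u w + bform v w" "bform w (u + v) = bform w u + bform w v"
  by (simp_all add: bform_def algebra_simps sum.distrib)

lemma bform_polar: "2 * bform v w = qform (v + w) - qform v - qform w"
  by (simp add: qform_bform bform_add bform_commute[of w v])

lemma bform_axis: "bform (axis i 1) (axis j 1) = (if i = flip j then 1 else 0)"
  by (auto simp: bform_def axis_def if_distrib[of "\<lambda>x. x * _"] if_distrib[of "\<lambda>x. _ * x"] sum.delta cong: if_cong)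

lemma matrix_mul_nth: "(A ** B) $ i $ j = (\<Sum>k\<in>UNIV. A $ i $ k * B $ k $ j)"
  by (simp add: matrix_matrix_mult_def)

lemma bform_columns: "bform (column i A) (column j A) = (adj A ** A) $ flip i $ j"
  by (simp add: bform_def adj_def matrix_mul_nth column_def)

lemma bform_adj: "bform (A *v v) w = bform v (adj A *v w)"
proof -
  have "bform (A *v v) w = (\<Sum>i\<in>UNIV. \<Sum>j\<in>UNIV. A $ flip i $ j * v $ j * w $ i)"
    by (simp add: bform_def matrix_vector_mult_def sum_distrib_right)
  also have "\<dots> = (\<Sum>j\<in>UNIV. \<Sum>i\<in>UNIV. A $ flip i $ j * v $ j * w $ i)"
    by (rule sum.swap)
  also have "\<dots> = (\<Sum>j\<in>UNIV. \<Sum>i\<in>UNIV. A $ flip i $ flip j * v $ flip j * w $ i)"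
    using sum.reindex_bij_betw[OF bij_flip, of "\<lambda>j. \<Sum>i\<in>UNIV. A $ flip i $ j * v $ j * w $ i"] by simp
  also have "\<dots> = bform v (adj A *v w)"
    by (simp add: bform_def adj_def matrix_vector_mult_def sum_distrib_left algebra_simps)
  finally show ?thesis .
qed

text \<open>By polarization an isometry of \<open>qform\<close> also preserves \<open>bform\<close>,
  and the \<open>bform\<close> products of the columns of \<open>A\<close> are, up to a flip of the
  row index, the entries of \<open>adj A ** A\<close>.\<close>

lemma preserves_iff_adj:
  "(\<forall>v. qform (A *v v) = qform v) \<longleftrightarrow> adj A ** A = mat 1"
proof
  assume A: "\<forall>v. qform (A *v v) = qform v"
  then have "bform (A *v v) (A *v w) = bform v w" for v w
    using bform_polar[of "A *v v" "A *v w"] bform_polar[of v w]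
    by (simp add: matrix_vector_right_distrib[symmetric])
  from this[of "axis _ 1" "axis _ 1"]
  have "bform (column i A) (column j A) = (if i = flip j then 1 else 0)" for i j
    by (simp add: bform_axis matrix_vector_mult_basis)
  then have "(adj A ** A) $ i $ j = (if i = j then 1 else 0)" for i j
    using bform_columns[of "flip i" A j] by simp
  then show "adj A ** A = mat 1"
    by (simp add: vec_eq_iff mat_def)
next
  assume "adj A ** A = mat 1"
  then show "\<forall>v. qform (A *v v) = qform v"
    by (simp add: qform_bform bform_adj matrix_vector_mul_assoc)
qed

lemma carrier_SO2n: "carrier SO2n = {A. det A = 1 \<and> adj A ** A = mat 1}"
  by (simp add: SO2n_def preserves_iff_adj)

lemma SO2n_simps [simp]: "A \<otimes>\<^bsub>SO2n\<^esub> B = A ** B" "\<one>\<^bsub>SO2n\<^esub> = mat 1"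
  by (simp_all add: SO2n_def)

lemma adj_adj [simp]: "adj (adj A) = A"
  by (simp add: adj_def vec_eq_iff)

lemma adj_mult: "adj (A ** B) = adj B ** adj A"
proof -
  have "(adj (A ** B)) $ i $ j = (adj B ** adj A) $ i $ j" for i j
    using sum.reindex_bij_betw[OF bij_flip, of "\<lambda>k. A $ flip j $ k * B $ k $ flip i"]
    by (simp add: adj_def matrix_mul_nth mult.commute)
  then show ?thesis by (simp add: vec_eq_iff)
qed

lemma adj_one [simp]: "adj (mat 1) = mat 1"
  by (auto simp: adj_def mat_def vec_eq_iff)

lemma flip_matrix_mult [simp]: "(flip_matrix ** A) $ i $ j = A $ flip i $ j"
  by (simp add: matrix_mul_nth flip_matrix_def if_distrib[of "\<lambda>x. x * _"] sum.delta cong: if_cong)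

lemma mult_flip_matrix [simp]: "(A ** flip_matrix) $ i $ j = A $ i $ flip j"
proof -
  have "(if j = flip k then 1 else 0) = (if k = flip j then 1 else (0::real))" for k :: "'a idx"
    by auto
  then show ?thesis
    by (simp add: matrix_mul_nth flip_matrix_def if_distrib[of "\<lambda>x. _ * x"] sum.delta cong: if_cong)
qed

lemma adj_eq: "adj A = flip_matrix ** transpose A ** flip_matrix"
  by (simp add: adj_def vec_eq_iff transpose_def)

lemma det_adj [simp]: "det (adj A) = det A"
proof -
  have "flip_matrix ** flip_matrix = (mat 1 :: real^('a idx)^('a idx))"
    by (auto simp: vec_eq_iff) (auto simp: flip_matrix_def mat_def)
  then have "det (flip_matrix :: real^('a idx)^('a idx)) * det (flip_matrix :: real^('a idx)^('a idx)) = 1"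
    by (metis det_mul det_I)
  then show ?thesis
    by (simp add: adj_eq det_mul)
qed

lemma group_SO2n: "group (SO2n :: (real^('k::finite idx)^('k idx)) monoid)"
proof (rule groupI)
  fix A :: "real^('k idx)^('k idx)" assume A: "A \<in> carrier SO2n"
  then have "adj A \<in> carrier SO2n"
    by (auto simp: carrier_SO2n matrix_left_right_inverse)
  with A show "\<exists>B\<in>carrier SO2n. B \<otimes>\<^bsub>SO2n\<^esub> A = \<one>\<^bsub>SO2n\<^esub>"
    by (intro bexI[of _ "adj A"]) (auto simp: carrier_SO2n)
next
  fix A B :: "real^('k idx)^('k idx)" assume "A \<in> carrier SO2n" "B \<in> carrier SO2n"
  then show "A \<otimes>\<^bsub>SO2n\<^esub> B \<in> carrier SO2n"
    by (simp add: carrier_SO2n det_mul adj_mult)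
       (metis matrix_mul_assoc matrix_mul_lid)
qed (auto simp: carrier_SO2n matrix_mul_assoc)

lemma adj_inverse:
  assumes "A \<in> carrier SO2n"
  shows "adj A ** A = mat 1" "A ** adj A = mat 1" "adj A \<in> carrier SO2n" "inv\<^bsub>SO2n\<^esub> A = adj A"
proof -
  show *: "adj A ** A = mat 1" "A ** adj A = mat 1" "adj A \<in> carrier SO2n"
    using assms by (auto simp: carrier_SO2n matrix_left_right_inverse)
  show "inv\<^bsub>SO2n\<^esub> A = adj A"
    using * assms by (intro group.inv_equality[OF group_SO2n]) auto
qed

lemma continuous_on_adj: "continuous_on S (adj :: real^('k::finite idx)^('k idx) \<Rightarrow> _)"
  unfolding adj_def by (intro continuous_intros)

lemma tendsto_matrix_mult:
  fixes A :: "'b \<Rightarrow> real^'n::finite^'m::finite" and B :: "'b \<Rightarrow> real^'p::finite^'n"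
  assumes "(A \<longlongrightarrow> a) F" "(B \<longlongrightarrow> b) F"
  shows "((\<lambda>x. A x ** B x) \<longlongrightarrow> a ** b) F"
  unfolding matrix_matrix_mult_def
  by (intro vec_tendstoI) (auto intro!: tendsto_sum tendsto_mult tendsto_vec_nth assms)

lemma continuous_on_matrix_mult:
  fixes A :: "'b::topological_space \<Rightarrow> real^'n::finite^'m::finite" and B :: "'b \<Rightarrow> real^'p::finite^'n"
  assumes "continuous_on S A" "continuous_on S B"
  shows "continuous_on S (\<lambda>x. A x ** B x)"
  using assms unfolding continuous_on_def by (auto intro: tendsto_matrix_mult)

lemma continuous_on_det: "continuous_on S (det :: real^'n::finite^'n \<Rightarrow> real)"
  unfolding det_def by (intro continuous_intros)

lemma closed_carrier_SO2n: "closed (carrier SO2n)"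
proof -
  have "carrier SO2n = {A. det A = 1} \<inter> {A :: real^('a idx)^('a idx). adj A ** A = mat 1}"
    by (auto simp: carrier_SO2n)
  moreover have "closed {A :: real^('a idx)^('a idx). adj A ** A = mat 1}"
    by (intro closed_Collect_eq continuous_on_matrix_mult continuous_on_adj continuous_on_id continuous_on_const)
  ultimately show ?thesis
    by (auto intro!: closed_Int closed_Collect_eq continuous_on_det continuous_on_const)
qed

lemma closed_unipotent_N: "closed (unipotent_N :: (real^('k::{finite,linorder} idx)^('k idx)) set)"
proof -
  have "(unipotent_N :: (real^('k idx)^('k idx)) set) = carrier SO2n \<inter> (\<Inter>i. \<Inter>j\<in>{j. j < i}. {A. A $ i $ j = 0}) \<inter> (\<Inter>i. {A. A $ i $ i = 1})"
    by (auto simp: unipotent_N_def)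
  also have "closed \<dots>"
    by (intro closed_Int closed_carrier_SO2n closed_INT closed_Collect_eq ballI continuous_intros)
  finally show ?thesis .
qed

subsection \<open>Coordinates on the unipotent group\<close>

type_synonym 'k nvec = "real \<times> (real^'k) \<times> (real^'k) \<times> real"

text \<open>The element of \<open>unipotent_N\<close> whose entries above the diagonal in the first row and in the middle of the
  second one are \<open>p\<close>, \<open>q\<close>, \<open>e\<close> and \<open>r\<close>; the form determines all other entries.\<close>

fun unip_entry :: "real \<Rightarrow> real^'k \<Rightarrow> real^'k \<Rightarrow> real \<Rightarrow> 'k::finite idx \<Rightarrow> 'k idx \<Rightarrow> real" where
  "unip_entry p q r e First First = 1"
| "unip_entry p q r e First Second = p"
| "unip_entry p q r e First (Mid k) = q $ k"
| "unip_entry p q r e First Penult = e"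
| "unip_entry p q r e First Last = - p * e + p\<^sup>2 * (r \<bullet> r) / 2 - p * (q \<bullet> r) - ((q - p *\<^sub>R r) \<bullet> (q - p *\<^sub>R r)) / 2"
| "unip_entry p q r e Second Second = 1"
| "unip_entry p q r e Second (Mid k) = r $ k"
| "unip_entry p q r e Second Penult = - (r \<bullet> r) / 2"
| "unip_entry p q r e Second Last = - e + p * (r \<bullet> r) / 2 - q \<bullet> r"
| "unip_entry p q r e (Mid k) (Mid l) = (if k = l then 1 else 0)"
| "unip_entry p q r e (Mid k) Penult = - (r $ k)"
| "unip_entry p q r e (Mid k) Last = - (q $ k) + p * r $ k"
| "unip_entry p q r e Penult Penult = 1"
| "unip_entry p q r e Penult Last = - p"
| "unip_entry p q r e Last Last = 1"
| "unip_entry p q r e _ _ = 0"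

definition unip :: "real \<Rightarrow> real^'k \<Rightarrow> real^'k \<Rightarrow> real \<Rightarrow> real^('k::finite idx)^('k idx)" where
  "unip p q r e = (\<chi> i j. unip_entry p q r e i j)"

lemma inner_vec_sum: "(x :: real^'k::finite) \<bullet> y = (\<Sum>k\<in>UNIV. x $ k * y $ k)"
  by (simp add: inner_vec_def)

text \<open>Read entry by entry, \<open>adj A ** A = mat 1\<close> is a triangular system: once the
  four parameters are given, each relation contains one new entry, which it determines.\<close>

lemma unipotent_N_eq_unip:
  fixes A :: "real^('k::{finite,linorder} idx)^('k idx)"
  assumes "A \<in> unipotent_N"
  shows "A = unip (phi_of A) (x_of A) (y_of A) (eta_of A)"
proof -
  have lower: "A $ i $ j = 0" if "j < i" for i j
    using assms that by (auto simp: unipotent_N_def)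
  have diag: "A $ i $ i = 1" for i
    using assms by (auto simp: unipotent_N_def)
  have low: "A $ Second $ First = 0" "A $ Mid k $ First = 0" "A $ Mid k $ Second = 0"
    "A $ Penult $ First = 0" "A $ Penult $ Second = 0" "A $ Penult $ Mid k = 0"
    "A $ Last $ First = 0" "A $ Last $ Second = 0" "A $ Last $ Mid k = 0" "A $ Last $ Penult = 0" for k
    by (rule lower, simp)+
  have "adj A ** A = mat 1"
    using assms by (auto simp: unipotent_N_def carrier_SO2n)
  then have rel0: "(\<Sum>k\<in>UNIV. A $ flip k $ flip i * A $ k $ j) = (if i = j then 1 else 0)" for i j
    by (simp add: vec_eq_iff matrix_mul_nth adj_def mat_def)
  have rel: "(\<Sum>k\<in>UNIV. A $ flip k $ i * A $ k $ j) = (if flip i = j then 1 else 0)" for i j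
    using rel0[of "flip i" j] by simp
  \<comment> \<open>Column \<open>l\<close> of the middle block has Euclidean norm one and diagonal
    entry one, so its other entries vanish.\<close>
  have mid: "A $ Mid k $ Mid l = (if k = l then 1 else 0)" for k l
  proof (cases "k = l")
    case False
    have "(\<Sum>i\<in>UNIV. (A $ Mid i $ Mid l)\<^sup>2) = 1"
      using rel[of "Mid l" "Mid l"] by (simp add: sum_idx low power2_eq_square)
    moreover have "(\<Sum>i\<in>UNIV. (A $ Mid i $ Mid l)\<^sup>2)
        = (A $ Mid l $ Mid l)\<^sup>2 + (\<Sum>i\<in>UNIV - {l}. (A $ Mid i $ Mid l)\<^sup>2)"
      by (rule sum.remove) auto
    ultimately have "(\<Sum>i\<in>UNIV - {l}. (A $ Mid i $ Mid l)\<^sup>2) = 0"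
      by (simp add: diag)
    then have "\<forall>i\<in>UNIV - {l}. (A $ Mid i $ Mid l)\<^sup>2 = 0"
      by (subst (asm) sum_nonneg_eq_0_iff) auto
    with False show ?thesis by simp
  qed (simp add: diag)
  define p q r e where "p = A $ First $ Second" and "q = x_of A" and "r = y_of A" and "e = A $ First $ Penult"
  have q: "A $ First $ Mid k = q $ k" and r: "A $ Second $ Mid k = r $ k" for k
    by (simp_all add: q_def r_def x_of_def y_of_def)
  have pe: "A $ First $ Second = p" "A $ First $ Penult = e"
    by (simp_all add: p_def e_def)
  have z: "A $ Penult $ Last = - p"
    using rel[of Second Last] by (simp add: sum_idx low diag p_def)
  have delta: "(\<Sum>i\<in>UNIV. (if i = k then 1 else 0) * f i) = f k" for k :: 'k and f :: "'k \<Rightarrow> real"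
    by (simp add: if_distrib[of "\<lambda>x. x * _"] sum.delta cong: if_cong)
  then have delta': "(\<Sum>i\<in>UNIV. f i * (if i = k then 1 else 0)) = f k" for k :: 'k and f :: "'k \<Rightarrow> real"
    by (simp add: mult.commute)
  have mP: "A $ Mid k $ Penult = - (r $ k)" for k
    using rel[of "Mid k" Penult] by (simp add: sum_idx low diag mid r delta)
  have mL: "A $ Mid k $ Last = - (q $ k) + p * r $ k" for k
    using rel[of "Mid k" Last] by (simp add: sum_idx low diag mid r q delta delta' z algebra_simps)
  have s: "A $ Second $ Penult = - (r \<bullet> r) / 2"
    using rel[of Penult Penult] by (simp add: sum_idx low diag mP inner_vec_sum)
  have w: "A $ Second $ Last = - e + p * (r \<bullet> r) / 2 - q \<bullet> r"
    using rel[of Penult Last]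
    by (simp add: sum_idx low diag mP mL s z inner_vec_sum sum.distrib sum_negf sum_distrib_left
        algebra_simps sum_subtractf e_def flip: sum_divide_distrib)
  have "(\<Sum>k\<in>UNIV. (A $ Mid k $ Last) * (A $ Mid k $ Last)) = (q - p *\<^sub>R r) \<bullet> (q - p *\<^sub>R r)"
    by (simp add: mL inner_vec_sum algebra_simps)
  then have f: "A $ First $ Last = - p * e + p\<^sup>2 * (r \<bullet> r) / 2 - p * (q \<bullet> r) - ((q - p *\<^sub>R r) \<bullet> (q - p *\<^sub>R r)) / 2"
    using rel[of Last Last]
    by (simp add: sum_idx low diag z w field_simps power2_eq_square)
  have "A $ i $ j = unip_entry p q r e i j" for i j
    by (cases i; cases j) (simp_all only: low diag mid mP mL s w f z q r pe unip_entry.simps)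
  then have "A = unip p q r e"
    by (simp add: unip_def vec_eq_iff)
  then show ?thesis
    unfolding p_def q_def r_def e_def phi_of_def eta_of_def .
qed

text \<open>The closed form of the matrix exponential of \<open>nmat\<close>, as
  \<open>matrix_exp_nmat\<close> confirms; \<open>nlog\<close> is its polynomial inverse on the
  unipotent group.\<close>

definition nexp :: "'k::finite nvec \<Rightarrow> real^('k idx)^('k idx)" where
  "nexp = (\<lambda>(\<phi>, x, y, \<eta>). unip \<phi> (x + (\<phi>/2) *\<^sub>R y) y (\<eta> - (x \<bullet> y) / 2 - \<phi> * (y \<bullet> y) / 6))"

definition nlog :: "real^('k::finite idx)^('k idx) \<Rightarrow> 'k nvec" where
  "nlog A = (phi_of A, x_of A - (phi_of A / 2) *\<^sub>R y_of A, y_of A,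
     eta_of A + (x_of A \<bullet> y_of A) / 2 - phi_of A * (y_of A \<bullet> y_of A) / 12)"

lemma unip_parameters [simp]:
  "phi_of (unip p q r e) = p" "x_of (unip p q r e) = q" "y_of (unip p q r e) = r" "eta_of (unip p q r e) = e"
  by (simp_all add: unip_def phi_of_def x_of_def y_of_def eta_of_def vec_eq_iff)

lemma nlog_nexp [simp]: "nlog (nexp v) = v"
  by (cases v) (simp add: nlog_def nexp_def inner_add_left field_simps)

lemma nexp_nlog: "A \<in> unipotent_N \<Longrightarrow> nexp (nlog A) = A"
  by (subst (3) unipotent_N_eq_unip, assumption)
     (simp add: nlog_def nexp_def inner_diff_left field_simps)

lemma nexp_inject [simp]: "nexp v = nexp w \<longleftrightarrow> v = w"
  by (metis nlog_nexp)

fun nexp_entry :: "real \<Rightarrow> real^'k \<Rightarrow> real^'k \<Rightarrow> real \<Rightarrow> 'k::finite idx \<Rightarrow> 'k idx \<Rightarrow> real" where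
  "nexp_entry \<phi> x y \<eta> First First = 1"
| "nexp_entry \<phi> x y \<eta> First Second = \<phi>"
| "nexp_entry \<phi> x y \<eta> First (Mid k) = x $ k + \<phi> * y $ k / 2"
| "nexp_entry \<phi> x y \<eta> First Penult = \<eta> - (x \<bullet> y) / 2 - \<phi> * (y \<bullet> y) / 6"
| "nexp_entry \<phi> x y \<eta> First Last = - \<phi> * \<eta> - (x \<bullet> x) / 2 + \<phi>\<^sup>2 * (y \<bullet> y) / 24"
| "nexp_entry \<phi> x y \<eta> Second Second = 1"
| "nexp_entry \<phi> x y \<eta> Second (Mid k) = y $ k"
| "nexp_entry \<phi> x y \<eta> Second Penult = - (y \<bullet> y) / 2"
| "nexp_entry \<phi> x y \<eta> Second Last = - \<eta> - (x \<bullet> y) / 2 + \<phi> * (y \<bullet> y) / 6"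
| "nexp_entry \<phi> x y \<eta> (Mid k) (Mid l) = (if k = l then 1 else 0)"
| "nexp_entry \<phi> x y \<eta> (Mid k) Penult = - (y $ k)"
| "nexp_entry \<phi> x y \<eta> (Mid k) Last = - (x $ k) + \<phi> * y $ k / 2"
| "nexp_entry \<phi> x y \<eta> Penult Penult = 1"
| "nexp_entry \<phi> x y \<eta> Penult Last = - \<phi>"
| "nexp_entry \<phi> x y \<eta> Last Last = 1"
| "nexp_entry \<phi> x y \<eta> _ _ = 0"

lemma nexp_nth: "nexp (\<phi>, x, y, \<eta>) $ i $ j = nexp_entry \<phi> x y \<eta> i j"
  by (cases i; cases j)
     (auto simp: nexp_def unip_def inner_add_left inner_add_right inner_diff_left inner_diff_right
        power2_eq_square field_simps inner_commute[of y x])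

text \<open>The Baker-Campbell-Hausdorff product; brackets of length four vanish.\<close>

definition star :: "'k::finite nvec \<Rightarrow> 'k nvec \<Rightarrow> 'k nvec" (infixl "\<star>" 70) where
  "star = (\<lambda>(\<phi>, x, y, \<eta>) (\<phi>', x', y', \<eta>').
     let w = \<phi> *\<^sub>R y' - \<phi>' *\<^sub>R y in
     (\<phi> + \<phi>', x + x' + (1/2) *\<^sub>R w, y + y',
      \<eta> + \<eta>' + (x' \<bullet> y - x \<bullet> y') / 2 + (w \<bullet> y - w \<bullet> y') / 12))"

lemma nlog_mult: "nlog (nexp v ** nexp w) = v \<star> w"
proof (cases v, cases w)
  fix \<phi> x y \<eta> \<phi>' x' y' \<eta>' assume v: "v = (\<phi>, x, y, \<eta>)" and w: "w = (\<phi>', x', y', \<eta>')"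
  have sw: "(\<Sum>k\<in>UNIV. f k * (if k = l then 1 else 0)) = f l" for l :: 'a and f :: "'a \<Rightarrow> real"
    by (simp add: if_distrib[of "\<lambda>x. _ * x"] sum.delta cong: if_cong)
  let ?P = "nexp v ** nexp w"
  have 1: "phi_of ?P = \<phi> + \<phi>'"
    by (simp add: phi_of_def matrix_mul_nth sum_idx v w nexp_nth)
  have 2: "y_of ?P = y + y'"
    by (simp add: y_of_def matrix_mul_nth sum_idx v w nexp_nth vec_eq_iff sw)
  have 3: "x_of ?P = x + (\<phi>/2) *\<^sub>R y + x' + (\<phi>'/2) *\<^sub>R y' + \<phi> *\<^sub>R y'"
    by (simp add: x_of_def matrix_mul_nth sum_idx v w nexp_nth vec_eq_iff sw)
  have mid: "(\<Sum>k\<in>UNIV. (x $ k + \<phi> * y $ k / 2) * - (y' $ k)) = - ((x + (\<phi>/2) *\<^sub>R y) \<bullet> y')"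
    by (simp add: inner_vec_sum sum_negf)
  have 4: "eta_of ?P = \<eta> - (x \<bullet> y) / 2 - \<phi> * (y \<bullet> y) / 6 + \<eta>' - (x' \<bullet> y') / 2 - \<phi>' * (y' \<bullet> y') / 6
      - \<phi> * (y' \<bullet> y') / 2 - (x + (\<phi>/2) *\<^sub>R y) \<bullet> y'"
    unfolding eta_of_def matrix_mul_nth sum_idx v w nexp_nth nexp_entry.simps mid by simp
  show ?thesis
    unfolding nlog_def 1 2 3 4
    by (simp add: star_def v w Let_def vec_eq_iff inner_add_left inner_add_right inner_diff_left inner_diff_right
        field_simps inner_commute[of y' y] inner_commute[of y' x] inner_commute[of y' x']
        inner_commute[of y x] inner_commute[of y x'])
qed

subsection \<open>The exponential map\<close>

definition nmat :: "'k::finite nvec \<Rightarrow> real^('k idx)^('k idx)" where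
  "nmat = (\<lambda>(\<phi>, x, y, \<eta>). n_matrix \<phi> x y \<eta>)"

text \<open>A pattern that contains \<open>nmat\<close> and is closed under products, so that all
  powers in the exponential series can be computed inside it.\<close>

fun upper_entry :: "real \<Rightarrow> real^'k \<Rightarrow> real \<Rightarrow> real \<Rightarrow> real^'k \<Rightarrow> real \<Rightarrow> real \<Rightarrow> real^'k \<Rightarrow> real^'k \<Rightarrow> real
    \<Rightarrow> 'k::finite idx \<Rightarrow> 'k idx \<Rightarrow> real" where
  "upper_entry p q e f r s w m l z First Second = p"
| "upper_entry p q e f r s w m l z First (Mid k) = q $ k"
| "upper_entry p q e f r s w m l z First Penult = e"
| "upper_entry p q e f r s w m l z First Last = f"
| "upper_entry p q e f r s w m l z Second (Mid k) = r $ k"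
| "upper_entry p q e f r s w m l z Second Penult = s"
| "upper_entry p q e f r s w m l z Second Last = w"
| "upper_entry p q e f r s w m l z (Mid k) Penult = m $ k"
| "upper_entry p q e f r s w m l z (Mid k) Last = l $ k"
| "upper_entry p q e f r s w m l z Penult Last = z"
| "upper_entry p q e f r s w m l z _ _ = 0"

definition upper where
  "upper p q e f r s w m l z = (\<chi> i j. upper_entry p q e f r s w m l z i j)"

lemma nmat_upper: "nmat (\<phi>, x, y, \<eta>) = upper \<phi> x \<eta> 0 y 0 (- \<eta>) (- y) (- x) (- \<phi>)"
proof -
  have "nmat (\<phi>, x, y, \<eta>) $ i $ j = upper_entry \<phi> x \<eta> 0 y 0 (- \<eta>) (- y) (- x) (- \<phi>) i j" for i j
    by (cases i; cases j) (simp_all add: nmat_def n_matrix_def)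
  then show ?thesis
    by (simp add: upper_def vec_eq_iff)
qed

lemma nmat_parameters [simp]:
  "phi_of (nmat (\<phi>, x, y, \<eta>)) = \<phi>" "x_of (nmat (\<phi>, x, y, \<eta>)) = x"
  "y_of (nmat (\<phi>, x, y, \<eta>)) = y" "eta_of (nmat (\<phi>, x, y, \<eta>)) = \<eta>"
  by (simp_all add: nmat_def)

lemma upper_mult:
  "upper p q e f r s w m l z ** upper p' q' e' f' r' s' w' m' l' z' =
     upper 0 (p *\<^sub>R r') (p * s' + q \<bullet> m') (p * w' + q \<bullet> l' + e * z')
       0 (r \<bullet> m') (r \<bullet> l' + s * z') 0 (z' *\<^sub>R m) 0" (is "?L = ?R")
proof -
  have "?L $ i $ j = ?R $ i $ j" for i j
    by (cases i; cases j) (simp_all add: matrix_mul_nth sum_idx upper_def inner_vec_sum)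
  then show ?thesis
    by (simp add: vec_eq_iff)
qed

lemma upper_scaleR:
  "c *\<^sub>R upper p q e f r s w m l z = upper (c*p) (c *\<^sub>R q) (c*e) (c*f) (c *\<^sub>R r) (c * s) (c*w) (c *\<^sub>R m) (c *\<^sub>R l) (c*z)"
  (is "?L = ?R")
proof -
  have "?L $ i $ j = ?R $ i $ j" for i j
    by (cases i; cases j) (simp_all add: upper_def)
  then show ?thesis
    by (simp add: vec_eq_iff)
qed

lemma upper_add:
  "upper p q e f r s w m l z + upper p' q' e' f' r' s' w' m' l' z' =
     upper (p + p') (q + q') (e + e') (f + f') (r + r') (s + s') (w + w') (m + m') (l + l') (z + z')"
  (is "?L = ?R")
proof -
  have "?L $ i $ j = ?R $ i $ j" for i j
    by (cases i; cases j) (simp_all add: upper_def)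
  then show ?thesis
    by (simp add: vec_eq_iff)
qed

lemma upper_0: "upper 0 0 0 0 0 0 0 0 0 0 = 0"
proof -
  have "upper 0 0 0 0 0 0 0 0 0 0 $ i $ j = 0" for i j :: "'a idx"
    by (cases i; cases j) (simp_all add: upper_def)
  then show ?thesis
    by (simp add: vec_eq_iff)
qed

lemma nexp_upper:
  "nexp (\<phi>, x, y, \<eta>) = mat 1 + upper \<phi> (x + (\<phi>/2) *\<^sub>R y) (\<eta> - (x \<bullet> y)/2 - \<phi> * (y \<bullet> y)/6)
     (- \<phi> * \<eta> - (x \<bullet> x) / 2 + \<phi>\<^sup>2 * (y \<bullet> y) / 24) y (- (y \<bullet> y) / 2)
     (- \<eta> - (x \<bullet> y) / 2 + \<phi> * (y \<bullet> y) / 6) (- y) (- x + (\<phi>/2) *\<^sub>R y) (- \<phi>)" (is "?L = ?R")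
proof -
  have "?L $ i $ j = ?R $ i $ j" for i j
    by (cases i; cases j) (simp_all add: nexp_nth upper_def mat_def)
  then show ?thesis
    by (simp add: vec_eq_iff)
qed

section \<open>The exponential series and its derivative at the origin\<close>

definition mpow :: "real^'m::finite^'m \<Rightarrow> nat \<Rightarrow> real^'m^'m" where
  "mpow A k = ((**) A ^^ k) (mat 1)"

lemma mpow_simps [simp]: "mpow A 0 = mat 1" "mpow A (Suc k) = A ** mpow A k"
  by (simp_all add: mpow_def)

lemma matrix_exp_mpow: "matrix_exp A = (\<Sum>k. (1 / fact k) *\<^sub>R mpow A k)"
  by (simp add: matrix_exp_def mpow_def)

lemma mpow_nmat:
  fixes \<phi> \<eta> :: real and x y :: "real^'k::finite"
  defines "A \<equiv> nmat (\<phi>, x, y, \<eta>)"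
  shows "mpow A 1 = upper \<phi> x \<eta> 0 y 0 (- \<eta>) (- y) (- x) (- \<phi>)"
    and "mpow A 2 = upper 0 (\<phi> *\<^sub>R y) (- (x \<bullet> y)) (- 2 * \<phi> * \<eta> - x \<bullet> x) 0 (- (y \<bullet> y)) (- (x \<bullet> y)) 0 (\<phi> *\<^sub>R y) 0"
    and "mpow A 3 = upper 0 0 (- \<phi> * (y \<bullet> y)) 0 0 0 (\<phi> * (y \<bullet> y)) 0 0 0"
    and "mpow A 4 = upper 0 0 0 (\<phi>\<^sup>2 * (y \<bullet> y)) 0 0 0 0 0 0"
    and "k \<ge> 5 \<Longrightarrow> mpow A k = 0"
proof -
  have A: "A = upper \<phi> x \<eta> 0 y 0 (- \<eta>) (- y) (- x) (- \<phi>)"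
    by (simp add: A_def nmat_upper)
  have S: "mpow A 1 = A ** mpow A 0" "mpow A 2 = A ** mpow A 1" "mpow A 3 = A ** mpow A 2"
    "mpow A 4 = A ** mpow A 3" "mpow A 5 = A ** mpow A 4"
    by (simp_all add: eval_nat_numeral)
  show 1: "mpow A 1 = upper \<phi> x \<eta> 0 y 0 (- \<eta>) (- y) (- x) (- \<phi>)"
    unfolding S by (simp add: A)
  show 2: "mpow A 2 = upper 0 (\<phi> *\<^sub>R y) (- (x \<bullet> y)) (- 2 * \<phi> * \<eta> - x \<bullet> x) 0 (- (y \<bullet> y)) (- (x \<bullet> y)) 0 (\<phi> *\<^sub>R y) 0"
    unfolding S(2) 1 unfolding A upper_mult by (simp add: inner_commute mult.commute[of \<eta>] mult.assoc)
  show 3: "mpow A 3 = upper 0 0 (- \<phi> * (y \<bullet> y)) 0 0 0 (\<phi> * (y \<bullet> y)) 0 0 0"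
    unfolding S(3) 2 unfolding A upper_mult by (simp add: inner_commute)
  show 4: "mpow A 4 = upper 0 0 0 (\<phi>\<^sup>2 * (y \<bullet> y)) 0 0 0 0 0 0"
    unfolding S(4) 3 unfolding A upper_mult by (simp add: power2_eq_square mult.assoc)
  have 5: "mpow A 5 = 0"
    unfolding S(5) 4 unfolding A upper_mult by (simp add: upper_0)
  show "mpow A k = 0" if "k \<ge> 5"
    using that by (induction k rule: dec_induct) (use 5 in auto)
qed

lemma matrix_exp_nmat: "matrix_exp (nmat v) = nexp v"
proof (cases v)
  case (fields \<phi> x y \<eta>)
  let ?A = "nmat v"
  have "matrix_exp ?A = (\<Sum>k\<in>{..<5}. (1 / fact k) *\<^sub>R mpow ?A k)"
    unfolding matrix_exp_mpow
    by (rule suminf_finite) (auto simp: fields mpow_nmat(5))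
  also have "{..<5} = {0,1,2,3,4::nat}" by auto
  also have "(\<Sum>k\<in>{0,1,2,3,4}. (1 / fact k) *\<^sub>R mpow ?A k) = nexp v"
    unfolding fields
    by (simp add: mpow_nmat(1)[unfolded One_nat_def] mpow_nmat(2-4) del: mpow_simps)
       (simp add: upper_scaleR upper_add nexp_upper fact_numeral algebra_simps add_divide_distrib diff_divide_distrib)
  finally show ?thesis .
qed

lemma nmat_scaleR: "nmat (t *\<^sub>R v) = t *\<^sub>R nmat v"
  by (cases v) (simp add: nmat_upper upper_scaleR)

lemma nmat_add: "nmat (v + w) = nmat v + nmat w"
  by (cases v, cases w) (simp add: nmat_upper upper_add)

lemma linear_nmat: "linear nmat"
  by (simp add: linear_iff nmat_scaleR nmat_add)

lemma nmat_inject [simp]: "nmat v = nmat w \<longleftrightarrow> v = w"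
proof (cases v, cases w)
  fix \<phi> x y \<eta> \<phi>' x' y' \<eta>' assume v: "v = (\<phi>, x, y, \<eta>)" and w: "w = (\<phi>', x', y', \<eta>')"
  have "v = w" if "nmat v = nmat w"
    using arg_cong[OF that, of phi_of] arg_cong[OF that, of x_of] arg_cong[OF that, of y_of]
      arg_cong[OF that, of eta_of] by (simp add: v w)
  then show ?thesis by blast
qed

lemma mpow_scaleR: "mpow (t *\<^sub>R A) k = t ^ k *\<^sub>R mpow A k"
proof (induction k)
  case (Suc k)
  then show ?case
    by (simp add: vec_eq_iff matrix_mul_nth sum_distrib_left algebra_simps)
qed simp

text \<open>This is meant for an element of \<open>lie_algebra H\<close> before it is known to be
  nilpotent, so the series is infinite. The entries of the k-th power of \<open>A\<close> are at
  most \<open>B ^ k\<close>; hence every entry of the exponential is an everywhere convergent power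
  series in t and may be differentiated term by term.\<close>

lemma matrix_exp_deriv_0:
  fixes A :: "real^'m::finite^'m"
  shows "((\<lambda>t. (1/t) *\<^sub>R (matrix_exp (t *\<^sub>R A) - mat 1)) \<longlongrightarrow> A) (at 0)"
proof -
  define M where "M = norm A"
  have M: "\<bar>A $ i $ j\<bar> \<le> M" for i j
    using component_le_norm_cart[of "A $ i" j] Finite_Cartesian_Product.norm_nth_le[of A i] unfolding M_def by linarith
  define B where "B = real CARD('m) * M"
  have bound: "\<bar>mpow A k $ i $ j\<bar> \<le> B ^ k" for k i j
  proof (induction k arbitrary: i j)
    case 0
    then show ?case by (simp add: mat_def)
  next
    case (Suc k)
    have "\<bar>mpow A (Suc k) $ i $ j\<bar> \<le> (\<Sum>l\<in>UNIV. \<bar>A $ i $ l * mpow A k $ l $ j\<bar>)"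
      by (simp add: matrix_mul_nth)
    also have "\<dots> \<le> (\<Sum>l\<in>(UNIV::'m set). M * B ^ k)"
      unfolding abs_mult by (intro sum_mono mult_mono M Suc.IH) (auto simp: M_def)
    also have "\<dots> = B ^ Suc k"
      by (simp add: B_def)
    finally show ?case .
  qed
  define C where "C = real CARD('m) * real CARD('m)"
  have nrm: "norm (mpow A k) \<le> C * B ^ k" for k
  proof -
    have "norm (mpow A k) \<le> (\<Sum>i\<in>UNIV. norm (mpow A k $ i))"
      by (simp add: norm_vec_def L2_set_le_sum)
    also have "\<dots> \<le> (\<Sum>i\<in>UNIV. \<Sum>j\<in>UNIV. \<bar>mpow A k $ i $ j\<bar>)"
      by (intro sum_mono) (simp add: norm_le_l1_cart)
    also have "\<dots> \<le> (\<Sum>i\<in>(UNIV::'m set). \<Sum>j\<in>(UNIV::'m set). B ^ k)"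
      by (intro sum_mono bound)
    finally show ?thesis by (simp add: C_def)
  qed
  have summ: "summable (\<lambda>k. (1 / fact k) *\<^sub>R mpow (t *\<^sub>R A) k)" for t
  proof (rule summable_comparison_test)
    have "norm ((1 / fact k) *\<^sub>R mpow (t *\<^sub>R A) k) \<le> C * (inverse (fact k) * (\<bar>t\<bar> * B) ^ k)" for k
    proof -
      have "norm ((1 / fact k) *\<^sub>R mpow (t *\<^sub>R A) k) = inverse (fact k) * (\<bar>t\<bar> ^ k * norm (mpow A k))"
        by (simp add: mpow_scaleR power_abs abs_mult divide_inverse)
      also have "\<dots> \<le> inverse (fact k) * (\<bar>t\<bar> ^ k * (C * B ^ k))"
        by (intro mult_left_mono nrm) auto
      finally show ?thesis by (simp add: power_mult_distrib ac_simps)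
    qed
    then show "\<exists>N. \<forall>n\<ge>N. norm ((1 / fact n) *\<^sub>R mpow (t *\<^sub>R A) n) \<le> C * (inverse (fact n) * (\<bar>t\<bar> * B) ^ n)"
      by blast
    show "summable (\<lambda>n. C * (inverse (fact n) * (\<bar>t\<bar> * B) ^ n))"
      by (intro summable_mult summable_exp)
  qed
  show ?thesis
  proof (intro vec_tendstoI)
    fix i j
    define c where "c k = mpow A k $ i $ j / fact k" for k
    have bl: "bounded_linear (\<lambda>X :: real^'m^'m. X $ i $ j)"
      by (intro bounded_linear_compose[OF bounded_linear_vec_nth, unfolded o_def] bounded_linear_vec_nth)
    have eq: "(1 / fact k) *\<^sub>R mpow (t *\<^sub>R A) k $ i $ j = c k * t ^ k" for k t
      by (simp add: c_def mpow_scaleR)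
    have summ': "summable (\<lambda>k. c k * t ^ k)" for t
      using bounded_linear.summable[OF bl summ[of t]] by (simp add: eq[symmetric])
    have val: "matrix_exp (t *\<^sub>R A) $ i $ j = (\<Sum>k. c k * t ^ k)" for t
      unfolding matrix_exp_mpow bounded_linear.suminf[OF bl summ, of t]
      by (simp add: eq[symmetric])
    have "DERIV (\<lambda>t. \<Sum>k. c k * t ^ k) 0 :> (\<Sum>k. diffs c k * 0 ^ k)"
      by (rule termdiffs_strong_converges_everywhere[OF summ'])
    then have "((\<lambda>t. ((\<Sum>k. c k * t ^ k) - (\<Sum>k. c k * 0 ^ k)) / t) \<longlongrightarrow> diffs c 0) (at 0)"
      unfolding DERIV_def powser_zero by simp
    moreover have "diffs c 0 = A $ i $ j"
      by (simp add: diffs_def c_def)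
    moreover have "(\<Sum>k. c k * 0 ^ k) = mat 1 $ i $ j"
      unfolding powser_zero by (simp add: c_def)
    ultimately show "((\<lambda>t. ((1/t) *\<^sub>R (matrix_exp (t *\<^sub>R A) - mat 1)) $ i $ j) \<longlongrightarrow> A $ i $ j) (at 0)"
      by (simp add: val)
  qed
qed

text \<open>The logarithms of \<open>matrix_exp (t X)\<close>, divided by \<open>t\<close>, converge to a vector of parameters of \<open>X\<close>.\<close>

lemma one_parameter_in_N:
  fixes X :: "real^('k::{finite,linorder} idx)^('k idx)"
  assumes "\<And>t. matrix_exp (t *\<^sub>R X) \<in> unipotent_N"
  shows "X \<in> range nmat"
proof -
  define p q r e where "p = phi_of X" and "q = x_of X" and "r = y_of X" and "e = eta_of X"
  define g where "g t = (1/t) *\<^sub>R (matrix_exp (t *\<^sub>R X) - mat 1)" for t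
  have lim: "(g \<longlongrightarrow> X) (at 0)"
    unfolding g_def by (rule matrix_exp_deriv_0)
  have limc: "((\<lambda>t. g t $ i $ j) \<longlongrightarrow> X $ i $ j) (at 0)" for i j
    by (intro tendsto_vec_nth lim)
  have P: "((\<lambda>t. phi_of (g t)) \<longlongrightarrow> p) (at 0)" and Q: "((\<lambda>t. x_of (g t)) \<longlongrightarrow> q) (at 0)"
    and R: "((\<lambda>t. y_of (g t)) \<longlongrightarrow> r) (at 0)" and E: "((\<lambda>t. eta_of (g t)) \<longlongrightarrow> e) (at 0)"
    unfolding p_def q_def r_def e_def phi_of_def x_of_def y_of_def eta_of_def
    by (intro limc vec_tendstoI; simp add: limc)+
  \<comment> \<open>These are the entries of \<open>unip\<close> at t times the parameters of
    \<open>g t\<close>, divided by t. The quadratic and cubic terms keep a factor t and vanish in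
    the limit, so only the linear pattern of \<open>nmat\<close> remains.\<close>
  define a where "a t = upper (phi_of (g t)) (x_of (g t)) (eta_of (g t))
      (t * (- phi_of (g t) * eta_of (g t) - phi_of (g t) * (x_of (g t) \<bullet> y_of (g t)) * t +
         (phi_of (g t))\<^sup>2 * (y_of (g t) \<bullet> y_of (g t)) / 2 * t\<^sup>2
       - ((x_of (g t) - (t * phi_of (g t)) *\<^sub>R y_of (g t)) \<bullet> (x_of (g t) - (t * phi_of (g t)) *\<^sub>R y_of (g t))) / 2))
      (y_of (g t)) (t * (- (y_of (g t) \<bullet> y_of (g t)) / 2))
      (- eta_of (g t) + t * (t * phi_of (g t) * (y_of (g t) \<bullet> y_of (g t)) / 2 - x_of (g t) \<bullet> y_of (g t)))
      (- y_of (g t)) (- x_of (g t) + (t * phi_of (g t)) *\<^sub>R y_of (g t)) (- phi_of (g t))" for t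
  have ga: "g t = a t" if "t \<noteq> 0" for t
  proof -
    define E where "E = matrix_exp (t *\<^sub>R X)"
    have E: "E = unip (phi_of E) (x_of E) (y_of E) (eta_of E)"
      unfolding E_def by (rule unipotent_N_eq_unip[OF assms])
    have gE: "phi_of E = t * phi_of (g t)" "x_of E = t *\<^sub>R x_of (g t)" "y_of E = t *\<^sub>R y_of (g t)" "eta_of E = t * eta_of (g t)"
      using that by (auto simp: g_def E_def[symmetric] phi_of_def x_of_def y_of_def eta_of_def vec_eq_iff mat_def)
    have "E $ i $ j - mat 1 $ i $ j = t * (a t $ i $ j)" for i j
      by (subst E, unfold gE)
         (cases i; cases j; simp add: unip_def a_def upper_def mat_def inner_diff_left inner_diff_right
            power2_eq_square field_simps)
    then show ?thesis
      using that by (simp add: g_def E_def[symmetric] vec_eq_iff)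
  qed
  have Qk: "((\<lambda>t. x_of (g t) $ k) \<longlongrightarrow> q $ k) (at 0)" and Rk: "((\<lambda>t. y_of (g t) $ k) \<longlongrightarrow> r $ k) (at 0)" for k
    by (intro tendsto_vec_nth Q R)+
  have "(a \<longlongrightarrow> nmat (p, q, r, e)) (at 0)"
    unfolding nmat_upper
  proof (intro vec_tendstoI)
    fix i j
    show "((\<lambda>t. a t $ i $ j) \<longlongrightarrow> upper p q e 0 r 0 (- e) (- r) (- q) (- p) $ i $ j) (at 0)"
      unfolding a_def upper_def vec_lambda_beta
      by (cases i; cases j; auto intro!: tendsto_eq_intros P Q R E Qk Rk)
  qed
  then have "(g \<longlongrightarrow> nmat (p, q, r, e)) (at 0)"
    by (rule Lim_transform_eventually) (auto simp: eventually_at_filter ga)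
  with lim have "X = nmat (p, q, r, e)"
    using tendsto_unique trivial_limit_at by blast
  then show ?thesis by blast
qed

subsection \<open>Closed connected subgroups of the unipotent group\<close>

text \<open>The commutator of the matrices \<open>nmat\<close>, in coordinates.\<close>

definition br :: "'k::finite nvec \<Rightarrow> 'k nvec \<Rightarrow> 'k nvec" where
  "br = (\<lambda>(\<phi>, x, y, \<eta>) (\<phi>', x', y', \<eta>'). (0, \<phi> *\<^sub>R y' - \<phi>' *\<^sub>R y, 0, x' \<bullet> y - x \<bullet> y'))"

lemma star_br: "v \<star> w = v + w + (1/2) *\<^sub>R br v w + (1/12) *\<^sub>R (br v (br v w) + br w (br w v))"
  by (cases v, cases w)
     (simp add: star_def br_def Let_def inner_diff_left inner_diff_right algebra_simps add_divide_distrib diff_divide_distrib)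

lemma star_0 [simp]: "v \<star> 0 = v" "0 \<star> v = v"
  by (cases v; simp add: star_def Let_def zero_prod_def)+

lemma star_eq_0D: "v \<star> w = 0 \<Longrightarrow> w = - v"
  by (cases v, cases w)
     (auto simp: star_def Let_def zero_prod_def add_eq_0_iff add_eq_0_iff2 inner_diff_left inner_diff_right algebra_simps)

lemma star_line: "(a *\<^sub>R v) \<star> (b *\<^sub>R v) = (a + b) *\<^sub>R v"
  by (cases v) (simp add: star_def Let_def algebra_simps)

lemma continuous_on_star:
  assumes "continuous_on S f" "continuous_on S g"
  shows "continuous_on S (\<lambda>u. f u \<star> g u)"
  unfolding star_def case_prod_beta Let_def by (intro continuous_intros assms) auto

text \<open>After dilation by r the bracket terms of the Baker-Campbell-Hausdorff product carry
  factors r and r^2, so at small scale the group product is addition.\<close>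

lemma star_dilate_tendsto:
  assumes "(r \<longlongrightarrow> 0) F" "eventually (\<lambda>n. r n \<noteq> (0::real)) F" "(a \<longlongrightarrow> u) F" "(b \<longlongrightarrow> v) F"
  shows "((\<lambda>n. (1 / r n) *\<^sub>R ((r n *\<^sub>R a n) \<star> (r n *\<^sub>R b n))) \<longlongrightarrow> u + v) F"
proof -
  let ?f = "\<lambda>r a b. a + b + (r / 2) *\<^sub>R br a b + (r^2 / 12) *\<^sub>R (br a (br a b) + br b (br b a))"
  have br: "((\<lambda>n. br (f n) (g n)) \<longlongrightarrow> br f' g') F" if "(f \<longlongrightarrow> f') F" "(g \<longlongrightarrow> g') F" for f g f' g'
    using that unfolding br_def case_prod_beta by (intro tendsto_intros)
  have "((\<lambda>n. ?f (r n) (a n) (b n)) \<longlongrightarrow> ?f 0 u v) F"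
    by (intro tendsto_intros br assms) auto
  moreover have "eventually (\<lambda>n. ?f (r n) (a n) (b n) = (1 / r n) *\<^sub>R ((r n *\<^sub>R a n) \<star> (r n *\<^sub>R b n))) F"
    using assms(2)
  proof eventually_elim
    case (elim n)
    have s: "br (c *\<^sub>R x) (d *\<^sub>R y) = (c * d) *\<^sub>R br x y" for c d :: real and x y :: "'b nvec"
      by (cases x, cases y) (simp add: br_def algebra_simps)
    have "(r n *\<^sub>R a n) \<star> (r n *\<^sub>R b n) = r n *\<^sub>R ?f (r n) (a n) (b n)"
      unfolding star_br s
      using s[of "r n" "a n" "r n * r n"] s[of "r n" "b n" "r n * r n"]
      by (simp add: scaleR_add_right power2_eq_square)
    then show ?case
      using elim by simp
  qed
  ultimately show ?thesis
    by (auto elim: Lim_transform_eventually)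
qed

text \<open>The right-hand side is the adjoint action exp (ad v), which stops at second order
  because brackets of length four vanish. It is used to obtain brackets from conjugations.\<close>

lemma star_conj:
  "(v \<star> (s *\<^sub>R w)) \<star> (- v) = s *\<^sub>R (w + br v w + (1/2) *\<^sub>R br v (br v w))"
  by (cases v, cases w)
     (simp add: star_def br_def Let_def vec_eq_iff inner_diff_left inner_diff_right inner_add_left inner_add_right
       field_simps inner_commute)

lemma continuous_on_nexp: "continuous_on S nexp"
proof -
  have "continuous_on S (\<lambda>v :: 'a nvec. nexp v $ i $ j)" for i j
  proof -
    have "nexp v $ i $ j = nexp_entry (fst v) (fst (snd v)) (fst (snd (snd v))) (snd (snd (snd v))) i j" for v :: "'a nvec"
      by (cases v) (simp add: nexp_nth)
    then show ?thesis
      by (cases i; cases j) (auto intro!: continuous_intros)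
  qed
  then have "continuous_on S (\<lambda>v. \<chi> i j. nexp v $ i $ j)"
    by (intro continuous_on_vec_lambda)
  then show ?thesis by simp
qed

lemma continuous_on_nlog: "continuous_on S nlog"
  unfolding nlog_def phi_of_def x_of_def y_of_def eta_of_def by (intro continuous_intros) auto

locale unipotent_subgroup =
  fixes H :: "(real^('k::{finite,linorder} idx)^('k idx)) set"
  assumes subgroup_H: "subgroup H SO2n" and H_subset_N: "H \<subseteq> unipotent_N"
    and closedin_H: "closedin (top_of_set unipotent_N) H" and connected_H: "connected H"
begin

text \<open>A priori only a closed set: for a discrete subgroup it would contain no line. The set
  \<open>lie\<close> collects the lines in it, and connectedness is what makes the two
  agree.\<close>

definition logs :: "'k nvec set" where
  "logs = {v. nexp v \<in> H}"

definition lie :: "'k nvec set" where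
  "lie = {v. \<forall>t. t *\<^sub>R v \<in> logs}"

lemma closed_H: "closed H"
  using closedin_H closed_unipotent_N closedin_closed_trans by blast

lemma closed_logs: "closed logs"
  using closed_vimage[OF closed_H continuous_on_nexp] by (simp add: logs_def vimage_def)

lemma nexp_star: "v \<in> logs \<Longrightarrow> w \<in> logs \<Longrightarrow> nexp (v \<star> w) = nexp v ** nexp w"
proof -
  assume "v \<in> logs" "w \<in> logs"
  then have "nexp v ** nexp w \<in> H"
    using subgroup.m_closed[OF subgroup_H, of "nexp v" "nexp w"] by (simp add: logs_def)
  then show ?thesis
    using nexp_nlog[of "nexp v ** nexp w"] H_subset_N by (auto simp: nlog_mult)
qed

lemma star_logs: "v \<in> logs \<Longrightarrow> w \<in> logs \<Longrightarrow> v \<star> w \<in> logs"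
  using subgroup.m_closed[OF subgroup_H, of "nexp v" "nexp w"]
  by (simp add: logs_def nexp_star[unfolded logs_def])

text \<open>Associativity is inherited from the matrix product through the injective map
  \<open>nexp\<close>; no polynomial identity has to be checked.\<close>

lemma star_logs_assoc:
  "u \<in> logs \<Longrightarrow> v \<in> logs \<Longrightarrow> w \<in> logs \<Longrightarrow> (u \<star> v) \<star> w = u \<star> (v \<star> w)"
  by (subst nexp_inject[symmetric]) (simp add: nexp_star star_logs matrix_mul_assoc)

lemma nexp_0: "nexp 0 = mat 1"
  using matrix_exp_nmat[of 0] nexp_upper[of 0 0 0 0] by (simp add: zero_prod_def upper_0)

lemma zero_logs: "0 \<in> logs"
  using subgroup.one_closed[OF subgroup_H] by (simp add: logs_def nexp_0)

lemma uminus_logs: "v \<in> logs \<Longrightarrow> - v \<in> logs"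
proof -
  assume v: "v \<in> logs"
  then have vH: "nexp v \<in> H" by (simp add: logs_def)
  then have c: "nexp v \<in> carrier SO2n"
    using subgroup.subset[OF subgroup_H] by blast
  have a: "adj (nexp v) \<in> H"
    using subgroup.m_inv_closed[OF subgroup_H vH] adj_inverse(4)[OF c] by simp
  define w where "w = nlog (adj (nexp v))"
  have w: "nexp w = adj (nexp v)"
    using nexp_nlog a H_subset_N by (auto simp: w_def)
  have "v \<star> w = nlog (nexp 0)"
    unfolding nlog_mult[symmetric] w nexp_0 adj_inverse(2)[OF c] ..
  then have "w = - v"
    by (simp add: star_eq_0D)
  then show ?thesis
    using a w by (simp add: logs_def)
qed

lemma star_uminus [simp]: "v \<star> (- v) = 0" "(- v) \<star> v = 0" for v :: "'k nvec"
  using star_line[of 1 v "-1"] star_line[of "-1" v 1] by simp_all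

lemma nat_logs: "v \<in> logs \<Longrightarrow> real n *\<^sub>R v \<in> logs"
proof (induction n)
  case (Suc n)
  then show ?case
    using star_logs[of "real n *\<^sub>R v" v] star_line[of "real n" v 1] by (simp add: algebra_simps)
qed (simp add: zero_logs)

lemma int_logs: "v \<in> logs \<Longrightarrow> real_of_int n *\<^sub>R v \<in> logs"
  using nat_logs[of v "nat n"] uminus_logs[OF nat_logs[of v "nat (- n)"]]
  by (cases "n \<ge> 0") auto

lemma lie_logs: "v \<in> lie \<Longrightarrow> v \<in> logs"
  unfolding lie_def by (auto dest: spec[of _ 1])

lemma lie_scaleR: "v \<in> lie \<Longrightarrow> c *\<^sub>R v \<in> lie"
  by (simp add: lie_def)

text \<open>The closed subgroup argument: integer multiples of \<open>z n\<close> are logarithms of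
  powers, hence lie in \<open>logs\<close>. With the multiplier
  \<open>\<lfloor>t / r n\<rfloor>\<close> they converge to t times \<open>Y\<close>, because
  \<open>r n\<close> tends to 0 and rounding costs at most \<open>r n\<close>.\<close>

lemma lie_limit:
  fixes r :: "nat \<Rightarrow> real"
  assumes z: "\<And>n. z n \<in> logs" and r: "r \<longlonglongrightarrow> 0" "\<And>n. r n > 0" and lim: "(\<lambda>n. (1 / r n) *\<^sub>R z n) \<longlonglongrightarrow> Y"
  shows "Y \<in> lie"
  unfolding lie_def
proof (intro CollectI allI)
  fix t :: real
  have "(\<lambda>n. real_of_int \<lfloor>t / r n\<rfloor> * r n) \<longlonglongrightarrow> t"
  proof (rule real_tendsto_sandwich)
    have fl: "t - r n \<le> real_of_int \<lfloor>t / r n\<rfloor> * r n" "real_of_int \<lfloor>t / r n\<rfloor> * r n \<le> t" for n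
    proof -
      have "t / r n - 1 \<le> real_of_int \<lfloor>t / r n\<rfloor>"
        by linarith
      then show "t - r n \<le> real_of_int \<lfloor>t / r n\<rfloor> * r n"
        using r(2)[of n] by (simp add: field_simps)
      show "real_of_int \<lfloor>t / r n\<rfloor> * r n \<le> t"
        using mult_right_mono[OF of_int_floor_le[of "t / r n"], of "r n"] r(2)[of n] by simp
    qed
    show "\<forall>\<^sub>F n in sequentially. t - r n \<le> real_of_int \<lfloor>t / r n\<rfloor> * r n"
      "\<forall>\<^sub>F n in sequentially. real_of_int \<lfloor>t / r n\<rfloor> * r n \<le> t"
      by (intro always_eventually allI fl)+
    show "(\<lambda>n. t - r n) \<longlonglongrightarrow> t"
      using tendsto_diff[OF tendsto_const r(1), of t] by simp
  qed simp
  from tendsto_scaleR[OF this lim]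
  have "(\<lambda>n. real_of_int \<lfloor>t / r n\<rfloor> *\<^sub>R z n) \<longlonglongrightarrow> t *\<^sub>R Y"
    using r(2) by (simp add: less_imp_neq[THEN not_sym])
  then show "t *\<^sub>R Y \<in> logs"
    by (rule closed_sequentially[OF closed_logs, rotated]) (rule int_logs[OF z])
qed

text \<open>Closure under sums is a Lie product formula: the product of exp (r v) and exp (r w) has
  logarithm close to r (v + w), and \<open>lie_limit\<close> applies as r tends to 0.\<close>

lemma subspace_lie: "subspace lie"
proof (rule subspaceI)
  show "0 \<in> lie" by (simp add: lie_def zero_logs)
  show "c *\<^sub>R v \<in> lie" if "v \<in> lie" for c v
    by (rule lie_scaleR[OF that])
  show "v + w \<in> lie" if v: "v \<in> lie" and w: "w \<in> lie" for v w
  proof -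
    define r where "r n = 1 / real (Suc n)" for n
    have r: "r \<longlonglongrightarrow> 0" "r n > 0" for n
      unfolding r_def using LIMSEQ_inverse_real_of_nat by (simp_all add: inverse_eq_divide)
    show ?thesis
    proof (rule lie_limit[OF _ r])
      show "(r n *\<^sub>R v) \<star> (r n *\<^sub>R w) \<in> logs" for n
        by (intro star_logs lie_logs lie_scaleR v w)
      show "(\<lambda>n. (1 / r n) *\<^sub>R ((r n *\<^sub>R v) \<star> (r n *\<^sub>R w))) \<longlonglongrightarrow> v + w"
        using r by (intro star_dilate_tendsto) (auto simp: less_imp_neq[THEN not_sym])
    qed
  qed
qed

text \<open>Conjugation by the exponentials of \<open>v\<close> and of \<open>- v\<close> keeps
  \<open>w\<close> in \<open>lie\<close>. In the difference of the two results the even-order terms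
  cancel and twice the bracket is left.\<close>

lemma br_lie:
  assumes v: "v \<in> lie" and w: "w \<in> lie"
  shows "br v w \<in> lie"
proof -
  have Ad: "w + br u w + (1/2) *\<^sub>R br u (br u w) \<in> lie" if "u \<in> lie" for u
  proof -
    have "s *\<^sub>R (w + br u w + (1/2) *\<^sub>R br u (br u w)) \<in> logs" for s
      unfolding star_conj[symmetric]
      by (intro star_logs uminus_logs lie_logs lie_scaleR that w)
    then show ?thesis by (simp add: lie_def)
  qed
  have "- v \<in> lie"
    using subspace_lie v by (rule subspace_neg)
  from subspace_diff[OF subspace_lie Ad[OF v] Ad[OF this]]
  have "(w + br v w + (1/2) *\<^sub>R br v (br v w)) - (w + br (- v) w + (1/2) *\<^sub>R br (- v) (br (- v) w)) \<in> lie" .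
  also have "(w + br v w + (1/2) *\<^sub>R br v (br v w)) - (w + br (- v) w + (1/2) *\<^sub>R br (- v) (br (- v) w)) = 2 *\<^sub>R br v w"
    by (cases v, cases w) (simp add: br_def vec_eq_iff algebra_simps)
  finally have "2 *\<^sub>R br v w \<in> lie" .
  from lie_scaleR[OF this, of "1/2"] show ?thesis by simp
qed

lemma star_lie: "v \<in> lie \<Longrightarrow> w \<in> lie \<Longrightarrow> v \<star> w \<in> lie"
  unfolding star_br by (intro subspace_add[OF subspace_lie] subspace_scale[OF subspace_lie] br_lie)

lemma closed_lie: "closed lie"
  using subspace_lie by (rule closed_subspace)

text \<open>An element of \<open>logs - lie\<close> near the origin may be replaced by the shortest one in its orbit under \<open>lie\<close>. If
  such elements existed arbitrarily near the origin, their directions would accumulate at a vector of \<open>lie\<close>,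
  and a translation along it would shorten them further.\<close>

lemma shortest_in_orbit:
  assumes z: "z \<in> logs" "z \<notin> lie"
  obtains w where "w \<in> logs" "w \<notin> lie" "norm w \<le> norm z" "\<And>X. X \<in> lie \<Longrightarrow> norm w \<le> norm (X \<star> w)"
proof -
  define S where "S = {u \<in> logs. u \<star> (- z) \<in> lie}"
  have "closed ((\<lambda>u. u \<star> (- z)) -` lie)"
    by (rule closed_vimage[OF closed_lie]) (intro continuous_on_star continuous_intros)
  then have "closed S"
    using closed_logs unfolding S_def
    by (simp add: closed_Int vimage_def Collect_conj_eq)
  moreover have zS: "z \<in> S"
    using z subspace_0[OF subspace_lie] by (simp add: S_def)
  ultimately obtain w where w: "w \<in> S" and min: "\<And>u. u \<in> S \<Longrightarrow> dist 0 w \<le> dist 0 u"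
    using distance_attains_inf[of S 0] by blast
  show ?thesis
  proof
    show wl: "w \<in> logs" using w by (simp add: S_def)
    have zl: "- z \<in> logs" using z by (intro uminus_logs)
    show "w \<notin> lie"
    proof
      assume "w \<in> lie"
      then have "(- w) \<star> (w \<star> (- z)) \<in> lie"
        using w by (intro star_lie[of "- w"] subspace_neg[OF subspace_lie]) (auto simp: S_def)
      moreover have "(- w) \<star> (w \<star> (- z)) = - z"
        using star_logs_assoc[of "- w" w "- z"] by (simp add: uminus_logs wl zl)
      ultimately have "- z \<in> lie" by simp
      then show False
        using z subspace_neg[OF subspace_lie, of "- z"] by simp
    qed
    show "norm w \<le> norm z" using min[OF zS] by simp
    show "norm w \<le> norm (X \<star> w)" if X: "X \<in> lie" for X
    proof -
      have "(X \<star> w) \<star> (- z) = X \<star> (w \<star> (- z))"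
        by (intro star_logs_assoc lie_logs X wl zl)
      then have "X \<star> w \<in> S"
        using w X by (auto simp: S_def intro: star_lie star_logs lie_logs)
      then show ?thesis using min by fastforce
    qed
  qed
qed

lemma logs_near_0: "\<exists>\<epsilon>>0. \<forall>z\<in>logs. norm z < \<epsilon> \<longrightarrow> z \<in> lie"
proof (rule ccontr)
  assume "\<not> ?thesis"
  then have ex: "\<exists>z. z \<in> logs \<and> norm z < 1 / real (Suc n) \<and> z \<notin> lie" for n
    by (meson of_nat_0_less_iff zero_less_Suc zero_less_divide_1_iff)
  have "\<exists>w. w \<in> logs \<and> w \<notin> lie \<and> norm w < 1 / real (Suc n) \<and> (\<forall>X\<in>lie. norm w \<le> norm (X \<star> w))" for n
  proof -
    from ex[of n]
    obtain z where z: "z \<in> logs" "norm z < 1 / real (Suc n)" "z \<notin> lie" by blast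
    obtain w where "w \<in> logs" "w \<notin> lie" "norm w \<le> norm z" "\<And>X. X \<in> lie \<Longrightarrow> norm w \<le> norm (X \<star> w)"
      using shortest_in_orbit[OF z(1,3)] by metis
    with z(2) show ?thesis
      by (intro exI[of _ w]) auto
  qed
  then have "\<forall>n. \<exists>w. w \<in> logs \<and> w \<notin> lie \<and> norm w < 1 / real (Suc n) \<and> (\<forall>X\<in>lie. norm w \<le> norm (X \<star> w))"
    by blast
  from choice[OF this] obtain w where
    w': "\<forall>n. w n \<in> logs \<and> w n \<notin> lie \<and> norm (w n) < 1 / real (Suc n) \<and> (\<forall>X\<in>lie. norm (w n) \<le> norm (X \<star> w n))"
    by blast
  then have w: "\<And>n. w n \<in> logs" "\<And>n. w n \<notin> lie" "\<And>n. norm (w n) < 1 / real (Suc n)"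
    "\<And>n X. X \<in> lie \<Longrightarrow> norm (w n) \<le> norm (X \<star> w n)"
    by blast+
  have w0: "norm (w n) > 0" for n
    using w(2)[of n] subspace_0[OF subspace_lie] by auto
  have "(\<lambda>n. norm (w n)) \<longlonglongrightarrow> 0"
    by (rule real_tendsto_sandwich[OF _ _ tendsto_const LIMSEQ_inverse_real_of_nat])
       (use w(3) in \<open>auto intro!: always_eventually less_imp_le simp: inverse_eq_divide\<close>)
  moreover have "\<And>n. (1 / norm (w n)) *\<^sub>R w n \<in> sphere 0 1"
    using w0 by (simp add: less_imp_neq[THEN not_sym])
  then obtain Y s where Y: "Y \<in> sphere 0 1" and s: "strict_mono s"
    and lim: "((\<lambda>n. (1 / norm (w n)) *\<^sub>R w n) \<circ> s) \<longlonglongrightarrow> Y"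
    using compact_sphere[of "0 :: 'k nvec" 1] unfolding compact_def
    by (elim allE[of _ "\<lambda>n. (1 / norm (w n)) *\<^sub>R w n"]) auto
  ultimately have r: "(\<lambda>n. norm (w (s n))) \<longlonglongrightarrow> 0"
    using LIMSEQ_subseq_LIMSEQ[OF _ s] by (auto simp: o_def)
  have "Y \<in> lie"
    by (rule lie_limit[OF _ r w0]) (use w(1) lim in \<open>auto simp: o_def\<close>)
  then have mY: "- Y \<in> lie"
    using subspace_neg[OF subspace_lie] by blast
  \<comment> \<open>The translate of \<open>w (s n)\<close> by its limiting direction, rescaled. It
    tends to \<open>- Y + Y\<close>, that is to 0, while minimality in the orbit keeps its norm at
    least one.\<close>
  define d where "d n = (1 / norm (w (s n))) *\<^sub>R ((norm (w (s n)) *\<^sub>R (- Y)) \<star>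
       (norm (w (s n)) *\<^sub>R ((1 / norm (w (s n))) *\<^sub>R w (s n))))" for n
  have "d \<longlonglongrightarrow> - Y + Y"
    unfolding d_def using r lim w0
    by (intro star_dilate_tendsto) (auto simp: o_def less_imp_neq[THEN not_sym])
  then have "(\<lambda>n. norm (d n)) \<longlonglongrightarrow> 0"
    using tendsto_norm by fastforce
  moreover have "norm (d n) \<ge> 1" for n
  proof -
    have "norm (w (s n)) \<le> norm ((norm (w (s n)) *\<^sub>R (- Y)) \<star> w (s n))"
      by (intro w(4) lie_scaleR mY)
    then show ?thesis
      using w0[of "s n"] by (simp add: d_def divide_simps)
  qed
  ultimately show False
    using LIMSEQ_le_const[of "\<lambda>n. norm (d n)" 0 1] by auto
qed

text \<open>\<open>lie\<close> is closed in \<open>logs\<close>, and open there because the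
  neighbourhood of the origin from \<open>logs_near_0\<close> can be translated to any of its
  points. As a continuous image of \<open>H\<close>, the set \<open>logs\<close> is
  connected.\<close>

lemma logs_eq_lie: "logs = lie"
proof -
  obtain \<epsilon> where \<epsilon>: "\<epsilon> > 0" "\<And>z. z \<in> logs \<Longrightarrow> norm z < \<epsilon> \<Longrightarrow> z \<in> lie"
    using logs_near_0 by blast
  have "openin (top_of_set logs) lie"
  proof (subst openin_subopen, intro ballI)
    fix a assume a: "a \<in> lie"
    define T where "T = logs \<inter> (\<lambda>z. (- a) \<star> z) -` ball 0 \<epsilon>"
    have "open ((\<lambda>z. (- a) \<star> z) -` ball 0 \<epsilon>)"
      by (rule open_vimage[OF open_ball]) (intro continuous_on_star continuous_intros)
    then have "openin (top_of_set logs) T"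
      unfolding T_def by (rule openin_open_Int)
    moreover have "a \<in> T"
      using a \<epsilon>(1) lie_logs by (simp add: T_def)
    moreover have "T \<subseteq> lie"
    proof
      fix z assume z: "z \<in> T"
      have ma: "- a \<in> lie" using a subspace_neg[OF subspace_lie] by blast
      have "(- a) \<star> z \<in> lie"
        using z star_logs[OF lie_logs[OF ma], of z] by (intro \<epsilon>(2)) (auto simp: T_def)
      then have "a \<star> ((- a) \<star> z) \<in> lie"
        by (rule star_lie[OF a])
      moreover have "a \<star> ((- a) \<star> z) = z"
        using star_logs_assoc[of a "- a" z] a ma z by (simp add: T_def lie_logs)
      ultimately show "z \<in> lie" by simp
    qed
    ultimately show "\<exists>T. openin (top_of_set logs) T \<and> a \<in> T \<and> T \<subseteq> lie"
      by blast
  qed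
  moreover have "closedin (top_of_set logs) lie"
    using closed_lie lie_logs by (intro closed_subset) auto
  moreover have "connected logs"
  proof -
    have "logs = nlog ` H"
    proof (intro equalityI subsetI)
      fix v assume "v \<in> logs"
      then show "v \<in> nlog ` H"
        by (intro image_eqI[of _ _ "nexp v"]) (simp_all add: logs_def)
    next
      fix v assume "v \<in> nlog ` H"
      then show "v \<in> logs"
        using H_subset_N by (auto simp: logs_def nexp_nlog)
    qed
    then show ?thesis
      using connected_continuous_image[OF continuous_on_nlog connected_H] by simp
  qed
  ultimately have "lie = {} \<or> lie = logs"
    unfolding connected_clopen by blast
  then show ?thesis
    using subspace_0[OF subspace_lie] by blast
qed

lemma H_eq: "H = nexp ` lie"
proof (intro equalityI subsetI)
  fix A assume A: "A \<in> H"
  then have "nexp (nlog A) = A"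
    using H_subset_N by (intro nexp_nlog) auto
  with A show "A \<in> nexp ` lie"
    by (intro image_eqI[of _ _ "nlog A"]) (simp_all add: logs_eq_lie[symmetric] logs_def)
qed (auto simp: logs_eq_lie[symmetric] logs_def)

lemma lie_algebra_eq: "lie_algebra H = nmat ` lie"
proof (intro equalityI subsetI)
  fix X assume X: "X \<in> lie_algebra H"
  then have "X \<in> range nmat"
    using H_subset_N by (intro one_parameter_in_N) (auto simp: lie_algebra_def)
  then obtain v where v: "X = nmat v" by blast
  have "v \<in> lie"
    using X by (simp add: lie_algebra_def lie_def logs_def v nmat_scaleR[symmetric] matrix_exp_nmat)
  then show "X \<in> nmat ` lie" by (simp add: v)
next
  fix X assume "X \<in> nmat ` lie"
  then show "X \<in> lie_algebra H"
    by (auto simp: lie_algebra_def lie_def logs_def nmat_scaleR[symmetric] matrix_exp_nmat)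
qed

lemma dim_lie_algebra: "dim (lie_algebra H) = dim lie"
  unfolding lie_algebra_eq by (rule dim_image_eq[OF linear_nmat]) (simp add: inj_on_def)

end

subsection \<open>Limits of rescaled elements\<close>

text \<open>All 2 x 2 minors vanish. Stated by polynomial equations, the property can be tested on
  convergent sequences; the zero matrix has it.\<close>

definition rank_le_1 :: "real^'m^'n \<Rightarrow> bool" where
  "rank_le_1 M \<longleftrightarrow> (\<forall>i j k l. M $ i $ j * M $ k $ l = M $ i $ l * M $ k $ j)"

lemma rank_le_1_outer:
  assumes "rank_le_1 M"
  obtains u v where "\<And>i j. M $ i $ j = u $ i * v $ j"
proof (cases "M = 0")
  case True
  then show ?thesis
    using that[of 0 0] by simp
next
  case False
  then obtain k l where kl: "M $ k $ l \<noteq> 0"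
    by (auto simp: vec_eq_iff)
  show ?thesis
  proof (rule that[of "\<chi> i. M $ i $ l" "\<chi> j. M $ k $ j / M $ k $ l"])
    fix i j
    have "M $ i $ j * M $ k $ l = M $ i $ l * M $ k $ j"
      using assms by (simp add: rank_le_1_def)
    then show "M $ i $ j = (\<chi> i. M $ i $ l) $ i * (\<chi> j. M $ k $ j / M $ k $ l) $ j"
      using kl by (simp add: field_simps)
  qed
qed

lemma rank_le_1_mult:
  fixes M :: "real^'m::finite^'n::finite"
  assumes "rank_le_1 M"
  shows "rank_le_1 (A ** M ** B)"
proof -
  obtain u v where M: "\<And>i j. M $ i $ j = u $ i * v $ j"
    using rank_le_1_outer[OF assms] by metis
  have "(A ** M ** B) $ i $ j = (A *v u) $ i * (v v* B) $ j" for i j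
    by (simp add: matrix_mul_nth matrix_vector_mult_def vector_matrix_mult_def M sum_distrib_left
        sum_distrib_right mult.assoc mult.left_commute)
  then show ?thesis
    by (simp add: rank_le_1_def)
qed

lemma rank_le_1_block:
  fixes M :: "real^('k::finite idx)^('k idx)"
  assumes zero: "\<And>i j. i \<notin> {First, Second} \<or> j \<notin> {Penult, Last} \<Longrightarrow> M $ i $ j = 0"
    and minor: "M $ First $ Penult * M $ Second $ Last = M $ First $ Last * M $ Second $ Penult"
  shows "rank_le_1 M"
  unfolding rank_le_1_def
proof (intro allI)
  fix i j k l
  show "M $ i $ j * M $ k $ l = M $ i $ l * M $ k $ j"
  proof (cases "i \<in> {First, Second} \<and> k \<in> {First, Second} \<and> j \<in> {Penult, Last} \<and> l \<in> {Penult, Last}")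
    case True
    then show ?thesis using minor by (auto simp: mult.commute)
  next
    case False
    then have "M $ i $ j * M $ k $ l = 0" "M $ i $ l * M $ k $ j = 0"
      using zero[of i j] zero[of k l] zero[of i l] zero[of k j] by auto
    then show ?thesis by (rule trans[OF _ sym])
  qed
qed

section \<open>Rescaled limits that a Cartan decomposition forces to exist\<close>

definition torus :: "real \<Rightarrow> real \<Rightarrow> real^('k::finite idx)^('k idx)" where
  "torus a b = (\<chi> i j. if i = j then (case i of First \<Rightarrow> a | Second \<Rightarrow> b | Mid _ \<Rightarrow> 1 | Penult \<Rightarrow> 1 / b | Last \<Rightarrow> 1 / a) else 0)"

lemma torus_SO2n:
  assumes ab: "a \<noteq> 0" "b \<noteq> 0"
  shows "(torus a b :: real^('k::finite idx)^('k idx)) \<in> carrier SO2n"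
proof -
  have "det (torus a b :: real^('k idx)^('k idx)) = 1"
    using ab by (subst det_diagonal) (auto simp: torus_def prod_idx)
  moreover have "(adj (torus a b) ** torus a b) $ i $ j = mat 1 $ i $ j" for i j :: "'k idx"
    using ab by (cases i; cases j)
      (auto simp: adj_def matrix_mul_nth sum_idx torus_def mat_def if_distrib[of "\<lambda>x. x * _"] cong: if_cong)
  ultimately show ?thesis
    by (simp add: carrier_SO2n vec_eq_iff)
qed

text \<open>Write \<open>g n\<close> as a product c h c' and pass to a subsequence along which the
  compact factors converge; solving for h gives the limit. The last conclusion makes the passage
  reversible, so that statements on the rank of \<open>D\<close> carry over to the limit in
  \<open>H\<close>.\<close>

lemma cartan_decomposition_limit:
  fixes H :: "(real^('k::finite idx)^('k idx)) set"
  assumes cds: "cartan_decomposition_subgroup SO2n H"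
    and g: "\<And>n :: nat. (g n :: real^('k idx)^('k idx)) \<in> carrier SO2n" and lim: "(\<lambda>n. (1 / real (Suc n)) *\<^sub>R g n) \<longlonglongrightarrow> D"
  obtains h r A B A' B' where "\<And>n :: nat. h n \<in> H" "filterlim r at_top sequentially"
    "(\<lambda>n. (1 / r n) *\<^sub>R h n) \<longlonglongrightarrow> A ** D ** B" "D = A' ** (A ** D ** B) ** B'"
proof -
  obtain C where C: "compact C" "C \<subseteq> carrier SO2n" "C <#>\<^bsub>SO2n\<^esub> H <#>\<^bsub>SO2n\<^esub> C = carrier SO2n"
    using cds unfolding cartan_decomposition_subgroup_def by blast
  have sub: "subgroup H SO2n"
    using cds unfolding cartan_decomposition_subgroup_def by blast
  have "\<exists>q. fst q \<in> C \<and> snd (snd q) \<in> C \<and> fst (snd q) \<in> H \<and> g n = fst q ** fst (snd q) ** snd (snd q)" for n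
  proof -
    have "g n \<in> C <#>\<^bsub>SO2n\<^esub> H <#>\<^bsub>SO2n\<^esub> C"
      using g C(3) by blast
    then obtain c h c' where "c \<in> C" "h \<in> H" "c' \<in> C" "g n = c ** h ** c'"
      by (auto simp: set_mult_def)
    then show ?thesis
      by (intro exI[of _ "(c, h, c')"]) simp
  qed
  then obtain q where q: "\<And>n. fst (q n) \<in> C" "\<And>n. snd (snd (q n)) \<in> C" "\<And>n. fst (snd (q n)) \<in> H"
    "\<And>n. g n = fst (q n) ** fst (snd (q n)) ** snd (snd (q n))"
    by metis
  define c h c' where "c n = fst (q n)" and "h n = fst (snd (q n))" and "c' n = snd (snd (q n))" for n
  have ch: "c n \<in> C" "c' n \<in> C" "h n \<in> H" "g n = c n ** h n ** c' n" for n
    using q unfolding c_def c'_def h_def by auto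
  have "\<forall>n. (c n, c' n) \<in> C \<times> C"
    using ch by blast
  moreover have "compact (C \<times> C)"
    using C(1) by (intro compact_Times)
  ultimately obtain \<gamma> \<gamma>' s where \<gamma>: "\<gamma> \<in> C" "\<gamma>' \<in> C" and s: "strict_mono s"
    and cs: "((\<lambda>n. (c n, c' n)) \<circ> s) \<longlonglongrightarrow> (\<gamma>, \<gamma>')"
    unfolding compact_def by (elim allE[of _ "\<lambda>n. (c n, c' n)"]) auto
  have lc: "(\<lambda>n. c (s n)) \<longlonglongrightarrow> \<gamma>" "(\<lambda>n. c' (s n)) \<longlonglongrightarrow> \<gamma>'"
    using tendsto_fst[OF cs] tendsto_snd[OF cs] by (simp_all add: o_def)
  have ladj: "(\<lambda>n. adj (f n)) \<longlonglongrightarrow> adj x" if "f \<longlonglongrightarrow> x" for f and x :: "real^('k idx)^('k idx)"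
    using continuous_on_tendsto_compose[OF continuous_on_adj[of UNIV] that] by simp
  have hn: "h n = adj (c n) ** g n ** adj (c' n)" for n
  proof -
    have "adj (c n) ** g n ** adj (c' n) = (adj (c n) ** c n) ** h n ** (c' n ** adj (c' n))"
      by (simp add: ch(4) matrix_mul_assoc)
    also have "\<dots> = h n"
      using ch C(2) by (simp add: adj_inverse(1,2) subset_iff)
    finally show ?thesis by simp
  qed
  have scal: "r *\<^sub>R (X ** Y ** Z) = X ** (r *\<^sub>R Y) ** Z" for r and X Y Z :: "real^('k idx)^('k idx)"
    by (simp add: vec_eq_iff matrix_mul_nth sum_distrib_left sum_distrib_right algebra_simps)
  show ?thesis
  proof (rule that)
    show "h (s n) \<in> H" for n by (rule ch)
    show "filterlim (\<lambda>n. real (Suc (s n))) at_top sequentially"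
      by (rule filterlim_compose[OF filterlim_real_sequentially])
         (intro filterlim_compose[OF filterlim_Suc] filterlim_subseq s)
    have "(\<lambda>n. (1 / real (Suc (s n))) *\<^sub>R g (s n)) \<longlonglongrightarrow> D"
      using LIMSEQ_subseq_LIMSEQ[OF lim s] by (simp add: o_def)
    then show "(\<lambda>n. (1 / real (Suc (s n))) *\<^sub>R h (s n)) \<longlonglongrightarrow> adj \<gamma> ** D ** adj \<gamma>'"
      unfolding hn scal by (intro tendsto_matrix_mult ladj lc)
    have "\<gamma> ** (adj \<gamma> ** D ** adj \<gamma>') ** \<gamma>' = (\<gamma> ** adj \<gamma>) ** D ** (adj \<gamma>' ** \<gamma>')"
      by (simp add: matrix_mul_assoc)
    then show "D = \<gamma> ** (adj \<gamma> ** D ** adj \<gamma>') ** \<gamma>'"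
      using \<gamma> C(2) by (simp add: adj_inverse(1,2) subset_iff)
  qed
qed

definition scaled_limit :: "(real^('k::finite idx)^('k idx)) set \<Rightarrow> real^('k idx)^('k idx) \<Rightarrow> bool" where
  "scaled_limit H M \<longleftrightarrow> (\<exists>h r. (\<forall>n :: nat. h n \<in> H) \<and> filterlim r at_top sequentially \<and>
     (\<lambda>n. (1 / r n) *\<^sub>R h n) \<longlonglongrightarrow> M)"

lemma scaled_torus_lim:
  fixes b :: "nat \<Rightarrow> real"
  assumes "\<And>n. b n \<ge> 1" and lim: "(\<lambda>n. b n / real (Suc n)) \<longlonglongrightarrow> \<beta>"
  shows "(\<lambda>n. (1 / real (Suc n)) *\<^sub>R torus (real (Suc n)) (b n)) \<longlonglongrightarrow>
     (\<chi> i j. if i = First \<and> j = First then 1 else if i = Second \<and> j = Second then \<beta> else 0)" (is "_ \<longlonglongrightarrow> ?D")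
proof (intro vec_tendstoI)
  fix i j :: "'a idx"
  have inv: "(\<lambda>n. 1 / real (Suc n)) \<longlonglongrightarrow> 0"
    using LIMSEQ_inverse_real_of_nat by (simp add: inverse_eq_divide)
  have small: "(\<lambda>n. 1 / real (Suc n) * f n) \<longlonglongrightarrow> 0" if "\<And>n. 0 \<le> f n \<and> f n \<le> 1" for f :: "nat \<Rightarrow> real"
    by (rule real_tendsto_sandwich[OF _ _ tendsto_const inv])
       (use that in \<open>auto intro!: always_eventually divide_right_mono\<close>)
  have "0 \<le> 1 / b n \<and> 1 / b n \<le> 1" for n
    using assms(1)[of n] by simp
  then have "(\<lambda>n. 1 / real (Suc n) * (1 / real (Suc n))) \<longlonglongrightarrow> 0" "(\<lambda>n. 1 / real (Suc n) * (1 / b n)) \<longlonglongrightarrow> 0"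
    by (intro small; simp)+
  then show "(\<lambda>n. ((1 / real (Suc n)) *\<^sub>R torus (real (Suc n)) (b n)) $ i $ j) \<longlonglongrightarrow> ?D $ i $ j"
    using inv lim by (cases "i = j"; cases i) (auto simp: torus_def)
qed

lemma cartan_decomposition_limits:
  fixes H :: "(real^('k::finite idx)^('k idx)) set"
  assumes "cartan_decomposition_subgroup SO2n H"
  shows "\<exists>M. scaled_limit H M \<and> M \<noteq> 0 \<and> rank_le_1 M" "\<exists>M. scaled_limit H M \<and> \<not> rank_le_1 M"
proof -
  let ?D = "\<lambda>\<beta>. (\<chi> i j. if i = First \<and> j = First then 1 else if i = Second \<and> j = Second then \<beta> else 0)
    :: real^('k idx)^('k idx)"
  have inv: "(\<lambda>n. 1 / real (Suc n)) \<longlonglongrightarrow> 0"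
    using LIMSEQ_inverse_real_of_nat by (simp add: inverse_eq_divide)
  have l0: "(\<lambda>n. (1 / real (Suc n)) *\<^sub>R torus (real (Suc n)) 1) \<longlonglongrightarrow> ?D 0"
    by (rule scaled_torus_lim) (use inv in auto)
  have l1: "(\<lambda>n. (1 / real (Suc n)) *\<^sub>R torus (real (Suc n)) (real (Suc n))) \<longlonglongrightarrow> ?D 1"
    by (rule scaled_torus_lim) auto
  have T: "torus (real (Suc n)) 1 \<in> carrier SO2n" "torus (real (Suc n)) (real (Suc n)) \<in> carrier SO2n" for n
    by (auto intro!: torus_SO2n)
  have D0: "rank_le_1 (?D 0)" "?D 0 \<noteq> 0"
    by (auto simp: rank_le_1_def vec_eq_iff)
  show "\<exists>M. scaled_limit H M \<and> M \<noteq> 0 \<and> rank_le_1 M"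
  proof (rule cartan_decomposition_limit[OF assms T(1) l0])
    fix h r A B A' B'
    assume "\<And>n. h n \<in> H" "filterlim r at_top sequentially"
      "(\<lambda>n. (1 / r n) *\<^sub>R h n) \<longlonglongrightarrow> A ** ?D 0 ** B" and D: "?D 0 = A' ** (A ** ?D 0 ** B) ** B'"
    moreover have "A ** ?D 0 ** B \<noteq> 0"
      using D D0(2) by (auto simp del: matrix_mul_assoc)
    ultimately show ?thesis
      by (intro exI[of _ "A ** ?D 0 ** B"] conjI rank_le_1_mult D0) (auto simp: scaled_limit_def)
  qed
  have D1: "\<not> rank_le_1 (?D 1)"
  proof
    assume "rank_le_1 (?D 1)"
    then have "?D 1 $ First $ First * ?D 1 $ Second $ Second = ?D 1 $ First $ Second * ?D 1 $ Second $ First"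
      unfolding rank_le_1_def by blast
    then show False by simp
  qed
  show "\<exists>M. scaled_limit H M \<and> \<not> rank_le_1 M"
  proof (rule cartan_decomposition_limit[OF assms T(2) l1])
    fix h r A B A' B'
    assume "\<And>n. h n \<in> H" "filterlim r at_top sequentially"
      "(\<lambda>n. (1 / r n) *\<^sub>R h n) \<longlonglongrightarrow> A ** ?D 1 ** B" and D: "?D 1 = A' ** (A ** ?D 1 ** B) ** B'"
    moreover have "\<not> rank_le_1 (A ** ?D 1 ** B)"
      using rank_le_1_mult[of "A ** ?D 1 ** B" A' B'] D1 unfolding D[symmetric] by blast
    ultimately show ?thesis
      by (intro exI[of _ "A ** ?D 1 ** B"] conjI) (auto simp: scaled_limit_def)
  qed
qed

subsection \<open>Quantitative estimates by compactness\<close>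

text \<open>The constant is the minimum of \<open>f\<close> on the unit sphere of \<open>S\<close>;
  if \<open>S\<close> is trivial, this sphere is empty and any constant will do.\<close>

lemma homogeneous_lower_bound:
  fixes f :: "'a::euclidean_space \<Rightarrow> real"
  assumes S: "subspace S" and cont: "continuous_on UNIV f" and hom: "\<And>c v. f (c *\<^sub>R v) = c ^ k * f v"
    and pos: "\<And>v. v \<in> S \<Longrightarrow> v \<noteq> 0 \<Longrightarrow> f v > 0" and "k > 0"
  shows "\<exists>\<epsilon>>0. \<forall>v\<in>S. \<epsilon> * norm v ^ k \<le> f v"
proof (cases "S \<inter> sphere 0 1 = {}")
  case True
  have z: "v = 0" if "v \<in> S" for v
  proof (rule ccontr)
    assume "v \<noteq> 0"
    then have "(1 / norm v) *\<^sub>R v \<in> S \<inter> sphere 0 1"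
      using that S by (simp add: subspace_scale)
    with True show False by blast
  qed
  have "f 0 = 0"
    using hom[of 0 0] zero_power[OF \<open>k > 0\<close>, where ?'a = real] by simp
  then have "1 * norm v ^ k \<le> f v" if "v \<in> S" for v
    using z[OF that] \<open>k > 0\<close> by (simp add: zero_power)
  then show ?thesis by (intro exI[of _ 1]) simp
next
  case False
  have "compact (S \<inter> sphere 0 1)"
    using S by (intro closed_Int_compact closed_subspace) auto
  then obtain w where w: "w \<in> S \<inter> sphere 0 1" "\<And>v. v \<in> S \<inter> sphere 0 1 \<Longrightarrow> f w \<le> f v"
    using continuous_attains_inf[OF _ False continuous_on_subset[OF cont subset_UNIV]] by blast
  show ?thesis
  proof (intro exI[of _ "f w"] conjI ballI)
    show "f w > 0"
      using w(1) by (intro pos) auto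
    show "f w * norm v ^ k \<le> f v" if v: "v \<in> S" for v
    proof (cases "v = 0")
      case True
      then show ?thesis using hom[of 0 0] zero_power[OF \<open>k > 0\<close>, where ?'a = real] by (simp add: zero_power)
    next
      case False
      have "f w \<le> f ((1 / norm v) *\<^sub>R v)"
        using v False S by (intro w(2)) (simp add: subspace_scale)
      then have "f w * norm v ^ k \<le> ((1 / norm v) ^ k * f v) * norm v ^ k"
        unfolding hom by (rule mult_right_mono) simp
      also have "\<dots> = f v"
        using False by (simp add: power_divide)
      finally show ?thesis .
    qed
  qed
qed

definition gram :: "'a::real_inner \<Rightarrow> 'a \<Rightarrow> real" where
  "gram x y = (x \<bullet> x) * (y \<bullet> y) - (x \<bullet> y)\<^sup>2"

lemma gram_nonneg: "gram x y \<ge> 0"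
  using Cauchy_Schwarz_ineq[of x y] by (simp add: gram_def)

text \<open>Replaces a dimension by the vanishing of a polynomial, which can be bounded from below
  by compactness and followed along sequences.\<close>

lemma dim_span_pair_eq_1:
  fixes x y :: "'a::euclidean_space"
  shows "dim (span {x, y}) = 1 \<longleftrightarrow> (x \<noteq> 0 \<or> y \<noteq> 0) \<and> gram x y = 0"
proof
  assume "dim (span {x, y}) = 1"
  then obtain B where B: "B \<subseteq> {x, y}" "{x, y} \<subseteq> span B" "card B = 1"
    using basis_exists[of "{x, y}"] unfolding dim_span by metis
  then obtain b where b: "B = {b}"
    using card_1_singletonE by blast
  then obtain \<alpha> \<beta> where xy: "x = \<alpha> *\<^sub>R b" "y = \<beta> *\<^sub>R b"
    using B(2) by (auto simp: span_singleton)
  have "gram x y = 0"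
    by (simp add: gram_def xy power2_eq_square)
  moreover have "x \<noteq> 0 \<or> y \<noteq> 0"
    using \<open>dim (span {x, y}) = 1\<close> by auto
  ultimately show "(x \<noteq> 0 \<or> y \<noteq> 0) \<and> gram x y = 0" by blast
next
  have key: "dim (span {x, y}) = 1" if "x \<noteq> 0" "gram x y = 0" for x y :: 'a
  proof -
    \<comment> \<open>The equality case of Cauchy-Schwarz: \<open>y\<close> minus its projection to
      the line of \<open>x\<close> has squared norm
      \<open>gram x y / (x \<bullet> x)\<close>.\<close>
    let ?c = "(x \<bullet> y) / (x \<bullet> x)"
    have "(y - ?c *\<^sub>R x) \<bullet> (y - ?c *\<^sub>R x) = 0"
      using that by (simp add: inner_diff_left inner_diff_right gram_def inner_commute field_simps power2_eq_square)
    then have "y = ?c *\<^sub>R x" by simp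
    then have "y \<in> span {x}" by (metis span_base span_scale singletonI)
    then have "span {x, y} = span {x}"
      by (subst insert_commute) (rule span_redundant)
    then show ?thesis
      using that by (simp add: dim_span)
  qed
  assume "(x \<noteq> 0 \<or> y \<noteq> 0) \<and> gram x y = 0"
  then show "dim (span {x, y}) = 1"
    using key[of x y] key[of y x] by (auto simp: gram_def mult.commute inner_commute insert_commute)
qed

text \<open>The squared norm of the scaled vector is at most |a| |a q| / \<open>\<epsilon>\<close>,
  where the second factor stays bounded and the first tends to 0. So a scaling that keeps a
  dominating quadratic quantity bounded makes the linear ones vanish.\<close>

lemma scaled_norm_tendsto_0:
  fixes a :: "nat \<Rightarrow> real" and v :: "nat \<Rightarrow> 'a::real_normed_vector"
  assumes a: "a \<longlonglongrightarrow> 0" and le: "\<And>n. \<epsilon> * (norm (v n))\<^sup>2 \<le> q n" and \<epsilon>: "\<epsilon> > 0"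
    and lim: "(\<lambda>n. a n * q n) \<longlonglongrightarrow> m"
  shows "(\<lambda>n. a n *\<^sub>R v n) \<longlonglongrightarrow> 0"
proof -
  have q: "q n \<ge> 0" for n
    using le[of n] \<epsilon> by (meson mult_nonneg_nonneg less_imp_le order_trans zero_le_power2)
  have "(\<lambda>n. \<bar>a n\<bar> * \<bar>a n * q n\<bar> / \<epsilon>) \<longlonglongrightarrow> \<bar>0\<bar> * \<bar>m\<bar> / \<epsilon>"
    using \<epsilon> by (intro tendsto_intros a lim) auto
  then have lim0: "(\<lambda>n. \<bar>a n\<bar> * \<bar>a n * q n\<bar> / \<epsilon>) \<longlonglongrightarrow> 0" by simp
  have le2: "(norm (a n *\<^sub>R v n))\<^sup>2 \<le> \<bar>a n\<bar> * \<bar>a n * q n\<bar> / \<epsilon>" for n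
  proof -
    have "(norm (a n *\<^sub>R v n))\<^sup>2 * \<epsilon> = (a n)\<^sup>2 * (\<epsilon> * (norm (v n))\<^sup>2)"
      by (simp add: power_mult_distrib algebra_simps)
    also have "\<dots> \<le> (a n)\<^sup>2 * q n"
      by (intro mult_left_mono le) simp
    also have "\<dots> = \<bar>a n\<bar> * \<bar>a n * q n\<bar>"
      using q[of n] by (simp add: abs_mult power2_eq_square mult.assoc[symmetric])
    finally show ?thesis using \<epsilon> by (simp add: field_simps)
  qed
  have "(\<lambda>n. (norm (a n *\<^sub>R v n))\<^sup>2) \<longlonglongrightarrow> 0"
    by (rule real_tendsto_sandwich[OF always_eventually[rule_format, OF zero_le_power2]
          always_eventually[rule_format, OF le2] tendsto_const lim0])
  from tendsto_real_sqrt[OF this]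
  have "(\<lambda>n. norm (a n *\<^sub>R v n)) \<longlonglongrightarrow> 0"
    by (simp del: norm_scaleR)
  then show ?thesis
    by (rule tendsto_norm_zero_cancel)
qed

subsection \<open>Subgroups that are not Cartan-decomposition subgroups\<close>

context unipotent_subgroup
begin

lemma scaled_limit_nexp:
  assumes "scaled_limit H M"
  shows "\<exists>v r. (\<forall>n :: nat. v n \<in> lie) \<and> filterlim r at_top sequentially \<and>
    (\<lambda>n. 1 / r n) \<longlonglongrightarrow> 0 \<and> (\<lambda>n. (1 / r n) *\<^sub>R nexp (v n)) \<longlonglongrightarrow> M"
proof -
  obtain h r where h: "\<And>n :: nat. h n \<in> H" and r: "filterlim r at_top sequentially"
    and lim: "(\<lambda>n. (1 / r n) *\<^sub>R h n) \<longlonglongrightarrow> M"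
    using assms unfolding scaled_limit_def by blast
  have "\<exists>v. v \<in> lie \<and> h n = nexp v" for n
    using H_eq[THEN equalityD1, THEN subsetD, OF h[of n]] by blast
  then have "\<exists>v. \<forall>n. v n \<in> lie \<and> h n = nexp (v n)"
    by (intro choice allI)
  then obtain v where v: "\<And>n. v n \<in> lie" "\<And>n. h n = nexp (v n)"
    by blast
  have "(\<lambda>n. 1 / r n) \<longlonglongrightarrow> 0"
    by (rule tendsto_divide_0[OF tendsto_const filterlim_at_top_imp_at_infinity[OF r]])
  with v(1) r lim[unfolded v(2)] show ?thesis by blast
qed

text \<open>With \<open>\<phi> = 0\<close> the minor of the upper right block is \<open>d\<close>,
  the sum of the square of \<open>\<eta>\<close> and a quarter of \<open>gram x y\<close>. By
  compactness the latter dominates the square of \<open>s\<close>, and all entries are at most 1 + s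
  + |\<open>\<eta>\<close>|. If a rescaled limit has rank at most one, the scaled minor tends to 0,
  hence so do all scaled entries. Thus no nonzero limit of rank one exists.\<close>

lemma not_cartan_independent:
  assumes "\<And>\<phi> x y \<eta>. (\<phi>, x, y, \<eta>) \<in> lie \<Longrightarrow> \<phi> = 0 \<and> ((x, y) \<noteq> 0 \<longrightarrow> gram x y \<noteq> 0)"
  shows "\<not> cartan_decomposition_subgroup SO2n H"
proof
  assume "cartan_decomposition_subgroup SO2n H"
  then obtain M where M: "scaled_limit H M" "M \<noteq> 0" "rank_le_1 M"
    using cartan_decomposition_limits(1) by blast
  obtain v r where v: "\<And>n :: nat. v n \<in> lie" and "filterlim r at_top sequentially" and a0: "(\<lambda>n. 1 / r n) \<longlonglongrightarrow> 0"
    and lim: "(\<lambda>n. (1 / r n) *\<^sub>R nexp (v n)) \<longlonglongrightarrow> M"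
    using scaled_limit_nexp[OF M(1)] by blast
  define a x y \<eta> where "a n = 1 / r n" and "x n = fst (snd (v n))" and "y n = fst (snd (snd (v n)))"
    and "\<eta> n = snd (snd (snd (v n)))" for n
  have vn: "v n = (0, x n, y n, \<eta> n)" for n
    using v[of n] assms by (cases "v n") (auto simp: x_def y_def \<eta>_def)
  have a: "a \<longlonglongrightarrow> 0"
    using a0 by (simp add: a_def[abs_def])
  define W where "W = (\<lambda>v :: 'k nvec. (fst (snd v), fst (snd (snd v)))) ` lie"
  have "linear (\<lambda>v :: 'k nvec. (fst (snd v), fst (snd (snd v))))"
    by (auto simp: linear_iff)
  then have W: "subspace W"
    unfolding W_def by (intro subspace_lie linear_subspace_image)
  let ?g = "\<lambda>(x :: (real, 'k) vec, y). gram x y"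
  have cont: "continuous_on UNIV ?g"
    unfolding gram_def case_prod_beta by (intro continuous_intros)
  have hom: "?g (c *\<^sub>R w) = c ^ 4 * ?g w" for c w
    by (cases w) (simp add: gram_def power2_eq_square eval_nat_numeral algebra_simps)
  have pos: "?g w > 0" if w: "w \<in> W" "w \<noteq> 0" for w
  proof -
    obtain \<phi> x y \<eta> where "(\<phi>, x, y, \<eta>) \<in> lie" "w = (x, y)"
      using w(1) by (auto simp: W_def)
    then show ?thesis
      using assms[of \<phi> x y \<eta>] w(2) gram_nonneg[of x y] by auto
  qed
  have "\<exists>\<epsilon>>0. \<forall>w\<in>W. \<epsilon> * norm w ^ 4 \<le> ?g w"
    by (rule homogeneous_lower_bound[OF W cont hom pos]) simp_all
  then obtain \<epsilon> where \<epsilon>0: "\<epsilon> > 0" and \<epsilon>': "\<forall>w\<in>W. \<epsilon> * norm w ^ 4 \<le> ?g w"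
    by (elim exE conjE)
  note \<epsilon> = \<epsilon>0 bspec[OF \<epsilon>']
  have g: "\<epsilon> * ((norm (x n))\<^sup>2 + (norm (y n))\<^sup>2)\<^sup>2 \<le> gram (x n) (y n)" for n
  proof -
    have "(x n, y n) \<in> W"
      unfolding W_def x_def y_def by (rule imageI[OF v])
    moreover have "norm (x n, y n) ^ 4 = ((norm (x n))\<^sup>2 + (norm (y n))\<^sup>2)\<^sup>2"
      by (simp add: norm_prod_def power4_eq_xxxx power2_eq_square)
    ultimately show ?thesis using \<epsilon>(2)[of "(x n, y n)"] by simp
  qed
  have limc: "(\<lambda>n. a n * nexp (v n) $ i $ j) \<longlonglongrightarrow> M $ i $ j" for i j
    using tendsto_vec_nth[OF tendsto_vec_nth[OF lim], of i j] by (simp add: a_def)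
  define s where "s n = (norm (x n))\<^sup>2 + (norm (y n))\<^sup>2" for n
  define d where "d n = (\<eta> n)\<^sup>2 + gram (x n) (y n) / 4" for n
  have "(\<lambda>n. (a n * nexp (v n) $ First $ Last) * (a n * nexp (v n) $ Second $ Penult)
      - (a n * nexp (v n) $ First $ Penult) * (a n * nexp (v n) $ Second $ Last))
     \<longlonglongrightarrow> M $ First $ Last * M $ Second $ Penult - M $ First $ Penult * M $ Second $ Last"
    by (intro tendsto_intros limc)
  moreover have "M $ First $ Last * M $ Second $ Penult - M $ First $ Penult * M $ Second $ Last = 0"
    using M(3) unfolding rank_le_1_def by (metis right_minus_eq)
  moreover have "(a n * nexp (v n) $ First $ Last) * (a n * nexp (v n) $ Second $ Penult)
      - (a n * nexp (v n) $ First $ Penult) * (a n * nexp (v n) $ Second $ Last) = (a n)\<^sup>2 * d n" for n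
    by (simp add: vn nexp_nth d_def gram_def field_simps power2_eq_square)
  ultimately have d: "(\<lambda>n. (a n)\<^sup>2 * d n) \<longlonglongrightarrow> 0" by simp
  have "(\<lambda>n. (a n * \<eta> n)\<^sup>2) \<longlonglongrightarrow> 0"
  proof (rule real_tendsto_sandwich[OF always_eventually[rule_format, OF zero_le_power2]
          always_eventually[rule_format] tendsto_const d])
    show "(a n * \<eta> n)\<^sup>2 \<le> (a n)\<^sup>2 * d n" for n
      using gram_nonneg[of "x n" "y n"] by (simp add: power_mult_distrib d_def mult_left_mono)
  qed
  then have \<eta>0: "(\<lambda>n. \<bar>a n * \<eta> n\<bar>) \<longlonglongrightarrow> 0"
    using tendsto_real_sqrt by fastforce
  have "(\<lambda>n. (a n * s n)\<^sup>2) \<longlonglongrightarrow> 0"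
  proof (rule real_tendsto_sandwich[OF always_eventually[rule_format, OF zero_le_power2]
          always_eventually[rule_format] tendsto_const])
    show "(a n * s n)\<^sup>2 \<le> (4 / \<epsilon>) * ((a n)\<^sup>2 * d n)" for n
    proof -
      have "\<epsilon> * (s n)\<^sup>2 \<le> 4 * d n"
        using g[of n] zero_le_power2[of "\<eta> n"] unfolding s_def d_def distrib_left by linarith
      then have "(s n)\<^sup>2 \<le> (4 / \<epsilon>) * d n"
        using \<epsilon>(1) by (simp add: field_simps)
      then have "(a n)\<^sup>2 * (s n)\<^sup>2 \<le> (a n)\<^sup>2 * ((4 / \<epsilon>) * d n)"
        by (rule mult_left_mono) simp
      then show ?thesis by (simp add: power_mult_distrib mult.left_commute)
    qed
    show "(\<lambda>n. (4 / \<epsilon>) * ((a n)\<^sup>2 * d n)) \<longlonglongrightarrow> 0"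
      using tendsto_mult_left[OF d, of "4 / \<epsilon>"] by simp
  qed
  then have s0: "(\<lambda>n. \<bar>a n * s n\<bar>) \<longlonglongrightarrow> 0"
    using tendsto_real_sqrt by fastforce
  have entry: "\<bar>nexp (v n) $ i $ j\<bar> \<le> 1 + s n + \<bar>\<eta> n\<bar>" for n i j
  proof -
    have q: "\<bar>t\<bar> \<le> 1 + t\<^sup>2" for t :: real
      using zero_le_power2[of "\<bar>t\<bar> - 1"] by (simp add: power2_diff)
    have xk: "\<bar>x n $ k\<bar> \<le> 1 + (norm (x n))\<^sup>2" "\<bar>y n $ k\<bar> \<le> 1 + (norm (y n))\<^sup>2" for k
      using q[of "norm (x n)"] q[of "norm (y n)"] component_le_norm_cart[of "x n" k] component_le_norm_cart[of "y n" k]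
      by auto
    have xy: "\<bar>x n $ k\<bar> \<le> 1 + s n + \<bar>\<eta> n\<bar>" "\<bar>y n $ k\<bar> \<le> 1 + s n + \<bar>\<eta> n\<bar>" for k
      unfolding s_def
      using xk(1)[of k] xk(2)[of k] zero_le_power2[of "norm (x n)"] zero_le_power2[of "norm (y n)"]
        abs_ge_zero[of "\<eta> n"] by linarith+
    have "x n \<bullet> x n = (norm (x n))\<^sup>2" "y n \<bullet> y n = (norm (y n))\<^sup>2"
      by (simp_all add: power2_norm_eq_inner)
    moreover have "2 * \<bar>x n \<bullet> y n\<bar> \<le> (norm (x n))\<^sup>2 + (norm (y n))\<^sup>2"
      using Cauchy_Schwarz_ineq2[of "x n" "y n"] zero_le_power2[of "norm (x n) - norm (y n)"]
      by (simp add: power2_diff)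
    ultimately have "x n \<bullet> x n \<le> s n" "y n \<bullet> y n \<le> s n" "2 * \<bar>x n \<bullet> y n\<bar> \<le> s n" "s n \<ge> 0"
      by (simp_all add: s_def)
    then show ?thesis
      using xy inner_ge_zero[of "x n"] inner_ge_zero[of "y n"]
      by (cases i; cases j) (auto simp: vn nexp_nth)
  qed
  have "M $ i $ j = 0" for i j
  proof -
    have "(\<lambda>n. \<bar>a n * nexp (v n) $ i $ j\<bar>) \<longlonglongrightarrow> 0"
    proof (rule real_tendsto_sandwich[OF always_eventually[rule_format, OF abs_ge_zero]
          always_eventually[rule_format] tendsto_const])
      show "\<bar>a n * nexp (v n) $ i $ j\<bar> \<le> \<bar>a n\<bar> + \<bar>a n * s n\<bar> + \<bar>a n * \<eta> n\<bar>" for n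
      proof -
        have "s n \<ge> 0" by (simp add: s_def)
        then have "\<bar>s n\<bar> = s n" by simp
        then show ?thesis
          using mult_left_mono[OF entry[of n i j], of "\<bar>a n\<bar>"] by (simp only: abs_mult distrib_left mult_1_right abs_ge_zero)
      qed
      have "(\<lambda>n. \<bar>a n\<bar> + \<bar>a n * s n\<bar> + \<bar>a n * \<eta> n\<bar>) \<longlonglongrightarrow> \<bar>0\<bar> + 0 + 0"
        by (intro tendsto_intros a s0 \<eta>0)
      then show "(\<lambda>n. \<bar>a n\<bar> + \<bar>a n * s n\<bar> + \<bar>a n * \<eta> n\<bar>) \<longlonglongrightarrow> 0" by simp
    qed
    then have "(\<lambda>n. a n * nexp (v n) $ i $ j) \<longlonglongrightarrow> 0"
      by (rule tendsto_rabs_zero_cancel)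
    then show ?thesis
      using LIMSEQ_unique[OF limc[of i j]] by simp
  qed
  then show False
    using M(2) by (simp add: vec_eq_iff)
qed

text \<open>Outside the upper right block all entries of \<open>nexp v\<close> are affine in \<open>v\<close> when \<open>\<phi> y = 0\<close>; if a quadratic
  entry dominates \<open>v\<close>, they disappear in the limit.\<close>

lemma affine_entries_limit:
  assumes v: "\<And>n :: nat. v n = (\<phi> n, x n, y n, \<eta> n)" and \<phi>y: "\<And>n. \<phi> n *\<^sub>R y n = 0"
    and a: "a \<longlonglongrightarrow> 0" and av: "(\<lambda>n. a n *\<^sub>R v n) \<longlonglongrightarrow> 0"
    and lim: "(\<lambda>n. a n *\<^sub>R nexp (v n)) \<longlonglongrightarrow> M"
    and ij: "i \<notin> {First, Second} \<or> j \<notin> {Penult, Last}"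
  shows "M $ i $ j = 0"
proof -
  have limc: "(\<lambda>n. a n * nexp (v n) $ i $ j) \<longlonglongrightarrow> M $ i $ j"
    using tendsto_vec_nth[OF tendsto_vec_nth[OF lim], of i j] by simp
  have "(\<lambda>n. a n * \<phi> n) \<longlonglongrightarrow> 0" and x: "(\<lambda>n. a n *\<^sub>R x n) \<longlonglongrightarrow> 0" and y: "(\<lambda>n. a n *\<^sub>R y n) \<longlonglongrightarrow> 0"
    using tendsto_fst[OF av] tendsto_fst[OF tendsto_snd[OF av]] tendsto_fst[OF tendsto_snd[OF tendsto_snd[OF av]]]
    by (simp_all add: v)
  moreover have "(\<lambda>n. a n * x n $ k) \<longlonglongrightarrow> 0" "(\<lambda>n. a n * y n $ k) \<longlonglongrightarrow> 0" for k
    using tendsto_vec_nth[OF x, of k] tendsto_vec_nth[OF y, of k] by simp_all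
  moreover have \<phi>y': "\<phi> n * y n $ k = 0" for n k
    using arg_cong[OF \<phi>y[of n], of "\<lambda>z. z $ k"] by simp
  ultimately have "(\<lambda>n. a n * nexp (v n) $ i $ j) \<longlonglongrightarrow> 0"
    using ij a by (cases i; cases j) (auto simp: v nexp_nth \<phi>y' tendsto_minus_cancel_left[symmetric])
  then show ?thesis
    using limc LIMSEQ_unique by blast
qed

text \<open>Here \<open>x \<bullet> x + y \<bullet> y\<close> is positive definite on
  \<open>lie\<close> and is a combination of two entries, so the scaled vectors tend to 0 and only
  the upper right block survives. Its minor is the square of \<open>\<eta>\<close>, because the Gram
  determinant vanishes, and after scaling it tends to 0 too. So every limit has rank at most
  one.\<close>

lemma not_cartan_dependent:
  assumes 1: "\<And>\<phi> x y \<eta>. (\<phi>, x, y, \<eta>) \<in> lie \<Longrightarrow> \<phi> = 0 \<and> gram x y = 0"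
    and 2: "\<And>\<phi> x y \<eta>. (\<phi>, x, y, \<eta>) \<in> lie \<Longrightarrow> x = 0 \<Longrightarrow> y = 0 \<Longrightarrow> \<eta> = 0"
  shows "\<not> cartan_decomposition_subgroup SO2n H"
proof
  assume "cartan_decomposition_subgroup SO2n H"
  then obtain M where M: "scaled_limit H M" "\<not> rank_le_1 M"
    using cartan_decomposition_limits(2) by blast
  obtain v r where v: "\<And>n :: nat. v n \<in> lie" and "filterlim r at_top sequentially" and a0: "(\<lambda>n. 1 / r n) \<longlonglongrightarrow> 0"
    and lim0: "(\<lambda>n. (1 / r n) *\<^sub>R nexp (v n)) \<longlonglongrightarrow> M"
    using scaled_limit_nexp[OF M(1)] by blast
  define a x y \<eta> where "a n = 1 / r n" and "x n = fst (snd (v n))" and "y n = fst (snd (snd (v n)))"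
    and "\<eta> n = snd (snd (snd (v n)))" for n
  have vn: "v n = (0, x n, y n, \<eta> n)" for n
    using v[of n] 1 by (cases "v n") (auto simp: x_def y_def \<eta>_def)
  have a: "a \<longlonglongrightarrow> 0" and lim: "(\<lambda>n. a n *\<^sub>R nexp (v n)) \<longlonglongrightarrow> M"
    using a0 lim0 by (simp_all add: a_def[abs_def])
  have limc: "(\<lambda>n. a n * nexp (v n) $ i $ j) \<longlonglongrightarrow> M $ i $ j" for i j
    using tendsto_vec_nth[OF tendsto_vec_nth[OF lim], of i j] by simp
  let ?f = "\<lambda>(\<phi> :: real, x :: (real, 'k) vec, y :: (real, 'k) vec, \<eta> :: real). x \<bullet> x + y \<bullet> y"
  have cont: "continuous_on UNIV ?f"
    unfolding case_prod_beta by (intro continuous_intros)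
  have hom: "?f (c *\<^sub>R w) = c ^ 2 * ?f w" for c w
    by (cases w) (simp add: power2_eq_square algebra_simps)
  have pos: "?f w > 0" if w: "w \<in> lie" "w \<noteq> 0" for w
  proof -
    obtain \<phi> x y \<eta> where e: "w = (\<phi>, x, y, \<eta>)" by (cases w)
    then have "x \<noteq> 0 \<or> y \<noteq> 0"
      using 1 2 w by (auto simp: zero_prod_def)
    then show ?thesis
      by (auto simp: e add_pos_nonneg add_nonneg_pos)
  qed
  have "\<exists>\<epsilon>>0. \<forall>w\<in>lie. \<epsilon> * norm w ^ 2 \<le> ?f w"
    by (rule homogeneous_lower_bound[OF subspace_lie cont hom pos]) simp_all
  then obtain \<epsilon> where \<epsilon>0: "\<epsilon> > 0" and \<epsilon>': "\<forall>w\<in>lie. \<epsilon> * norm w ^ 2 \<le> ?f w"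
    by (elim exE conjE)
  note \<epsilon> = \<epsilon>0 bspec[OF \<epsilon>']
  have "(\<lambda>n. - 2 * (a n * nexp (v n) $ First $ Last) - 2 * (a n * nexp (v n) $ Second $ Penult))
     \<longlonglongrightarrow> - 2 * M $ First $ Last - 2 * M $ Second $ Penult"
    by (intro tendsto_intros limc)
  then have "(\<lambda>n. a n * ?f (v n)) \<longlonglongrightarrow> - 2 * M $ First $ Last - 2 * M $ Second $ Penult"
    by (simp add: vn nexp_nth algebra_simps)
  from scaled_norm_tendsto_0[OF a \<epsilon>(2)[OF v] \<epsilon>(1) this]
  have av: "(\<lambda>n. a n *\<^sub>R v n) \<longlonglongrightarrow> 0" .
  have ae: "(\<lambda>n. a n * \<eta> n) \<longlonglongrightarrow> 0"
    using tendsto_snd[OF tendsto_snd[OF tendsto_snd[OF av]]] by (simp add: vn)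
  have "(\<lambda>n. (a n * nexp (v n) $ First $ Last) * (a n * nexp (v n) $ Second $ Penult)
      - (a n * nexp (v n) $ First $ Penult) * (a n * nexp (v n) $ Second $ Last))
     \<longlonglongrightarrow> M $ First $ Last * M $ Second $ Penult - M $ First $ Penult * M $ Second $ Last"
    by (intro tendsto_intros limc)
  moreover have "(a n * nexp (v n) $ First $ Last) * (a n * nexp (v n) $ Second $ Penult)
      - (a n * nexp (v n) $ First $ Penult) * (a n * nexp (v n) $ Second $ Last) = (a n * \<eta> n)\<^sup>2" for n
  proof -
    have "(x n \<bullet> x n) * (y n \<bullet> y n) = (x n \<bullet> y n)\<^sup>2"
      using 1[of 0 "x n" "y n" "\<eta> n"] v[of n] by (simp add: vn gram_def)
    then show ?thesis
      by (simp add: vn nexp_nth power2_eq_square) (simp add: field_simps)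
  qed
  moreover have "(\<lambda>n. (a n * \<eta> n)\<^sup>2) \<longlonglongrightarrow> 0\<^sup>2"
    by (intro tendsto_intros ae)
  ultimately have "M $ First $ Last * M $ Second $ Penult - M $ First $ Penult * M $ Second $ Last = 0"
    using LIMSEQ_unique by fastforce
  then have "rank_le_1 M"
    using affine_entries_limit[OF vn _ a av lim] by (intro rank_le_1_block) auto
  with M(2) show False by simp
qed

text \<open>The positive definite form in the hypothesis is minus the corner entry. It controls the
  scaled vectors, so that in the limit only the corner entry can differ from 0 and the rank is at
  most one.\<close>

lemma not_cartan_positive_definite:
  assumes 1: "\<And>\<phi> x y \<eta>. (\<phi>, x, y, \<eta>) \<in> lie \<Longrightarrow> y = 0"
    and 2: "\<And>\<phi> x y \<eta>. (\<phi>, x, y, \<eta>) \<in> lie \<Longrightarrow> (\<phi>, x, y, \<eta>) \<noteq> 0 \<Longrightarrow> \<phi> * \<eta> + (x \<bullet> x) / 2 > 0"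
  shows "\<not> cartan_decomposition_subgroup SO2n H"
proof
  assume "cartan_decomposition_subgroup SO2n H"
  then obtain M where M: "scaled_limit H M" "\<not> rank_le_1 M"
    using cartan_decomposition_limits(2) by blast
  obtain v r where v: "\<And>n :: nat. v n \<in> lie" and "filterlim r at_top sequentially" and a0: "(\<lambda>n. 1 / r n) \<longlonglongrightarrow> 0"
    and lim0: "(\<lambda>n. (1 / r n) *\<^sub>R nexp (v n)) \<longlonglongrightarrow> M"
    using scaled_limit_nexp[OF M(1)] by blast
  define a \<phi> x \<eta> where "a n = 1 / r n" and "\<phi> n = fst (v n)" and "x n = fst (snd (v n))"
    and "\<eta> n = snd (snd (snd (v n)))" for n
  have vn: "v n = (\<phi> n, x n, 0, \<eta> n)" for n
    using v[of n] 1 by (cases "v n") (auto simp: x_def \<phi>_def \<eta>_def)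
  have a: "a \<longlonglongrightarrow> 0" and lim: "(\<lambda>n. a n *\<^sub>R nexp (v n)) \<longlonglongrightarrow> M"
    using a0 lim0 by (simp_all add: a_def[abs_def])
  have limc: "(\<lambda>n. a n * nexp (v n) $ i $ j) \<longlonglongrightarrow> M $ i $ j" for i j
    using tendsto_vec_nth[OF tendsto_vec_nth[OF lim], of i j] by simp
  let ?f = "\<lambda>(\<phi> :: real, x :: (real, 'k) vec, y :: (real, 'k) vec, \<eta> :: real). \<phi> * \<eta> + (x \<bullet> x) / 2"
  have cont: "continuous_on UNIV ?f"
    unfolding case_prod_beta by (intro continuous_intros) auto
  have hom: "?f (c *\<^sub>R w) = c ^ 2 * ?f w" for c w
    by (cases w) (simp add: power2_eq_square algebra_simps)
  have pos: "?f w > 0" if w: "w \<in> lie" "w \<noteq> 0" for w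
    using 2 w by (cases w) auto
  have "\<exists>\<epsilon>>0. \<forall>w\<in>lie. \<epsilon> * norm w ^ 2 \<le> ?f w"
    by (rule homogeneous_lower_bound[OF subspace_lie cont hom pos]) simp_all
  then obtain \<epsilon> where \<epsilon>0: "\<epsilon> > 0" and \<epsilon>': "\<forall>w\<in>lie. \<epsilon> * norm w ^ 2 \<le> ?f w"
    by (elim exE conjE)
  note \<epsilon> = \<epsilon>0 bspec[OF \<epsilon>']
  have "(\<lambda>n. - (a n * nexp (v n) $ First $ Last)) \<longlonglongrightarrow> - M $ First $ Last"
    by (intro tendsto_intros limc)
  then have "(\<lambda>n. a n * ?f (v n)) \<longlonglongrightarrow> - M $ First $ Last"
    by (simp add: vn nexp_nth algebra_simps)
  from scaled_norm_tendsto_0[OF a \<epsilon>(2)[OF v] \<epsilon>(1) this]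
  have av: "(\<lambda>n. a n *\<^sub>R v n) \<longlonglongrightarrow> 0" .
  have ae: "(\<lambda>n. a n * \<eta> n) \<longlonglongrightarrow> 0"
    using tendsto_snd[OF tendsto_snd[OF tendsto_snd[OF av]]] by (simp add: vn)
  have "M $ Second $ Penult = 0" "M $ First $ Penult = 0"
    using LIMSEQ_unique[OF limc[of Second Penult], of 0] LIMSEQ_unique[OF limc[of First Penult], of 0] ae
    by (simp_all add: vn nexp_nth)
  then have "rank_le_1 M"
    using affine_entries_limit[OF vn _ a av lim] by (intro rank_le_1_block) auto
  with M(2) show False by simp
qed

text \<open>\<open>nmat v\<close> is nilpotent, so the exponential of the line is a polynomial in t.
  \<open>B d\<close> is its leading coefficient, which exists because \<open>B 0\<close> is the
  identity.\<close>

lemma nexp_line: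
  obtains B d where "d \<le> 4" "B d \<noteq> 0" "\<And>t. nexp (t *\<^sub>R v) = (\<Sum>k\<le>d. t ^ k *\<^sub>R B k)"
proof -
  define B where "B k = (1 / fact k) *\<^sub>R mpow (nmat v) k" for k
  have B5: "B k = 0" if "k \<ge> 5" for k
    using that by (cases v) (simp add: B_def mpow_nmat(5))
  have B0: "B 0 \<noteq> 0"
    by (auto simp: B_def vec_eq_iff mat_def)
  have nexp: "nexp (t *\<^sub>R v) = (\<Sum>k\<in>{..<5}. t ^ k *\<^sub>R B k)" for t
    unfolding matrix_exp_nmat[symmetric] matrix_exp_mpow nmat_scaleR mpow_scaleR
    by (subst suminf_finite[of "{..<5}"]) (auto simp: B5[unfolded B_def] B_def mult.commute, use B5 in \<open>force simp: B_def\<close>)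
  define d where "d = (GREATEST k. B k \<noteq> 0)"
  have bd: "\<And>k. B k \<noteq> 0 \<Longrightarrow> k \<le> 4"
    using B5 by (metis not_less_eq_eq eval_nat_numeral(2) eval_nat_numeral(3) semiring_norm(26) semiring_norm(27))
  have d: "B d \<noteq> 0"
    unfolding d_def by (rule GreatestI_nat[where P = "\<lambda>k. B k \<noteq> 0", OF B0 bd])
  have gt: "B k = 0" if "k > d" for k
    using Greatest_le_nat[where P = "\<lambda>k. B k \<noteq> 0", OF _ bd] that unfolding d_def by fastforce
  show ?thesis
  proof (rule that[of d B])
    show "nexp (t *\<^sub>R v) = (\<Sum>k\<le>d. t ^ k *\<^sub>R B k)" for t
      unfolding nexp using bd[OF d] by (intro sum.mono_neutral_right) (auto simp: gt not_le)
  qed (use d bd in auto)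
qed

text \<open>A nonzero rescaled limit forces the parameter to be unbounded, hence is a multiple of
  the leading coefficient \<open>B d\<close>. So all such limits agree on \<open>rank_le_1\<close>,
  whereas a Cartan decomposition requires both behaviours. Minors are quadratic, so only the square
  of the scalar enters and its sign needs no control.\<close>

lemma not_cartan_line:
  assumes line: "\<And>w. w \<in> lie \<Longrightarrow> \<exists>t. w = t *\<^sub>R v"
  shows "\<not> cartan_decomposition_subgroup SO2n H"
proof -
  obtain B d where d: "B d \<noteq> 0" and nexp: "\<And>t. nexp (t *\<^sub>R v) = (\<Sum>k\<le>d. t ^ k *\<^sub>R B k)"
    using nexp_line by metis
  have key: "rank_le_1 M \<longleftrightarrow> rank_le_1 (B d)" if M: "scaled_limit H M" "M \<noteq> 0" for M
  proof -
    obtain w r where w: "\<And>n :: nat. w n \<in> lie" and r: "filterlim r at_top sequentially"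
      and "(\<lambda>n. 1 / r n) \<longlonglongrightarrow> 0" and lim: "(\<lambda>n. (1 / r n) *\<^sub>R nexp (w n)) \<longlonglongrightarrow> M"
      using scaled_limit_nexp[OF M(1)] by blast
    have "\<exists>t. w n = t *\<^sub>R v" for n using line w by blast
    then obtain t where t: "\<And>n. w n = t n *\<^sub>R v" by metis
    have F: "filterlim (\<lambda>n. norm ((1 / r n) *\<^sub>R nexp (w n)) * r n) at_top sequentially"
      using M(2) by (intro filterlim_tendsto_pos_mult_at_top[OF tendsto_norm[OF lim] _ r]) simp
    have E: "\<forall>\<^sub>F n in sequentially. norm ((1 / r n) *\<^sub>R nexp (w n)) * r n = norm (nexp (w n))"
      using filterlim_at_top_dense[THEN iffD1, OF r, rule_format, of 0] by eventually_elim auto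
    have big: "filterlim (\<lambda>n. norm (nexp (w n))) at_top sequentially"
      using F unfolding filterlim_cong[OF refl refl E] .
    have tlim: "filterlim (\<lambda>n. \<bar>t n\<bar>) at_top sequentially"
      unfolding filterlim_at_top
    proof
      fix Z :: real
      have "compact ((\<lambda>s. nexp (s *\<^sub>R v)) ` {-\<bar>Z\<bar>..\<bar>Z\<bar>})"
        by (intro compact_continuous_image continuous_on_compose2[OF continuous_on_nexp[of UNIV]] continuous_intros) auto
      then obtain R where R: "\<And>s. \<bar>s\<bar> \<le> \<bar>Z\<bar> \<Longrightarrow> norm (nexp (s *\<^sub>R v)) \<le> R"
        using compact_imp_bounded bounded_iff by (metis (no_types, lifting) abs_le_iff atLeastAtMost_iff image_eqI minus_le_iff)
      have "\<forall>\<^sub>F n in sequentially. norm (nexp (w n)) > R"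
        using filterlim_at_top_dense[THEN iffD1, OF big] by blast
      then show "\<forall>\<^sub>F n in sequentially. Z \<le> \<bar>t n\<bar>"
      proof eventually_elim
        case (elim n)
        then show ?case using R[of "t n"] by (force simp: t)
      qed
    qed
    have tinv: "(\<lambda>n. inverse (t n)) \<longlonglongrightarrow> 0"
      using tendsto_inverse_0_at_top[OF tlim] by (simp add: tendsto_rabs_zero_iff flip: abs_inverse)
    have t0: "\<forall>\<^sub>F n in sequentially. t n \<noteq> 0"
      using filterlim_at_top_dense[THEN iffD1, OF tlim, rule_format, of 0] by eventually_elim auto
    define N where "N n = (\<Sum>k\<le>d. inverse (t n) ^ (d - k) *\<^sub>R B k)" for n
    have "N \<longlonglongrightarrow> (\<Sum>k\<le>d. 0 ^ (d - k) *\<^sub>R B k)"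
      unfolding N_def by (intro tendsto_intros tinv)
    also have "(\<Sum>k\<le>d. 0 ^ (d - k) *\<^sub>R B k) = (\<Sum>k\<in>{d}. 0 ^ (d - k) *\<^sub>R B k)"
      by (rule sum.mono_neutral_right) auto
    finally have N: "N \<longlonglongrightarrow> B d" by simp
    define s where "s n = t n ^ d / r n" for n
    have "\<forall>\<^sub>F n in sequentially. (1 / r n) *\<^sub>R nexp (w n) = s n *\<^sub>R N n"
      using t0
    proof eventually_elim
      case (elim n)
      have "t n ^ d * inverse (t n) ^ (d - k) = t n ^ k" if "k \<le> d" for k
        using elim that by (simp add: power_diff power_inverse field_simps)
      then have "nexp (w n) = t n ^ d *\<^sub>R N n"
        by (simp add: t nexp N_def scaleR_sum_right)
      then show ?case by (simp add: s_def)
    qed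
    from Lim_transform_eventually[OF lim this]
    have sN: "(\<lambda>n. s n *\<^sub>R N n) \<longlonglongrightarrow> M" .
    define \<sigma> where "\<sigma> = norm M / norm (B d)"
    have \<sigma>: "\<sigma> \<noteq> 0" using M(2) d by (simp add: \<sigma>_def)
    have "(\<lambda>n. norm (s n *\<^sub>R N n) / norm (N n)) \<longlonglongrightarrow> \<sigma>"
      unfolding \<sigma>_def using d by (intro tendsto_intros sN N) simp
    moreover have "\<forall>\<^sub>F n in sequentially. norm (s n *\<^sub>R N n) / norm (N n) = \<bar>s n\<bar>"
      using tendsto_imp_eventually_ne[OF N d] by eventually_elim simp
    ultimately have "(\<lambda>n. \<bar>s n\<bar>) \<longlonglongrightarrow> \<sigma>"
      by (rule Lim_transform_eventually)
    from tendsto_power[OF this, of 2] have s2: "(\<lambda>n. (s n)\<^sup>2) \<longlonglongrightarrow> \<sigma>\<^sup>2" by simp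
    have "M $ i $ j * M $ k $ l - M $ i $ l * M $ k $ j
        = \<sigma>\<^sup>2 * (B d $ i $ j * B d $ k $ l - B d $ i $ l * B d $ k $ j)" for i j k l
    proof (rule LIMSEQ_unique)
      have c: "(\<lambda>n. s n * N n $ i $ j) \<longlonglongrightarrow> M $ i $ j" for i j
        using tendsto_vec_nth[OF tendsto_vec_nth[OF sN], of i j] by simp
      show "(\<lambda>n. (s n * N n $ i $ j) * (s n * N n $ k $ l) - (s n * N n $ i $ l) * (s n * N n $ k $ j))
        \<longlonglongrightarrow> M $ i $ j * M $ k $ l - M $ i $ l * M $ k $ j"
        by (intro tendsto_intros c)
      have "(\<lambda>n. (s n)\<^sup>2 * (N n $ i $ j * N n $ k $ l - N n $ i $ l * N n $ k $ j))
        \<longlonglongrightarrow> \<sigma>\<^sup>2 * (B d $ i $ j * B d $ k $ l - B d $ i $ l * B d $ k $ j)"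
        by (intro tendsto_intros s2 N)
      then show "(\<lambda>n. (s n * N n $ i $ j) * (s n * N n $ k $ l) - (s n * N n $ i $ l) * (s n * N n $ k $ j))
        \<longlonglongrightarrow> \<sigma>\<^sup>2 * (B d $ i $ j * B d $ k $ l - B d $ i $ l * B d $ k $ j)"
        by (simp add: algebra_simps power2_eq_square)
    qed
    then show ?thesis
      using \<sigma> unfolding rank_le_1_def by (metis (no_types, opaque_lifting) mult_eq_0_iff power_not_zero right_minus_eq)
  qed
  have "rank_le_1 (0 :: real^('k idx)^('k idx))"
    by (simp add: rank_le_1_def)
  then show ?thesis
    using key cartan_decomposition_limits by blast
qed

end

subsection \<open>The decomposition \<open>G = K A K\<close>\<close>

text \<open>The form is negative definite on the span of \<open>n1, n2\<close> and positive definite on its orthogonal complement.\<close>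

definition n1 :: "real^('k::finite idx)" where "n1 = axis First 1 - axis Last 1"
definition n2 :: "real^('k::finite idx)" where "n2 = axis Second 1 - axis Penult 1"
definition p1 :: "real^('k::finite idx)" where "p1 = axis First 1 + axis Last 1"
definition p2 :: "real^('k::finite idx)" where "p2 = axis Second 1 + axis Penult 1"

lemma inner_frame:
  "n1 \<bullet> v = v $ First - v $ Last" "n2 \<bullet> v = v $ Second - v $ Penult"
  "p1 \<bullet> v = v $ First + v $ Last" "p2 \<bullet> v = v $ Second + v $ Penult"
  by (simp_all add: n1_def n2_def p1_def p2_def inner_diff_left inner_add_left inner_axis')

lemma frame_nth:
  "n1 $ i = (if i = First then 1 else if i = Last then -1 else 0)"
  "n2 $ i = (if i = Second then 1 else if i = Penult then -1 else 0)"
  "p1 $ i = (if i = First then 1 else if i = Last then 1 else 0)"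
  "p2 $ i = (if i = Second then 1 else if i = Penult then 1 else 0)"
  by (auto simp: n1_def n2_def p1_def p2_def axis_def)

lemma frame_orthogonal [simp]:
  "n1 \<bullet> n1 = 2" "n1 \<bullet> n2 = 0" "n1 \<bullet> p1 = 0" "n1 \<bullet> p2 = 0"
  "n2 \<bullet> n1 = 0" "n2 \<bullet> n2 = 2" "n2 \<bullet> p1 = 0" "n2 \<bullet> p2 = 0"
  "p1 \<bullet> n1 = 0" "p1 \<bullet> n2 = 0" "p1 \<bullet> p1 = 2" "p1 \<bullet> p2 = 0"
  "p2 \<bullet> n1 = 0" "p2 \<bullet> n2 = 0" "p2 \<bullet> p1 = 0" "p2 \<bullet> p2 = 2"
  by (simp_all add: inner_frame frame_nth)

text \<open>\<open>n1\<close> and \<open>n2\<close> are orthogonal of squared length two, so the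
  subtracted terms are twice the Euclidean product of the projections to their plane: the form is
  the Euclidean product with the sign reversed on that plane.\<close>

lemma bform_inner: "bform v w = v \<bullet> w - (n1 \<bullet> v) * (n1 \<bullet> w) - (n2 \<bullet> v) * (n2 \<bullet> w)"
  unfolding inner_frame bform_expand unfolding inner_vec_sum sum_idx by (simp add: algebra_simps)

lemma qform_inner: "qform v = v \<bullet> v - (n1 \<bullet> v)\<^sup>2 - (n2 \<bullet> v)\<^sup>2"
  by (simp add: qform_bform bform_inner power2_eq_square)

section \<open>The maximal compact subgroup and its action on frames\<close>

lemma SO2n_bform: "A \<in> carrier SO2n \<Longrightarrow> bform (A *v v) (A *v w) = bform v w"
  by (simp add: bform_adj matrix_vector_mul_assoc adj_inverse)

lemma SO2n_qform: "A \<in> carrier SO2n \<Longrightarrow> qform (A *v v) = qform v"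
  by (simp add: qform_bform SO2n_bform)

text \<open>The intersection with the orthogonal group, isomorphic to S(O(2) x O(n)).\<close>

definition maxcompact :: "(real^('k::finite idx)^('k idx)) set" where
  "maxcompact = {A \<in> carrier SO2n. \<forall>v. norm (A *v v) = norm v}"

lemma compact_maxcompact: "compact (maxcompact :: (real^('k::finite idx)^('k idx)) set)"
proof -
  have "maxcompact = carrier SO2n \<inter> (\<Inter>v. {A :: real^('k idx)^('k idx). norm (A *v v) = norm v})"
    by (auto simp: maxcompact_def)
  also have "closed \<dots>"
    unfolding matrix_vector_mult_def
    by (intro closed_Int closed_carrier_SO2n closed_INT closed_Collect_eq ballI continuous_intros)
  finally have "closed (maxcompact :: (real^('k idx)^('k idx)) set)" .
  moreover have "bounded (maxcompact :: (real^('k idx)^('k idx)) set)"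
    unfolding bounded_iff
  proof (intro exI ballI)
    fix A :: "real^('k idx)^('k idx)" assume A: "A \<in> maxcompact"
    have e: "\<bar>A $ i $ j\<bar> \<le> 1" for i j
    proof -
      have "\<bar>A $ i $ j\<bar> = \<bar>(A *v axis j 1) $ i\<bar>"
        by (simp add: matrix_vector_mult_basis column_def)
      also have "\<dots> \<le> norm (A *v axis j 1)"
        by (rule component_le_norm_cart)
      finally show ?thesis
        using A by (simp add: maxcompact_def)
    qed
    have "norm A \<le> (\<Sum>i\<in>UNIV. norm (A $ i))"
      by (simp add: norm_vec_def L2_set_le_sum)
    also have "\<dots> \<le> (\<Sum>i\<in>UNIV. \<Sum>j\<in>UNIV. \<bar>A $ i $ j\<bar>)"
      by (intro sum_mono) (simp add: norm_le_l1_cart)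
    also have "\<dots> \<le> (\<Sum>i\<in>(UNIV::'k idx set). \<Sum>j\<in>(UNIV::'k idx set). 1)"
      by (intro sum_mono e)
    finally show "norm A \<le> (\<Sum>i\<in>(UNIV::'k idx set). \<Sum>j\<in>(UNIV::'k idx set). 1)" .
  qed
  ultimately show ?thesis
    by (simp add: compact_eq_bounded_closed)
qed

lemma adj_maxcompact: "A \<in> maxcompact \<Longrightarrow> adj A \<in> maxcompact"
proof -
  assume A: "A \<in> maxcompact"
  then have c: "A \<in> carrier SO2n" by (simp add: maxcompact_def)
  have "norm (adj A *v v) = norm v" for v
  proof -
    have "norm (adj A *v v) = norm (A *v (adj A *v v))"
      using A by (simp add: maxcompact_def)
    also have "A *v (adj A *v v) = v"
      by (simp add: matrix_vector_mul_assoc adj_inverse[OF c])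
    finally show ?thesis .
  qed
  then show ?thesis
    using adj_inverse[OF c] by (simp add: maxcompact_def)
qed

lemma dim_orthogonal_frame:
  fixes a b c d :: "'a::euclidean_space"
  assumes "a \<bullet> b = 0" "a \<bullet> c = 0" "a \<bullet> d = 0" "b \<bullet> c = 0" "b \<bullet> d = 0" "c \<bullet> d = 0"
    "a \<noteq> 0" "b \<noteq> 0" "c \<noteq> 0" "d \<noteq> 0"
  shows "dim {y. a \<bullet> y = 0 \<and> b \<bullet> y = 0 \<and> c \<bullet> y = 0 \<and> d \<bullet> y = 0} + 4 = DIM('a)"
proof -
  let ?S = "{a, b, c, d}"
  have "pairwise orthogonal ?S"
    using assms by (auto simp: pairwise_def orthogonal_def inner_commute)
  then have "independent ?S"
    using assms by (intro pairwise_orthogonal_independent) auto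
  moreover have "card ?S = 4"
  proof -
    have "a \<noteq> b" "a \<noteq> c" "a \<noteq> d" "b \<noteq> c" "b \<noteq> d" "c \<noteq> d"
      using assms by auto
    then show ?thesis by simp
  qed
  ultimately have 4: "dim (span ?S) = 4"
    by (simp add: dim_eq_card_independent)
  have "{y \<in> UNIV. \<forall>x\<in>span ?S. orthogonal x y} = {y. a \<bullet> y = 0 \<and> b \<bullet> y = 0 \<and> c \<bullet> y = 0 \<and> d \<bullet> y = 0}"
  proof (intro equalityI subsetI)
    fix y assume "y \<in> {y. a \<bullet> y = 0 \<and> b \<bullet> y = 0 \<and> c \<bullet> y = 0 \<and> d \<bullet> y = 0}"
    then have "orthogonal y s" if "s \<in> ?S" for s
      using that by (auto simp: orthogonal_def inner_commute)
    then have "orthogonal y x" if "x \<in> span ?S" for x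
      using orthogonal_to_span[OF that] by blast
    then show "y \<in> {y \<in> UNIV. \<forall>x\<in>span ?S. orthogonal x y}"
      by (simp add: orthogonal_commute)
  next
    fix y assume "y \<in> {y \<in> UNIV. \<forall>x\<in>span ?S. orthogonal x y}"
    then show "y \<in> {y. a \<bullet> y = 0 \<and> b \<bullet> y = 0 \<and> c \<bullet> y = 0 \<and> d \<bullet> y = 0}"
      by (auto simp: orthogonal_def span_base)
  qed
  then show ?thesis
    using dim_subspace_orthogonal_to_vectors[of "span ?S" UNIV] 4 by simp
qed

text \<open>The map is prescribed on four orthogonal vectors and completed by a linear isometry
  between their orthogonal complements, which have equal dimension. It preserves the negative plane,
  hence both the norm and the form; only the sign of the determinant may have to be
  corrected.\<close>

lemma frame_isometry:
  fixes x1 x2 e1 e2 :: "real^('k::finite idx)"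
  assumes x: "x1 = (n1 \<bullet> x1 / 2) *\<^sub>R n1 + (n2 \<bullet> x1 / 2) *\<^sub>R n2" "x2 = (n1 \<bullet> x2 / 2) *\<^sub>R n1 + (n2 \<bullet> x2 / 2) *\<^sub>R n2"
    and xx: "x1 \<bullet> x1 = 2" "x2 \<bullet> x2 = 2" "x1 \<bullet> x2 = 0"
    and e: "n1 \<bullet> e1 = 0" "n2 \<bullet> e1 = 0" "n1 \<bullet> e2 = 0" "n2 \<bullet> e2 = 0"
    and ee: "e1 \<bullet> e1 = 2" "e2 \<bullet> e2 = 2" "e1 \<bullet> e2 = 0"
  shows "\<exists>A\<in>maxcompact. A *v n1 = x1 \<and> A *v n2 = x2 \<and> A *v p1 = e1 \<and> A *v p2 = e2"
proof -
  have xe: "x1 \<bullet> e1 = 0" "x1 \<bullet> e2 = 0" "x2 \<bullet> e1 = 0" "x2 \<bullet> e2 = 0"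
    by (subst x, simp add: inner_add_left e)+
  define M where "M = {y :: real^('k idx). n1 \<bullet> y = 0 \<and> n2 \<bullet> y = 0 \<and> p1 \<bullet> y = 0 \<and> p2 \<bullet> y = 0}"
  define T where "T = {y. x1 \<bullet> y = 0 \<and> x2 \<bullet> y = 0 \<and> e1 \<bullet> y = 0 \<and> e2 \<bullet> y = 0}"
  have nz: "x1 \<noteq> 0" "x2 \<noteq> 0" "e1 \<noteq> 0" "e2 \<noteq> 0" using xx ee by auto
  have nz': "n1 \<noteq> (0 :: real^('k idx))" "n2 \<noteq> (0 :: real^('k idx))" "p1 \<noteq> (0 :: real^('k idx))" "p2 \<noteq> (0 :: real^('k idx))"
    using frame_orthogonal by (metis inner_zero_left zero_neq_numeral)+
  have "dim M + 4 = dim T + 4"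
    unfolding M_def T_def
    by (subst (1 2) dim_orthogonal_frame) (use xx ee xe nz nz' in auto)
  moreover have "subspace M" "subspace T"
    by (auto simp: M_def T_def subspace_def inner_add_right)
  ultimately obtain f where f: "linear f" "f ` M = T" "\<And>y. y \<in> M \<Longrightarrow> norm (f y) = norm y"
    using isometries_subspaces[of M T] by (metis add_right_cancel)
  define mid where "mid v = v - (1/2) *\<^sub>R ((n1 \<bullet> v) *\<^sub>R n1 + (n2 \<bullet> v) *\<^sub>R n2 + (p1 \<bullet> v) *\<^sub>R p1 + (p2 \<bullet> v) *\<^sub>R p2)"
    for v :: "real^('k idx)"
  define k where "k v = (1/2) *\<^sub>R ((n1 \<bullet> v) *\<^sub>R x1 + (n2 \<bullet> v) *\<^sub>R x2 + (p1 \<bullet> v) *\<^sub>R e1 + (p2 \<bullet> v) *\<^sub>R e2) + f (mid v)" for v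
  have midM: "mid v \<in> M" for v
    by (simp add: M_def mid_def inner_diff_right inner_add_right)
  have lin_mid: "linear mid"
    by (rule linearI) (simp_all add: mid_def inner_add_right algebra_simps)
  have lin: "linear k"
    using linear_compose[OF lin_mid f(1)]
    by (auto simp: linear_iff k_def inner_add_right algebra_simps)
  have fT: "f (mid v) \<in> T" for v
    using f(2) midM by blast
  define \<alpha>1 \<beta>1 \<alpha>2 \<beta>2 where ab: "\<alpha>1 = n1 \<bullet> x1 / 2" "\<beta>1 = n2 \<bullet> x1 / 2" "\<alpha>2 = n1 \<bullet> x2 / 2" "\<beta>2 = n2 \<bullet> x2 / 2"
  have xab: "x1 = \<alpha>1 *\<^sub>R n1 + \<beta>1 *\<^sub>R n2" "x2 = \<alpha>2 *\<^sub>R n1 + \<beta>2 *\<^sub>R n2"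
    using x by (simp_all add: ab)
  have orth: "\<alpha>1\<^sup>2 + \<beta>1\<^sup>2 = 1" "\<alpha>2\<^sup>2 + \<beta>2\<^sup>2 = 1" "\<alpha>1 * \<alpha>2 + \<beta>1 * \<beta>2 = 0"
  proof -
    have "x1 \<bullet> x1 = 2 * (\<alpha>1\<^sup>2 + \<beta>1\<^sup>2)" "x2 \<bullet> x2 = 2 * (\<alpha>2\<^sup>2 + \<beta>2\<^sup>2)" "x1 \<bullet> x2 = 2 * (\<alpha>1 * \<alpha>2 + \<beta>1 * \<beta>2)"
      unfolding xab by (simp_all add: inner_add_left inner_add_right power2_eq_square algebra_simps)
    with xx show "\<alpha>1\<^sup>2 + \<beta>1\<^sup>2 = 1" "\<alpha>2\<^sup>2 + \<beta>2\<^sup>2 = 1" "\<alpha>1 * \<alpha>2 + \<beta>1 * \<beta>2 = 0"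
      by simp_all
  qed
  \<comment> \<open>\<open>x1\<close> and \<open>x2\<close> span the same plane as \<open>n1\<close>
    and \<open>n2\<close>: by Lagrange's identity the determinant of their coordinates has square
    one.\<close>
  have Tneg: "n1 \<bullet> z = 0" "n2 \<bullet> z = 0" if "z \<in> T" for z
  proof -
    have z: "\<alpha>1 * (n1 \<bullet> z) + \<beta>1 * (n2 \<bullet> z) = 0" "\<alpha>2 * (n1 \<bullet> z) + \<beta>2 * (n2 \<bullet> z) = 0"
      using that unfolding T_def xab by (simp_all add: inner_add_left)
    have "(\<alpha>1 * \<beta>2 - \<alpha>2 * \<beta>1)\<^sup>2 + (\<alpha>1 * \<alpha>2 + \<beta>1 * \<beta>2)\<^sup>2 = (\<alpha>1\<^sup>2 + \<beta>1\<^sup>2) * (\<alpha>2\<^sup>2 + \<beta>2\<^sup>2)"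
      by (simp add: power2_eq_square algebra_simps)
    then have d: "\<alpha>1 * \<beta>2 - \<alpha>2 * \<beta>1 \<noteq> 0"
      unfolding orth by auto
    have "(\<alpha>1 * \<beta>2 - \<alpha>2 * \<beta>1) * (n1 \<bullet> z) = \<beta>2 * (\<alpha>1 * (n1 \<bullet> z) + \<beta>1 * (n2 \<bullet> z)) - \<beta>1 * (\<alpha>2 * (n1 \<bullet> z) + \<beta>2 * (n2 \<bullet> z))"
      "(\<alpha>1 * \<beta>2 - \<alpha>2 * \<beta>1) * (n2 \<bullet> z) = \<alpha>1 * (\<alpha>2 * (n1 \<bullet> z) + \<beta>2 * (n2 \<bullet> z)) - \<alpha>2 * (\<alpha>1 * (n1 \<bullet> z) + \<beta>1 * (n2 \<bullet> z))"
      by (simp_all add: algebra_simps)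
    then show "n1 \<bullet> z = 0" "n2 \<bullet> z = 0"
      using d unfolding z by auto
  qed
  have kk: "k v \<bullet> k v = v \<bullet> v" for v
  proof -
    have z: "x1 \<bullet> f (mid v) = 0" "x2 \<bullet> f (mid v) = 0" "e1 \<bullet> f (mid v) = 0" "e2 \<bullet> f (mid v) = 0"
      using fT[of v] by (auto simp: T_def)
    have "f (mid v) \<bullet> f (mid v) = mid v \<bullet> mid v"
      using f(3)[OF midM] by (simp add: dot_square_norm)
    also have "\<dots> = v \<bullet> v - (1/2) * ((n1 \<bullet> v)\<^sup>2 + (n2 \<bullet> v)\<^sup>2 + (p1 \<bullet> v)\<^sup>2 + (p2 \<bullet> v)\<^sup>2)"
      by (simp add: mid_def inner_diff_left inner_diff_right inner_add_left inner_add_right power2_eq_square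
          inner_commute[of v n1] inner_commute[of v n2] inner_commute[of v p1] inner_commute[of v p2])
    finally have f2: "f (mid v) \<bullet> f (mid v) = v \<bullet> v - (1/2) * ((n1 \<bullet> v)\<^sup>2 + (n2 \<bullet> v)\<^sup>2 + (p1 \<bullet> v)\<^sup>2 + (p2 \<bullet> v)\<^sup>2)" .
    have z': "f (mid v) \<bullet> x1 = 0" "f (mid v) \<bullet> x2 = 0" "f (mid v) \<bullet> e1 = 0" "f (mid v) \<bullet> e2 = 0"
      "e1 \<bullet> x1 = 0" "e2 \<bullet> x1 = 0" "e1 \<bullet> x2 = 0" "e2 \<bullet> x2 = 0" "x2 \<bullet> x1 = 0" "e2 \<bullet> e1 = 0"
      using z xx(3) ee(3) xe by (simp_all add: inner_commute)
    have comb: "((1/2) *\<^sub>R (a *\<^sub>R x1 + b *\<^sub>R x2 + c *\<^sub>R e1 + d *\<^sub>R e2) + f (mid v)) \<bullet>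
        ((1/2) *\<^sub>R (a *\<^sub>R x1 + b *\<^sub>R x2 + c *\<^sub>R e1 + d *\<^sub>R e2) + f (mid v))
        = (1/2) * (a\<^sup>2 + b\<^sup>2 + c\<^sup>2 + d\<^sup>2) + f (mid v) \<bullet> f (mid v)" for a b c d
      by (simp add: inner_add_left inner_add_right z z' xx ee xe power2_eq_square)
    show ?thesis
      unfolding k_def comb f2 by simp
  qed
  have q: "qform (k v) = qform v" for v
  proof -
    have "n1 \<bullet> k v = \<alpha>1 * (n1 \<bullet> v) + \<alpha>2 * (n2 \<bullet> v)" "n2 \<bullet> k v = \<beta>1 * (n1 \<bullet> v) + \<beta>2 * (n2 \<bullet> v)"
      using Tneg[OF fT[of v]] by (simp_all add: k_def inner_add_right e ab algebra_simps)
    then have "(n1 \<bullet> k v)\<^sup>2 + (n2 \<bullet> k v)\<^sup>2 = (\<alpha>1\<^sup>2 + \<beta>1\<^sup>2) * (n1 \<bullet> v)\<^sup>2 + (\<alpha>2\<^sup>2 + \<beta>2\<^sup>2) * (n2 \<bullet> v)\<^sup>2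
       + 2 * (\<alpha>1 * \<alpha>2 + \<beta>1 * \<beta>2) * (n1 \<bullet> v) * (n2 \<bullet> v)"
      by (simp add: power2_eq_square algebra_simps)
    then show ?thesis
      unfolding orth by (simp add: qform_inner kk)
  qed
  have mid0: "mid n1 = 0" "mid n2 = 0" "mid p1 = 0" "mid p2 = 0"
    by (simp_all add: mid_def)
  define A where "A = matrix k"
  have A: "A *v v = k v" for v
    unfolding A_def using lin by (simp add: matrix_works)
  have Af: "A *v n1 = x1" "A *v n2 = x2" "A *v p1 = e1" "A *v p2 = e2"
    by (simp_all add: A k_def mid0 linear_0[OF f(1)])
  have Aadj: "adj A ** A = mat 1"
    using q by (simp add: preserves_iff_adj[symmetric] A)
  have An: "norm (A *v v) = norm v" for v
    using kk[of v] by (simp add: A norm_eq_sqrt_inner)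
  have "det A * det A = 1"
    using arg_cong[OF Aadj, of det] by (simp add: det_mul)
  then consider "det A = 1" | "det A = -1"
    by (metis square_eq_1_iff)
  then show ?thesis
  proof cases
    case 1
    then show ?thesis
      using Af Aadj An by (auto simp: maxcompact_def carrier_SO2n)
  next
    case 2
    \<comment> \<open>The reflection in one middle coordinate repairs the determinant without moving
      the four frame vectors. There is such a coordinate because n is at least 3.\<close>
    fix l :: 'k
    define S :: "real^('k idx)^('k idx)" where "S = (\<chi> i j. if i = j then if i = Mid l then -1 else 1 else 0)"
    have Sv: "(S *v v) $ i = (if i = Mid l then -1 else 1) * v $ i" for v i
      by (simp add: S_def matrix_vector_mult_def if_distrib[of "\<lambda>x. x * _"] sum.delta cong: if_cong)
    have "det S = (\<Prod>i\<in>(UNIV :: 'k idx set). if i = Mid l then -1 else 1)"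
      by (subst det_diagonal) (auto simp: S_def)
    also have "\<dots> = -1" by (simp add: prod.delta)
    finally have detS: "det S = -1" .
    have Sn: "(S *v v) \<bullet> (S *v v) = v \<bullet> v" for v
      unfolding inner_vec_def by (intro sum.cong) (auto simp: Sv)
    have Sq: "qform (S *v v) = qform v" for v
      by (simp add: qform_inner inner_frame Sv Sn)
    have Sf: "S *v n1 = n1" "S *v n2 = n2" "S *v p1 = p1" "S *v p2 = p2"
      by (auto simp: vec_eq_iff Sv frame_nth)
    have "\<forall>v. qform ((A ** S) *v v) = qform v"
      using q by (simp add: matrix_vector_mul_assoc[symmetric] A Sq)
    then have "A ** S \<in> carrier SO2n"
      using 2 detS by (simp add: carrier_SO2n preserves_iff_adj det_mul)
    moreover have "norm ((A ** S) *v v) = norm v" for v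
      using An Sn[of v] by (simp add: matrix_vector_mul_assoc[symmetric] norm_eq_sqrt_inner)
    moreover have "(A ** S) *v n1 = x1" "(A ** S) *v n2 = x2" "(A ** S) *v p1 = e1" "(A ** S) *v p2 = e2"
      using Af by (simp_all add: matrix_vector_mul_assoc[symmetric] Sf)
    ultimately show ?thesis
      by (auto simp: maxcompact_def)
  qed
qed

text \<open>For \<open>g = k ** torus a b ** l\<close> with \<open>k\<close>, \<open>l\<close> in the maximal compact subgroup, the block of \<open>g\<close> on the span of
  \<open>n1, n2\<close> has singular values \<open>ch a\<close> and \<open>ch b\<close>. So \<open>esq\<close> and \<open>edet\<close>, the squared norm and the determinant of this
  block, locate \<open>g\<close> in the Weyl chamber.\<close>

definition esq :: "real^('k::finite idx)^('k idx) \<Rightarrow> real" where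
  "esq g = ((n1 \<bullet> (g *v n1))\<^sup>2 + (n1 \<bullet> (g *v n2))\<^sup>2 + (n2 \<bullet> (g *v n1))\<^sup>2 + (n2 \<bullet> (g *v n2))\<^sup>2) / 4"

definition edet :: "real^('k::finite idx)^('k idx) \<Rightarrow> real" where
  "edet g = ((n1 \<bullet> (g *v n1)) * (n2 \<bullet> (g *v n2)) - (n1 \<bullet> (g *v n2)) * (n2 \<bullet> (g *v n1))) / 4"

text \<open>For positive \<open>a\<close>, the hyperbolic cosine of \<open>ln a\<close>.\<close>

definition ch :: "real \<Rightarrow> real" where
  "ch a = (a + 1 / a) / 2"

text \<open>The essential step of a singular value decomposition of a 2 x 2 matrix. A quarter turn
  exchanges the columns up to sign and so reverses the sign of their inner product; in between it
  vanishes. One more quarter turn puts the longer column first, if necessary.\<close>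

lemma rotation_orthogonal_columns:
  fixes a b d e :: real
  shows "\<exists>c s. c\<^sup>2 + s\<^sup>2 = 1 \<and> (c * a + s * b) * (c * b - s * a) + (c * d + s * e) * (c * e - s * d) = 0 \<and>
     (c * b - s * a)\<^sup>2 + (c * e - s * d)\<^sup>2 \<le> (c * a + s * b)\<^sup>2 + (c * d + s * e)\<^sup>2"
proof -
  define f where "f t = (cos t * a + sin t * b) * (cos t * b - sin t * a) + (cos t * d + sin t * e) * (cos t * e - sin t * d)" for t
  have cont: "continuous_on {0..pi/2} f"
    unfolding f_def by (intro continuous_intros)
  have ends: "f 0 = a * b + d * e" "f (pi/2) = - (a * b + d * e)"
    by (simp_all add: f_def algebra_simps)
  have "\<exists>t. f t = 0"
  proof (cases "f 0 \<le> 0")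
    case True
    then show ?thesis
      using IVT'[of f 0 0 "pi/2"] cont ends by auto
  next
    case False
    then show ?thesis
      using IVT2'[of f "pi/2" 0 0] cont ends by auto
  qed
  then obtain t where t: "f t = 0" by blast
  define c s where "c = cos t" and "s = sin t"
  have cs: "c\<^sup>2 + s\<^sup>2 = 1" and z: "(c * a + s * b) * (c * b - s * a) + (c * d + s * e) * (c * e - s * d) = 0"
    using t by (simp_all add: c_def s_def f_def)
  show ?thesis
  proof (cases "(c * b - s * a)\<^sup>2 + (c * e - s * d)\<^sup>2 \<le> (c * a + s * b)\<^sup>2 + (c * d + s * e)\<^sup>2")
    case True
    with cs z show ?thesis by blast
  next
    case False
    have sq: "(- s * b - c * a)\<^sup>2 = (c * a + s * b)\<^sup>2" "(- s * e - c * d)\<^sup>2 = (c * d + s * e)\<^sup>2"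
      "- s * a + c * b = c * b - s * a" "- s * d + c * e = c * e - s * d"
      by (simp_all add: power2_eq_square algebra_simps)
    show ?thesis
      using cs z False
      by (intro exI[of _ "- s"] exI[of _ c]) (simp add: sq[simplified] algebra_simps power2_eq_square)
  qed
qed

lemma exists_positive_frame_vector:
  fixes w :: "real^('k::finite idx)"
  shows "\<exists>e :: real^('k idx). n1 \<bullet> e = 0 \<and> n2 \<bullet> e = 0 \<and> e \<bullet> e = 2 \<and> w \<bullet> e = 0"
proof -
  define z :: "real^('k idx)" where "z = (if w \<bullet> p1 = 0 then p1 else (w \<bullet> p2) *\<^sub>R p1 - (w \<bullet> p1) *\<^sub>R p2)"
  have z: "n1 \<bullet> z = 0" "n2 \<bullet> z = 0" "w \<bullet> z = 0"
    by (simp_all add: z_def inner_diff_right mult.commute)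
  have "z \<bullet> z = (if w \<bullet> p1 = 0 then 2 else 2 * ((w \<bullet> p2)\<^sup>2 + (w \<bullet> p1)\<^sup>2))"
    by (simp add: z_def inner_diff_left inner_diff_right power2_eq_square)
  also have "\<dots> > 0"
    by (simp add: add_nonneg_pos)
  finally have "z \<bullet> z > 0" .
  then show ?thesis
    using z by (intro exI[of _ "sqrt (2 / (z \<bullet> z)) *\<^sub>R z"]) (simp add: mult.assoc[symmetric])
qed

text \<open>Nonzero vectors are normalized. A zero vector has no direction and is replaced by any
  admissible one, chosen first orthogonal to \<open>q\<close> and then to \<open>e1\<close>.\<close>

lemma exists_positive_frame:
  fixes p q :: "real^('k::finite idx)"
  assumes p: "n1 \<bullet> p = 0" "n2 \<bullet> p = 0" and q: "n1 \<bullet> q = 0" "n2 \<bullet> q = 0" and pq: "p \<bullet> q = 0"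
  shows "\<exists>e1 e2. n1 \<bullet> e1 = 0 \<and> n2 \<bullet> e1 = 0 \<and> n1 \<bullet> e2 = 0 \<and> n2 \<bullet> e2 = 0 \<and>
    e1 \<bullet> e1 = 2 \<and> e2 \<bullet> e2 = 2 \<and> e1 \<bullet> e2 = 0 \<and> p = sqrt (p \<bullet> p / 2) *\<^sub>R e1 \<and> q = sqrt (q \<bullet> q / 2) *\<^sub>R e2"
proof -
  have sq: "sqrt (x \<bullet> x / 2) * sqrt (2 / (x \<bullet> x)) = 1" "(sqrt (2 / (x \<bullet> x)))\<^sup>2 = 2 / (x \<bullet> x)"
    if "x \<noteq> 0" for x :: "real^('k idx)"
    using that by (simp_all add: real_sqrt_mult[symmetric])
  have nrm: "(sqrt (2 / (x \<bullet> x)) *\<^sub>R x) \<bullet> (sqrt (2 / (x \<bullet> x)) *\<^sub>R x) = 2" if "x \<noteq> 0" for x :: "real^('k idx)"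
    using that sq(2)[OF that] by (simp add: power2_eq_square mult.assoc[symmetric])
  obtain e where e: "n1 \<bullet> e = 0" "n2 \<bullet> e = 0" "e \<bullet> e = 2" "q \<bullet> e = 0"
    using exists_positive_frame_vector[of q] by blast
  define e1 where "e1 = (if p = 0 then e else sqrt (2 / (p \<bullet> p)) *\<^sub>R p)"
  have e1: "n1 \<bullet> e1 = 0" "n2 \<bullet> e1 = 0" "e1 \<bullet> e1 = 2" "q \<bullet> e1 = 0" "p = sqrt (p \<bullet> p / 2) *\<^sub>R e1"
    using e p pq nrm[of p] sq(1)[of p] by (auto simp: e1_def inner_commute[of q p])
  obtain e' where e': "n1 \<bullet> e' = 0" "n2 \<bullet> e' = 0" "e' \<bullet> e' = 2" "e1 \<bullet> e' = 0"
    using exists_positive_frame_vector[of e1] by blast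
  define e2 where "e2 = (if q = 0 then e' else sqrt (2 / (q \<bullet> q)) *\<^sub>R q)"
  have e2: "n1 \<bullet> e2 = 0" "n2 \<bullet> e2 = 0" "e2 \<bullet> e2 = 2" "e1 \<bullet> e2 = 0" "q = sqrt (q \<bullet> q / 2) *\<^sub>R e2"
    using e' q e1 nrm[of q] sq(1)[of q] by (auto simp: e2_def inner_commute[of e1 q])
  show ?thesis
    using e1 e2 by blast
qed

lemma ch_surj:
  assumes "\<alpha> \<ge> 1"
  shows "\<exists>a\<ge>1. ch a = \<alpha> \<and> (a - 1 / a) / 2 = sqrt (\<alpha>\<^sup>2 - 1)"
proof -
  define r where "r = sqrt (\<alpha>\<^sup>2 - 1)"
  have r: "r\<^sup>2 = \<alpha>\<^sup>2 - 1" "r \<ge> 0"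
    using assms by (simp_all add: r_def)
  have "(\<alpha> + r) * (\<alpha> - r) = 1"
    using r(1) by (simp add: power2_eq_square algebra_simps)
  then have "1 / (\<alpha> + r) = \<alpha> - r"
    using assms r(2) by (simp add: field_simps)
  then show ?thesis
    using assms r(2) by (intro exI[of _ "\<alpha> + r"]) (simp add: ch_def flip: r_def)
qed

text \<open>The torus acts by hyperbolic rotations in the planes of \<open>n1\<close>,
  \<open>p1\<close> and of \<open>n2\<close>, \<open>p2\<close>.\<close>

lemma torus_frame:
  "torus a b *v n1 = ch a *\<^sub>R n1 + ((a - 1 / a) / 2) *\<^sub>R (p1 :: real^('k::finite idx))"
  "torus a b *v n2 = ch b *\<^sub>R n2 + ((b - 1 / b) / 2) *\<^sub>R (p2 :: real^('k idx))"
proof -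
  have T: "(torus a b *v v) $ i = (case i of First \<Rightarrow> a | Second \<Rightarrow> b | Mid _ \<Rightarrow> 1 | Penult \<Rightarrow> 1 / b | Last \<Rightarrow> 1 / a) * v $ i" for v and i :: "'k idx"
    by (simp add: torus_def matrix_vector_mult_def if_distrib[of "\<lambda>x. x * _"] cong: if_cong)
  have "(torus a b *v n1) $ i = (ch a *\<^sub>R n1 + ((a - 1 / a) / 2) *\<^sub>R p1) $ i" for i :: "'k idx"
    by (cases i) (simp_all add: T frame_nth ch_def add_divide_distrib diff_divide_distrib)
  moreover have "(torus a b *v n2) $ i = (ch b *\<^sub>R n2 + ((b - 1 / b) / 2) *\<^sub>R p2) $ i" for i :: "'k idx"
    by (cases i) (simp_all add: T frame_nth ch_def add_divide_distrib diff_divide_distrib)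
  ultimately show "torus a b *v n1 = ch a *\<^sub>R n1 + ((a - 1 / a) / 2) *\<^sub>R (p1 :: real^('k idx))"
    "torus a b *v n2 = ch b *\<^sub>R n2 + ((b - 1 / b) / 2) *\<^sub>R (p2 :: real^('k idx))"
    by (simp_all add: vec_eq_iff)
qed

lemma torus_mult: "torus a b ** torus a' b' = torus (a * a') (b * b')"
proof -
  have "(torus a b ** torus a' b') $ i $ j = torus (a * a') (b * b') $ i $ j" for i j :: "'a idx"
    by (cases i; cases j) (auto simp: matrix_mul_nth torus_def sum_idx if_distrib[of "\<lambda>x. x * _"] cong: if_cong)
  then show ?thesis by (simp add: vec_eq_iff)
qed

lemma torus_1: "torus 1 1 = mat 1"
proof -
  have "torus 1 1 $ i $ j = mat 1 $ i $ j" for i j :: "'a idx"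
    by (cases i; cases j) (auto simp: torus_def mat_def)
  then show ?thesis by (simp add: vec_eq_iff)
qed

lemma SO2n_mult: "A \<in> carrier SO2n \<Longrightarrow> B \<in> carrier SO2n \<Longrightarrow> A ** B \<in> carrier SO2n"
  using subgroup.m_closed[OF group.subgroup_self[OF group_SO2n], of A B] by simp

lemma bform_frame: "bform n1 v = - (n1 \<bullet> v)" "bform n2 v = - (n2 \<bullet> v)"
  by (simp_all add: bform_inner)

text \<open>Rotate \<open>n1\<close>, \<open>n2\<close> to \<open>r1\<close>, \<open>r2\<close> so
  that the negative parts \<open>m\<close>, \<open>m'\<close> of their images under \<open>g\<close>
  are orthogonal. Since \<open>g\<close> preserves the form, the positive parts \<open>p\<close>,
  \<open>q\<close> are then orthogonal too, and their lengths are those of the hyperbolic sines that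
  belong to the cosines \<open>\<alpha>\<close> and \<open>\<beta>\<close>. So some k times a torus
  element agrees with \<open>g\<close> on this plane, up to the rotation, and the remaining factor
  \<open>l\<close> preserves the negative plane, hence the Euclidean norm.\<close>

lemma KAK:
  fixes g :: "real^('k::finite idx)^('k idx)"
  assumes g: "g \<in> carrier SO2n"
  shows "\<exists>k\<in>maxcompact. \<exists>l\<in>maxcompact. \<exists>a\<ge>1. \<exists>b\<ge>1. g = k ** torus a b ** l \<and> 1 \<le> ch b \<and> ch b \<le> ch a \<and>
    (ch a)\<^sup>2 + (ch b)\<^sup>2 = esq g \<and> ch a * ch b = \<bar>edet g\<bar>"
proof -
  define d11 d12 d21 d22 where d: "d11 = n1 \<bullet> (g *v n1) / 2" "d12 = n1 \<bullet> (g *v n2) / 2"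
    "d21 = n2 \<bullet> (g *v n1) / 2" "d22 = n2 \<bullet> (g *v n2) / 2"
  have E: "esq g = d11\<^sup>2 + d12\<^sup>2 + d21\<^sup>2 + d22\<^sup>2" and D: "edet g = d11 * d22 - d12 * d21"
    by (simp_all add: esq_def edet_def d power2_eq_square field_simps)
  obtain c s where cs: "c\<^sup>2 + s\<^sup>2 = 1"
    and orth: "(c * d11 + s * d12) * (c * d12 - s * d11) + (c * d21 + s * d22) * (c * d22 - s * d21) = 0"
    and le: "(c * d12 - s * d11)\<^sup>2 + (c * d22 - s * d21)\<^sup>2 \<le> (c * d11 + s * d12)\<^sup>2 + (c * d21 + s * d22)\<^sup>2"
    using rotation_orthogonal_columns[of d11 d12 d21 d22] by blast
  define r1 r2 :: "real^('k idx)" where r: "r1 = c *\<^sub>R n1 + s *\<^sub>R n2" "r2 = c *\<^sub>R n2 - s *\<^sub>R n1"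
  define u u' where u: "u = g *v r1" "u' = g *v r2"
  have nu: "n1 \<bullet> u = 2 * (c * d11 + s * d12)" "n2 \<bullet> u = 2 * (c * d21 + s * d22)"
    "n1 \<bullet> u' = 2 * (c * d12 - s * d11)" "n2 \<bullet> u' = 2 * (c * d22 - s * d21)"
    by (simp_all add: u r d matrix_vector_right_distrib matrix_vector_mult_scaleR inner_add_right inner_diff_right
        matrix_vector_mult_diff_distrib)
  have "bform u u = bform r1 r1" "bform u' u' = bform r2 r2" "bform u u' = bform r1 r2"
    unfolding u by (rule SO2n_bform[OF g])+
  moreover have "bform r1 r1 = - 2 * (c\<^sup>2 + s\<^sup>2)" "bform r2 r2 = - 2 * (c\<^sup>2 + s\<^sup>2)" "bform r1 r2 = 0"
    by (simp_all add: r bform_inner inner_add_left inner_add_right inner_diff_left inner_diff_right power2_eq_square algebra_simps)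
  ultimately have b: "bform u u = - 2" "bform u' u' = - 2" "bform u u' = 0"
    unfolding cs by simp_all
  define \<alpha> \<beta> where ab: "\<alpha> = sqrt ((c * d11 + s * d12)\<^sup>2 + (c * d21 + s * d22)\<^sup>2)"
    "\<beta> = sqrt ((c * d12 - s * d11)\<^sup>2 + (c * d22 - s * d21)\<^sup>2)"
  have ab2: "\<alpha>\<^sup>2 = (c * d11 + s * d12)\<^sup>2 + (c * d21 + s * d22)\<^sup>2" "\<beta>\<^sup>2 = (c * d12 - s * d11)\<^sup>2 + (c * d22 - s * d21)\<^sup>2"
    unfolding ab by simp_all
  define m m' :: "real^('k idx)" where m: "m = (n1 \<bullet> u / 2) *\<^sub>R n1 + (n2 \<bullet> u / 2) *\<^sub>R n2" "m' = (n1 \<bullet> u' / 2) *\<^sub>R n1 + (n2 \<bullet> u' / 2) *\<^sub>R n2"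
  define p q where pq: "p = u - m" "q = u' - m'"
  have mm: "m \<bullet> m = 2 * \<alpha>\<^sup>2" "m' \<bullet> m' = 2 * \<beta>\<^sup>2" "m \<bullet> m' = 0"
  proof -
    have "m \<bullet> m' = 2 * ((c * d11 + s * d12) * (c * d12 - s * d11) + (c * d21 + s * d22) * (c * d22 - s * d21))"
      by (simp add: m inner_add_left inner_add_right nu) (simp add: field_simps)
    then show "m \<bullet> m' = 0" unfolding orth by simp
    have "m \<bullet> m = 2 * ((n1 \<bullet> u / 2)\<^sup>2 + (n2 \<bullet> u / 2)\<^sup>2)" "m' \<bullet> m' = 2 * ((n1 \<bullet> u' / 2)\<^sup>2 + (n2 \<bullet> u' / 2)\<^sup>2)"
      by (simp_all add: m inner_add_left inner_add_right power2_eq_square)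
    moreover have "n1 \<bullet> u / 2 = c * d11 + s * d12" "n2 \<bullet> u / 2 = c * d21 + s * d22"
      "n1 \<bullet> u' / 2 = c * d12 - s * d11" "n2 \<bullet> u' / 2 = c * d22 - s * d21"
      unfolding nu by (rule nonzero_mult_div_cancel_left, simp)+
    ultimately show "m \<bullet> m = 2 * \<alpha>\<^sup>2" "m' \<bullet> m' = 2 * \<beta>\<^sup>2"
      unfolding ab2 by simp_all
  qed
  have np: "n1 \<bullet> p = 0" "n2 \<bullet> p = 0" "n1 \<bullet> q = 0" "n2 \<bullet> q = 0"
    by (simp_all add: pq m inner_diff_right inner_add_right)
  have mp: "m \<bullet> p = 0" "m \<bullet> q = 0" "m' \<bullet> p = 0" "m' \<bullet> q = 0"
    by (simp_all add: m inner_add_left np)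
  have nm: "n1 \<bullet> m = n1 \<bullet> u" "n2 \<bullet> m = n2 \<bullet> u" "n1 \<bullet> m' = n1 \<bullet> u'" "n2 \<bullet> m' = n2 \<bullet> u'"
    by (simp_all add: m inner_add_right)
  have um: "u = m + p" "u' = m' + q" by (simp_all add: pq)
  have uu: "u \<bullet> u = 2 * \<alpha>\<^sup>2 + p \<bullet> p" "u' \<bullet> u' = 2 * \<beta>\<^sup>2 + q \<bullet> q" "u \<bullet> u' = p \<bullet> q"
    by (simp_all add: um inner_add_left inner_add_right mm mp inner_commute[of p m] inner_commute[of q m'] inner_commute[of p m'])
  have pp: "p \<bullet> p = 2 * (\<alpha>\<^sup>2 - 1)" "q \<bullet> q = 2 * (\<beta>\<^sup>2 - 1)"
  proof -
    have "(n1 \<bullet> u) * (n1 \<bullet> u) + (n2 \<bullet> u) * (n2 \<bullet> u) = 4 * \<alpha>\<^sup>2"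
      "(n1 \<bullet> u') * (n1 \<bullet> u') + (n2 \<bullet> u') * (n2 \<bullet> u') = 4 * \<beta>\<^sup>2"
      unfolding nu ab2 by algebra+
    note h = this b(1,2)[unfolded bform_inner uu]
    show "p \<bullet> p = 2 * (\<alpha>\<^sup>2 - 1)"
      using h by algebra
    show "q \<bullet> q = 2 * (\<beta>\<^sup>2 - 1)"
      using h by algebra
  qed
  have "bform u u' = p \<bullet> q - 4 * ((c * d11 + s * d12) * (c * d12 - s * d11) + (c * d21 + s * d22) * (c * d22 - s * d21))"
    unfolding bform_inner uu nu by algebra
  then have pq0: "p \<bullet> q = 0"
    unfolding orth b by simp
  have ab1: "\<alpha> \<ge> 1" "\<beta> \<ge> 1" "\<beta> \<le> \<alpha>"
  proof -
    have 1: "1\<^sup>2 \<le> \<alpha>\<^sup>2" "1\<^sup>2 \<le> \<beta>\<^sup>2"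
      using pp inner_ge_zero[of p] inner_ge_zero[of q] by simp_all
    show "\<alpha> \<ge> 1"
      by (rule power2_le_imp_le[OF 1(1)]) (simp add: ab)
    show "\<beta> \<ge> 1"
      by (rule power2_le_imp_le[OF 1(2)]) (simp add: ab)
    show "\<beta> \<le> \<alpha>" unfolding ab using le by simp
  qed
  obtain e1 e2 where e: "n1 \<bullet> e1 = 0" "n2 \<bullet> e1 = 0" "n1 \<bullet> e2 = 0" "n2 \<bullet> e2 = 0" "e1 \<bullet> e1 = 2" "e2 \<bullet> e2 = 2" "e1 \<bullet> e2 = 0"
    and pe: "p = sqrt (p \<bullet> p / 2) *\<^sub>R e1" "q = sqrt (q \<bullet> q / 2) *\<^sub>R e2"
    using exists_positive_frame[OF np pq0] by blast
  obtain a where a: "a \<ge> 1" "ch a = \<alpha>" "(a - 1 / a) / 2 = sqrt (\<alpha>\<^sup>2 - 1)"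
    using ch_surj[OF ab1(1)] by blast
  obtain b' where b': "b' \<ge> 1" "ch b' = \<beta>" "(b' - 1 / b') / 2 = sqrt (\<beta>\<^sup>2 - 1)"
    using ch_surj[OF ab1(2)] by blast
  define x1 x2 where x: "x1 = (1 / \<alpha>) *\<^sub>R m" "x2 = (1 / \<beta>) *\<^sub>R m'"
  have "\<exists>A\<in>maxcompact. A *v n1 = x1 \<and> A *v n2 = x2 \<and> A *v p1 = e1 \<and> A *v p2 = e2"
  proof (rule frame_isometry)
    show "x1 = (n1 \<bullet> x1 / 2) *\<^sub>R n1 + (n2 \<bullet> x1 / 2) *\<^sub>R n2" "x2 = (n1 \<bullet> x2 / 2) *\<^sub>R n1 + (n2 \<bullet> x2 / 2) *\<^sub>R n2"
      by (simp_all add: x nm) (simp_all add: m scaleR_add_right)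
    show "x1 \<bullet> x1 = 2" "x2 \<bullet> x2 = 2" "x1 \<bullet> x2 = 0"
      using ab1 by (simp_all add: x mm power2_eq_square)
  qed (rule e)+
  then obtain k where k: "k \<in> maxcompact" "k *v n1 = x1" "k *v n2 = x2" "k *v p1 = e1" "k *v p2 = e2"
    by blast
  let ?T = "torus a b' :: real^('k idx)^('k idx)"
  have kT: "k ** ?T \<in> carrier SO2n"
    using k(1) a(1) b'(1) by (intro SO2n_mult torus_SO2n) (auto simp: maxcompact_def)
  have kTn: "(k ** ?T) *v n1 = u" "(k ** ?T) *v n2 = u'"
  proof -
    have "(k ** ?T) *v n1 = \<alpha> *\<^sub>R x1 + sqrt (\<alpha>\<^sup>2 - 1) *\<^sub>R e1"
      by (simp add: matrix_vector_mul_assoc[symmetric] torus_frame a(2,3) matrix_vector_right_distrib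
          matrix_vector_mult_scaleR k)
    also have "\<dots> = u"
      unfolding um using pe(1) pp(1) ab1 by (simp add: x)
    finally show "(k ** ?T) *v n1 = u" .
    have "(k ** ?T) *v n2 = \<beta> *\<^sub>R x2 + sqrt (\<beta>\<^sup>2 - 1) *\<^sub>R e2"
      by (simp add: matrix_vector_mul_assoc[symmetric] torus_frame b'(2,3) matrix_vector_right_distrib
          matrix_vector_mult_scaleR k)
    also have "\<dots> = u'"
      unfolding um using pe(2) pp(2) ab1 by (simp add: x)
    finally show "(k ** ?T) *v n2 = u'" .
  qed
  define l where "l = adj (k ** ?T) ** g"
  have l: "l \<in> carrier SO2n"
    unfolding l_def by (intro SO2n_mult adj_inverse(3) kT g)
  have gl: "g = k ** ?T ** l"
    unfolding l_def matrix_mul_assoc[symmetric, of "k ** ?T"]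
    by (metis adj_inverse(2)[OF kT] matrix_mul_assoc matrix_mul_lid)
  have lr: "l *v r1 = n1" "l *v r2 = n2"
  proof -
    have "l *v r1 = adj (k ** ?T) *v ((k ** ?T) *v n1)" "l *v r2 = adj (k ** ?T) *v ((k ** ?T) *v n2)"
      unfolding kTn u by (simp_all add: l_def matrix_vector_mul_assoc)
    then show "l *v r1 = n1" "l *v r2 = n2"
      by (simp_all add: matrix_vector_mul_assoc adj_inverse(1)[OF kT])
  qed
  have "norm (l *v v) = norm v" for v
  proof -
    have "n1 \<bullet> (l *v v) = - bform r1 v" "n2 \<bullet> (l *v v) = - bform r2 v"
      using bform_frame[of "l *v v"] SO2n_bform[OF l, of r1 v] SO2n_bform[OF l, of r2 v] by (simp_all add: lr)
    then have "n1 \<bullet> (l *v v) = c * (n1 \<bullet> v) + s * (n2 \<bullet> v)" "n2 \<bullet> (l *v v) = c * (n2 \<bullet> v) - s * (n1 \<bullet> v)"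
      by (simp_all add: r bform_inner inner_add_left inner_diff_left inner_diff_right inner_add_right algebra_simps)
    then have "(n1 \<bullet> (l *v v))\<^sup>2 + (n2 \<bullet> (l *v v))\<^sup>2 = (c\<^sup>2 + s\<^sup>2) * ((n1 \<bullet> v)\<^sup>2 + (n2 \<bullet> v)\<^sup>2)"
      by algebra
    then have "(l *v v) \<bullet> (l *v v) = v \<bullet> v"
      using SO2n_qform[OF l, of v] by (simp add: qform_inner cs)
    then show ?thesis by (simp add: norm_eq_sqrt_inner)
  qed
  with l have lK: "l \<in> maxcompact"
    by (simp add: maxcompact_def)
  have "(ch a)\<^sup>2 + (ch b')\<^sup>2 = (c\<^sup>2 + s\<^sup>2) * esq g"
    unfolding a b' ab2 E by (simp add: power2_eq_square algebra_simps)
  then have 1: "(ch a)\<^sup>2 + (ch b')\<^sup>2 = esq g" by (simp add: cs)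
  \<comment> \<open>Lagrange's identity: the product of the squared column lengths is the squared
    determinant plus the squared inner product, and the rotation has made the latter zero.\<close>
  have "(ch a * ch b')\<^sup>2 = ((c\<^sup>2 + s\<^sup>2) * edet g)\<^sup>2
      + ((c * d11 + s * d12) * (c * d12 - s * d11) + (c * d21 + s * d22) * (c * d22 - s * d21))\<^sup>2"
    unfolding a b' D power_mult_distrib ab2 by algebra
  then have "(ch a * ch b')\<^sup>2 = (edet g)\<^sup>2"
    unfolding orth cs by simp
  then have "\<bar>ch a * ch b'\<bar> = \<bar>edet g\<bar>"
    by (simp add: power2_eq_iff abs_eq_iff)
  then have 2: "ch a * ch b' = \<bar>edet g\<bar>"
    using ab1 by (simp add: a b')
  show ?thesis
    using k(1) lK a(1) b'(1) gl 1 2 ab1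
    by (intro bexI[of _ k] bexI[of _ l] exI[of _ a] exI[of _ b'] conjI) (simp_all only: a(2) b'(2))
qed

text \<open>The larger of the two values of \<open>ch\<close> is determined by \<open>esq\<close> up
  to a factor 2, hence the smaller one by \<open>edet\<close> up to 2 M. For arguments at least one,
  \<open>ch x\<close> lies between x/2 and x, which gives the bound 4 M on the ratios of torus
  parameters. One factor carries the ratio torus, the other \<open>torus 1 1\<close>, so a single
  compact set serves on both sides.\<close>

lemma KAK_close:
  fixes M :: real
  assumes "M \<ge> 1"
  shows "\<exists>C :: (real^('k::finite idx)^('k idx)) set. compact C \<and> C \<subseteq> carrier SO2n \<and>
    (\<forall>g\<in>carrier SO2n. \<forall>h\<in>carrier SO2n. esq g = esq h \<and> \<bar>edet g\<bar> \<le> M * \<bar>edet h\<bar> \<and> \<bar>edet h\<bar> \<le> M * \<bar>edet g\<bar> \<longrightarrow>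
      (\<exists>c\<in>C. \<exists>c'\<in>C. g = c ** h ** c'))"
proof -
  define I where "I = {1 / (4 * M) .. 4 * M}"
  define C where "C = (\<lambda>(k, a, b, l). k ** torus a b ** l) `
    ((maxcompact :: (real^('k idx)^('k idx)) set) \<times> I \<times> I \<times> (maxcompact :: (real^('k idx)^('k idx)) set))"
  have pos: "x > 0" if "x \<in> I" for x
  proof -
    have "0 < 1 / (4 * M)" using assms by simp
    also have "\<dots> \<le> x" using that by (simp add: I_def)
    finally show ?thesis .
  qed
  have contT: "continuous_on (I \<times> I) (\<lambda>(a, b). torus a b :: real^('k idx)^('k idx))"
  proof -
    have "continuous_on (I \<times> I) (\<lambda>q. torus (fst q) (snd q) $ i $ j :: real)" for i j :: "'k idx"
    proof (cases "i = j")
      case True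
      have nz: "\<forall>q\<in>I \<times> I. fst q \<noteq> 0" "\<forall>q\<in>I \<times> I. snd q \<noteq> 0"
        using pos by force+
      show ?thesis
        using nz True by (cases i) (auto simp: torus_def intro!: continuous_intros)
    qed (simp add: torus_def)
    then have "continuous_on (I \<times> I) (\<lambda>q. (\<chi> i j. torus (fst q) (snd q) $ i $ j) :: real^('k idx)^('k idx))"
      by (intro continuous_on_vec_lambda)
    then show ?thesis by (simp add: case_prod_beta)
  qed
  have "compact C"
    unfolding C_def
  proof (intro compact_continuous_image compact_Times compact_maxcompact)
    let ?D = "(maxcompact :: (real^('k idx)^('k idx)) set) \<times> I \<times> I \<times> (maxcompact :: (real^('k idx)^('k idx)) set)"
    have "continuous_on ?D (\<lambda>z. (\<lambda>(a, b). torus a b :: real^('k idx)^('k idx)) (fst (snd z), fst (snd (snd z))))"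
      by (rule continuous_on_compose2[OF contT]) (auto intro!: continuous_intros)
    then show "continuous_on ?D (\<lambda>(k, a, b, l). k ** torus a b ** l)"
      unfolding case_prod_beta by (intro continuous_on_matrix_mult continuous_intros) auto
  qed (auto simp: I_def)
  moreover have "C \<subseteq> carrier SO2n"
  proof -
    have "k ** torus a b ** l \<in> carrier SO2n" if "k \<in> maxcompact" "l \<in> maxcompact" "a \<in> I" "b \<in> I"
      for k l :: "real^('k idx)^('k idx)" and a b
      using that pos[of a] pos[of b] by (intro SO2n_mult torus_SO2n) (auto simp: maxcompact_def)
    then show ?thesis by (auto simp: C_def)
  qed
  moreover have "\<exists>c\<in>C. \<exists>c'\<in>C. g = c ** h ** c'"
    if g: "g \<in> carrier SO2n" and h: "h \<in> carrier SO2n" and E: "esq g = esq h"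
      and D: "\<bar>edet g\<bar> \<le> M * \<bar>edet h\<bar>" "\<bar>edet h\<bar> \<le> M * \<bar>edet g\<bar>" for g h :: "real^('k idx)^('k idx)"
  proof -
    obtain k l a b where k: "k \<in> maxcompact" "l \<in> maxcompact" "a \<ge> 1" "b \<ge> 1" "g = k ** torus a b ** l"
      "1 \<le> ch b" "ch b \<le> ch a" "(ch a)\<^sup>2 + (ch b)\<^sup>2 = esq g" "ch a * ch b = \<bar>edet g\<bar>"
      using KAK[OF g] by blast
    obtain k' l' a' b' where k': "k' \<in> maxcompact" "l' \<in> maxcompact" "a' \<ge> 1" "b' \<ge> 1" "h = k' ** torus a' b' ** l'"
      "1 \<le> ch b'" "ch b' \<le> ch a'" "(ch a')\<^sup>2 + (ch b')\<^sup>2 = esq h" "ch a' * ch b' = \<bar>edet h\<bar>"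
      using KAK[OF h] by blast
    have chle: "ch t \<le> 2 * ch t'" if "(ch t)\<^sup>2 + (ch s)\<^sup>2 = (ch t')\<^sup>2 + (ch s')\<^sup>2" "ch s' \<le> ch t'" "1 \<le> ch s'" for s t s' t'
    proof (rule power2_le_imp_le)
      have "(ch s')\<^sup>2 \<le> (ch t')\<^sup>2"
        using that by (intro power_mono) auto
      then show "(ch t)\<^sup>2 \<le> (2 * ch t')\<^sup>2"
        using that(1) zero_le_power2[of "ch s"] zero_le_power2[of "ch t'"]
        unfolding power_mult_distrib power2_eq_square[of 2] by linarith
    qed (use that in auto)
    have a1: "ch a \<le> 2 * ch a'" "ch a' \<le> 2 * ch a"
      using chle[of a b a' b'] chle[of a' b' a b] k k' E by auto
    have b1: "ch s \<le> 2 * M * ch s'" if "ch t * ch s \<le> M * (ch t' * ch s')" "ch t' \<le> 2 * ch t" "1 \<le> ch t" "1 \<le> ch s'" for s t s' t'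
    proof -
      have "M * ch t' * ch s' \<le> M * (2 * ch t) * ch s'"
        using that assms by (intro mult_right_mono mult_left_mono) auto
      then have "ch t * ch s \<le> ch t * (2 * M * ch s')"
        using that(1) by (simp add: algebra_simps)
      then show ?thesis
        using that(3) by simp
    qed
    have b2: "ch b \<le> 2 * M * ch b'" "ch b' \<le> 2 * M * ch b"
      using b1[of a b a' b'] b1[of a' b' a b] a1 D k k' by auto
    have ratio: "t / t' \<in> I" if "t \<ge> 1" "t' \<ge> 1" "ch t \<le> 2 * M * ch t'" "ch t' \<le> 2 * M * ch t" for t t'
    proof -
      have "ch x \<le> x" "x \<le> 2 * ch x" if "x \<ge> 1" for x
        using that mult_mono[OF that that] by (auto simp: ch_def field_simps)
      then have "t \<le> 2 * (2 * M * t')" "t' \<le> 2 * (2 * M * t)"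
        using that assms by (smt (verit) mult_left_mono)+
      then show ?thesis
        using that assms by (simp add: I_def field_simps)
    qed
    have aI: "a / a' \<in> I"
    proof (rule ratio)
      have "2 * ch a' \<le> 2 * M * ch a'" "2 * ch a \<le> 2 * M * ch a"
        using k k' assms by (auto intro!: mult_right_mono)
      then show "ch a \<le> 2 * M * ch a'" "ch a' \<le> 2 * M * ch a"
        using a1 by auto
    qed (use k k' in auto)
    have bI: "b / b' \<in> I"
      using k k' b2 by (intro ratio) auto
    have 1: "1 \<in> I" using assms by (simp add: I_def)
    define c c' where c: "c = k ** torus (a / a') (b / b') ** adj k'" "c' = adj l' ** torus 1 1 ** l"
    have "c \<in> C" "c' \<in> C"
      unfolding C_def c using k(1,2) k'(1,2) aI bI 1
      by (intro image_eqI[of _ _ "(k, a / a', b / b', adj k')"] image_eqI[of _ _ "(adj l', 1, 1, l)"];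
          simp add: adj_maxcompact)+
    moreover have "c ** h ** c' = k ** (torus (a / a') (b / b') ** (adj k' ** k') ** torus a' b') ** (l' ** adj l') ** l"
      by (simp add: c k'(5) torus_1 matrix_mul_assoc)
    then have "c ** h ** c' = g"
      using k k' by (simp add: adj_inverse[of k'] adj_inverse[of l'] maxcompact_def torus_mult)
    ultimately show ?thesis by blast
  qed
  ultimately show ?thesis by blast
qed

subsection \<open>Filling the Weyl chamber\<close>

text \<open>Brouwer's theorem for the map that subtracts (f1, f2) and clamps to the square. At a
  fixed point either nothing was clamped, and the functions vanish, or the sign condition on that
  edge makes them vanish.\<close>

lemma poincare_miranda:
  fixes f1 f2 :: "real \<times> real \<Rightarrow> real"
  assumes c1: "continuous_on ({0..1} \<times> {0..1}) f1" and c2: "continuous_on ({0..1} \<times> {0..1}) f2"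
    and left: "\<And>y. y \<in> {0..1} \<Longrightarrow> f1 (0, y) \<le> 0" and right: "\<And>y. y \<in> {0..1} \<Longrightarrow> f1 (1, y) \<ge> 0"
    and bot: "\<And>x. x \<in> {0..1} \<Longrightarrow> f2 (x, 0) \<le> 0" and top: "\<And>x. x \<in> {0..1} \<Longrightarrow> f2 (x, 1) \<ge> 0"
  shows "\<exists>x\<in>{0..1}. \<exists>y\<in>{0..1}. f1 (x, y) = 0 \<and> f2 (x, y) = 0"
proof -
  define S where "S = {0..1::real} \<times> {0..1::real}"
  define cl where "cl z = max 0 (min 1 z)" for z :: real
  define g where "g q = (cl (fst q - f1 q), cl (snd q - f2 q))" for q
  have "compact S" "convex S" "S \<noteq> {}"
    by (auto simp: S_def compact_Times convex_Times)
  moreover have "continuous_on S g"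
    unfolding g_def cl_def using c1 c2 by (intro continuous_intros) (auto simp: S_def)
  moreover have "g \<in> S \<rightarrow> S"
    by (auto simp: g_def S_def cl_def)
  ultimately obtain q where q: "q \<in> S" "g q = q"
    by (rule brouwer)
  obtain x y where xy: "q = (x, y)" by (cases q)
  have xS: "x \<in> {0..1}" "y \<in> {0..1}" using q(1) by (auto simp: S_def xy)
  have fix1: "cl (x - f1 (x, y)) = x" "cl (y - f2 (x, y)) = y"
    using q(2) by (auto simp: g_def xy)
  have "f1 (x, y) = 0"
    using fix1(1) xS left[of y] right[of y] by (auto simp: cl_def max_def min_def split: if_splits)
  moreover have "f2 (x, y) = 0"
    using fix1(2) xS bot[of x] top[of x] by (auto simp: cl_def max_def min_def split: if_splits)
  ultimately show ?thesis using xS by blast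
qed

section \<open>The chamber invariants as polynomials on the Lie algebra\<close>

lemma mult_frame:
  "(g *v n1) $ i = g $ i $ First - g $ i $ Last" "(g *v n2) $ i = g $ i $ Second - g $ i $ Penult"
proof -
  show "(g *v n1) $ i = g $ i $ First - g $ i $ Last"
    by (simp add: matrix_vector_mult_def sum_idx frame_nth)
  show "(g *v n2) $ i = g $ i $ Second - g $ i $ Penult"
    by (simp add: matrix_vector_mult_def sum_idx frame_nth)
qed

definition nF :: "'k::finite nvec \<Rightarrow> real" where "nF v = edet (nexp v)"
definition nE :: "'k::finite nvec \<Rightarrow> real" where "nE v = esq (nexp v)"

lemma nF_eq:
  "nF (\<phi>, x, y, \<eta>) = ((2 + \<phi> * \<eta> + (x \<bullet> x) / 2 - \<phi>\<^sup>2 * (y \<bullet> y) / 24) * (2 + (y \<bullet> y) / 2)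
     + (\<phi> - \<eta> + \<phi> * (y \<bullet> y) / 6)\<^sup>2 - (x \<bullet> y)\<^sup>2 / 4) / 4"
  by (simp add: nF_def edet_def inner_frame mult_frame nexp_nth power2_eq_square) (simp add: field_simps)

lemma nE_eq:
  "nE (\<phi>, x, y, \<eta>) = ((2 + \<phi> * \<eta> + (x \<bullet> x) / 2 - \<phi>\<^sup>2 * (y \<bullet> y) / 24)\<^sup>2 + (2 + (y \<bullet> y) / 2)\<^sup>2
     + 2 * (\<phi> - \<eta> + \<phi> * (y \<bullet> y) / 6)\<^sup>2 + (x \<bullet> y)\<^sup>2 / 2) / 4"
  by (simp add: nE_def esq_def inner_frame mult_frame nexp_nth power2_eq_square) (simp add: field_simps)

lemma nE_0: "nE 0 = 2"
  by (simp add: nE_eq zero_prod_def)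

lemma continuous_on_nF: "continuous_on S nF"
proof -
  have eq: "nF = (\<lambda>(\<phi>, x, y, \<eta>). ((2 + \<phi> * \<eta> + (x \<bullet> x) / 2 - \<phi>\<^sup>2 * (y \<bullet> y) / 24) * (2 + (y \<bullet> y) / 2)
     + (\<phi> - \<eta> + \<phi> * (y \<bullet> y) / 6)\<^sup>2 - (x \<bullet> y)\<^sup>2 / 4) / 4)"
    by (auto simp: fun_eq_iff nF_eq)
  show ?thesis
    unfolding eq case_prod_beta by (intro continuous_intros) auto
qed

lemma continuous_on_nE: "continuous_on S nE"
proof -
  have eq: "nE = (\<lambda>(\<phi>, x, y, \<eta>). ((2 + \<phi> * \<eta> + (x \<bullet> x) / 2 - \<phi>\<^sup>2 * (y \<bullet> y) / 24)\<^sup>2 + (2 + (y \<bullet> y) / 2)\<^sup>2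
     + 2 * (\<phi> - \<eta> + \<phi> * (y \<bullet> y) / 6)\<^sup>2 + (x \<bullet> y)\<^sup>2 / 2) / 4)"
    by (auto simp: fun_eq_iff nE_eq)
  show ?thesis
    unfolding eq case_prod_beta by (intro continuous_intros) auto
qed

text \<open>The entry \<open>A\<close> is indefinite in \<open>\<phi>\<close> and
  \<open>\<eta>\<close>, but \<open>nE\<close> also bounds \<open>m\<close>. After
  \<open>\<eta>\<close> is eliminated in favour of \<open>m\<close>, the entry becomes 2 plus
  nonnegative terms minus half the square of \<open>m\<close>, which bounds \<open>\<phi>\<close>
  and \<open>x\<close>; the definition of \<open>m\<close> then bounds
  \<open>\<eta>\<close>.\<close>

lemma nE_proper:
  assumes R: "R \<ge> 1" and less: "nE v < R"
  shows "(norm v)\<^sup>2 \<le> 14 * R + 12 * R * (1 + R)\<^sup>2"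
proof -
  obtain \<phi> x y \<eta> where v: "v = (\<phi>, x, y, \<eta>)" by (cases v)
  define X Y m A where "X = x \<bullet> x" and "Y = y \<bullet> y" and "m = \<phi> - \<eta> + \<phi> * Y / 6"
    and "A = 2 + \<phi> * \<eta> + X / 2 - \<phi>\<^sup>2 * Y / 24"
  have XY: "X \<ge> 0" "Y \<ge> 0" by (simp_all add: X_def Y_def)
  have sum: "A\<^sup>2 + (2 + Y / 2)\<^sup>2 + 2 * m\<^sup>2 + (x \<bullet> y)\<^sup>2 / 2 < 4 * R"
    using less by (simp add: v nE_eq X_def Y_def m_def A_def)
  note pos = zero_le_power2[of A] zero_le_power2[of "2 + Y / 2"] zero_le_power2[of m] zero_le_power2[of "x \<bullet> y"]
  have R2: "4 * R \<le> (2 * R)\<^sup>2"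
    using R by (simp add: power2_eq_square)
  have gen: "a \<le> 4 * R \<and> b \<le> 4 * R \<and> c \<le> 2 * R"
    if "a + b + 2 * c + d / 2 < 4 * R" "0 \<le> a" "0 \<le> b" "0 \<le> c" "0 \<le> d" for a b c d :: real
    using that by (intro conjI; linarith)
  note g = gen[OF sum pos]
  have m: "m\<^sup>2 \<le> 2 * R"
    by (rule g[THEN conjunct2, THEN conjunct2])
  have A2: "A\<^sup>2 \<le> 4 * R"
    by (rule g[THEN conjunct1])
  have Y2: "(2 + Y / 2)\<^sup>2 \<le> 4 * R"
    by (rule g[THEN conjunct2, THEN conjunct1])
  have "A\<^sup>2 \<le> (2 * R)\<^sup>2" by (rule order_trans[OF A2 R2])
  then have A: "A \<le> 2 * R" by (rule power2_le_imp_le) (use R in simp)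
  have "(2 + Y / 2)\<^sup>2 \<le> (2 * R)\<^sup>2" by (rule order_trans[OF Y2 R2])
  then have "2 + Y / 2 \<le> 2 * R" by (rule power2_le_imp_le) (use R in simp)
  then have Y: "Y \<le> 4 * R" by simp
  have \<eta>: "\<eta> = \<phi> * (1 + Y / 6) - m" by (simp add: m_def algebra_simps)
  have "A = 2 + \<phi>\<^sup>2 / 2 + \<phi>\<^sup>2 * Y / 8 + (\<phi> - m)\<^sup>2 / 2 - m\<^sup>2 / 2 + X / 2"
    unfolding A_def \<eta> by (simp add: power2_eq_square field_simps)
  moreover have "\<phi>\<^sup>2 * Y / 8 \<ge> 0" using XY by simp
  ultimately have \<phi>X: "\<phi>\<^sup>2 + X \<le> 6 * R"
    using A m zero_le_power2[of "\<phi> - m"] by linarith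
  have "\<eta>\<^sup>2 \<le> 2 * (\<phi> * (1 + Y / 6))\<^sup>2 + 2 * m\<^sup>2"
    using zero_le_power2[of "\<phi> * (1 + Y / 6) + m"] unfolding \<eta> by (simp add: power2_diff power2_sum)
  also have "(\<phi> * (1 + Y / 6))\<^sup>2 \<le> (6 * R) * (1 + R)\<^sup>2"
    unfolding power_mult_distrib using \<phi>X XY Y R by (intro mult_mono power_mono) auto
  finally have "\<eta>\<^sup>2 \<le> 12 * R * (1 + R)\<^sup>2 + 4 * R" using m by simp
  moreover have "(norm v)\<^sup>2 = \<phi>\<^sup>2 + X + Y + \<eta>\<^sup>2"
    by (simp add: v norm_prod_def X_def Y_def power2_norm_eq_inner)
  ultimately show ?thesis using \<phi>X Y by simp
qed

text \<open>By \<open>KAK\<close>, \<open>nE\<close> is \<open>(ch a)\<^sup>2\<close> up to a factor of two and \<open>\<bar>nF\<bar> = ch a * ch b\<close>. So the two conditions below say that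
  \<open>ch b\<close> is bounded (the wall \<open>b = 1\<close>) and that \<open>ch a / ch b\<close> is bounded (the wall \<open>a = b\<close>), respectively.\<close>

definition wall1 :: "(real \<Rightarrow> 'k::finite nvec) \<Rightarrow> bool" where
  "wall1 \<gamma> \<longleftrightarrow> (\<exists>M. \<forall>\<^sub>F t in at_top. (nF (\<gamma> t))\<^sup>2 \<le> M * nE (\<gamma> t))"

definition wall2 :: "(real \<Rightarrow> 'k::finite nvec) \<Rightarrow> bool" where
  "wall2 \<gamma> \<longleftrightarrow> (\<exists>M. \<forall>\<^sub>F t in at_top. nE (\<gamma> t) \<le> M * \<bar>nF (\<gamma> t)\<bar>)"

lemma bound_on_ray:
  fixes f g :: "real \<Rightarrow> real"
  assumes ev: "\<forall>\<^sub>F t in at_top. f t \<le> M * g t" and g: "\<And>t. t \<ge> 0 \<Longrightarrow> g t \<ge> 1" and f: "continuous_on {0..} f"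
  shows "\<exists>M\<ge>1. \<forall>t\<ge>0. f t \<le> M * g t"
proof -
  obtain T where T: "\<And>t. t \<ge> T \<Longrightarrow> f t \<le> M * g t"
    using ev by (auto simp: eventually_at_top_linorder)
  have "compact (f ` {0..\<bar>T\<bar>})"
    by (intro compact_continuous_image continuous_on_subset[OF f]) auto
  then obtain B where "\<forall>z\<in>f ` {0..\<bar>T\<bar>}. \<bar>z\<bar> \<le> B"
    using compact_imp_bounded[of "f ` {0..\<bar>T\<bar>}"] unfolding bounded_real by blast
  then have B: "\<bar>f t\<bar> \<le> B" if "t \<in> {0..\<bar>T\<bar>}" for t
    using that by blast
  define N where "N = max 1 (max M B)"
  have "f t \<le> N * g t" if t: "t \<ge> 0" for t
  proof (cases "t \<le> \<bar>T\<bar>")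
    case True
    have "f t \<le> B * 1" using B[of t] t True by auto
    also have "\<dots> \<le> N * g t"
      using g[OF t] unfolding N_def by (intro mult_mono) auto
    finally show ?thesis .
  next
    case False
    then have "f t \<le> M * g t" by (intro T) auto
    also have "\<dots> \<le> N * g t"
      using g[OF t] unfolding N_def by (intro mult_right_mono) auto
    finally show ?thesis .
  qed
  moreover have "N \<ge> 1" by (simp add: N_def)
  ultimately show ?thesis by blast
qed

section \<open>Covering the chamber by a two-parameter family\<close>

context unipotent_subgroup
begin

lemma nexp_lie_SO2n: "v \<in> lie \<Longrightarrow> nexp v \<in> carrier SO2n"
  using lie_logs[of v] subgroup.subset[OF subgroup_H] by (simp add: logs_def subset_iff)

text \<open>The two inequalities between \<open>esq\<close> and \<open>edet\<close> describe the
  chamber: equality in \<open>2 * \<bar>edet g\<bar> \<le> esq g\<close> is the wall a = b, equality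
  in the other one is the wall b = 1. They come from (ch a - ch b)^2 and from the product of (ch
  a)^2 - 1 and (ch b)^2 - 1 being nonnegative.\<close>

lemma SO2n_invariants:
  assumes "g \<in> carrier SO2n"
  shows "1 \<le> \<bar>edet g\<bar>" "2 * \<bar>edet g\<bar> \<le> esq g" "esq g \<le> (edet g)\<^sup>2 + 1" "2 \<le> esq g"
proof -
  obtain a b where a: "1 \<le> ch b" "ch b \<le> ch a" "(ch a)\<^sup>2 + (ch b)\<^sup>2 = esq g" "ch a * ch b = \<bar>edet g\<bar>"
    using KAK[OF assms] by blast
  show 1: "1 \<le> \<bar>edet g\<bar>"
    using mult_mono[of 1 "ch a" 1 "ch b"] a by auto
  show 2: "2 * \<bar>edet g\<bar> \<le> esq g"
    using zero_le_power2[of "ch a - ch b"] unfolding a(3,4)[symmetric] by (simp add: power2_diff)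
  show "2 \<le> esq g" using 1 2 by simp
  have "1 \<le> (ch a)\<^sup>2" "1 \<le> (ch b)\<^sup>2"
    using a(1,2) by (simp_all add: one_le_power)
  then have "0 \<le> ((ch a)\<^sup>2 - 1) * ((ch b)\<^sup>2 - 1)" by simp
  then have "esq g \<le> (ch a * ch b)\<^sup>2 + 1"
    unfolding a(3)[symmetric] by (simp add: power_mult_distrib algebra_simps)
  then show "esq g \<le> (edet g)\<^sup>2 + 1"
    unfolding a(4) by simp
qed

lemma lie_invariants:
  assumes "v \<in> lie"
  shows "1 \<le> \<bar>nF v\<bar>" "2 \<le> nE v" "1 \<le> nE v"
  using SO2n_invariants[OF nexp_lie_SO2n[OF assms]] by (auto simp: nF_def nE_def)

lemma cartan_decompositionI:
  assumes M: "M \<ge> 1"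
    and ex: "\<And>g :: real^('k idx)^('k idx). g \<in> carrier SO2n \<Longrightarrow> \<exists>v\<in>lie. nE v = esq g \<and> \<bar>nF v\<bar> \<le> M * \<bar>edet g\<bar> \<and> \<bar>edet g\<bar> \<le> M * \<bar>nF v\<bar>"
  shows "cartan_decomposition_subgroup SO2n H"
proof -
  obtain C :: "(real^('k idx)^('k idx)) set" where C: "compact C" "C \<subseteq> carrier SO2n"
    and close: "\<And>g h. g \<in> carrier SO2n \<Longrightarrow> h \<in> carrier SO2n \<Longrightarrow> esq g = esq h \<and> \<bar>edet g\<bar> \<le> M * \<bar>edet h\<bar> \<and> \<bar>edet h\<bar> \<le> M * \<bar>edet g\<bar> \<Longrightarrow>
      \<exists>c\<in>C. \<exists>c'\<in>C. g = c ** h ** c'"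
    using KAK_close[OF M, where ?'k = 'k] by blast
  have HG: "H \<subseteq> carrier SO2n" using subgroup.subset[OF subgroup_H] .
  have "C <#>\<^bsub>SO2n\<^esub> H <#>\<^bsub>SO2n\<^esub> C = carrier SO2n"
  proof (intro equalityI subsetI)
    fix g assume "g \<in> C <#>\<^bsub>SO2n\<^esub> H <#>\<^bsub>SO2n\<^esub> C"
    then obtain c h c' where g: "c \<in> C" "h \<in> H" "c' \<in> C" "g = c ** h ** c'"
      by (auto simp: set_mult_def)
    show "g \<in> carrier SO2n"
      unfolding g(4) using g(1-3) C(2) HG by (intro SO2n_mult) auto
  next
    fix g :: "real^('k idx)^('k idx)" assume g: "g \<in> carrier SO2n"
    obtain v where v: "v \<in> lie" "nE v = esq g" "\<bar>nF v\<bar> \<le> M * \<bar>edet g\<bar>" "\<bar>edet g\<bar> \<le> M * \<bar>nF v\<bar>"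
      using ex[OF g] by blast
    have "\<exists>c\<in>C. \<exists>c'\<in>C. g = c ** nexp v ** c'"
      using v by (intro close g nexp_lie_SO2n) (auto simp: nE_def nF_def)
    moreover have "nexp v \<in> H"
      using lie_logs[OF v(1)] by (simp add: logs_def)
    ultimately show "g \<in> C <#>\<^bsub>SO2n\<^esub> H <#>\<^bsub>SO2n\<^esub> C"
      unfolding set_mult_def by auto
  qed
  moreover have "closedin (top_of_set (carrier SO2n)) H"
    using closed_H HG by (rule closed_subset[rotated])
  ultimately show ?thesis
    unfolding cartan_decomposition_subgroup_def using subgroup_H connected_H C by blast
qed

text \<open>The curves \<open>\<gamma>\<close> and \<open>\<delta>\<close> run close to the two walls of the Weyl chamber. In the logarithmic coordinates \<open>ln nE\<close>,
  \<open>ln nF\<close> the interpolation between them has to cross, up to a bounded error, every ray of the chamber at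
  every height.\<close>

lemma filling:
  assumes \<gamma>: "continuous_on UNIV \<gamma>" "\<And>t. \<gamma> t \<in> lie" "\<gamma> 0 = 0" "wall1 \<gamma>"
    and \<delta>: "continuous_on UNIV \<delta>" "\<And>t. \<delta> t \<in> lie" "\<delta> 0 = 0" "wall2 \<delta>"
    and proper: "\<And>R. \<exists>t\<ge>0. \<forall>s\<in>{0..1}. norm ((1 - s) *\<^sub>R \<gamma> t + s *\<^sub>R \<delta> t) \<ge> R"
  shows "cartan_decomposition_subgroup SO2n H"
proof -
  have cE: "continuous_on {0..} (\<lambda>t. nE (\<delta> t))" and cF: "continuous_on {0..} (\<lambda>t. (nF (\<gamma> t))\<^sup>2)"
    by (intro continuous_intros continuous_on_compose2[OF continuous_on_nE[of UNIV]]
          continuous_on_compose2[OF continuous_on_nF[of UNIV]] continuous_on_subset[OF \<gamma>(1)] continuous_on_subset[OF \<delta>(1)]; simp)+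
  obtain N1 where N1: "\<forall>\<^sub>F t in at_top. (nF (\<gamma> t))\<^sup>2 \<le> N1 * nE (\<gamma> t)"
    using \<gamma>(4) unfolding wall1_def by blast
  obtain M1 where M1: "M1 \<ge> 1" "\<And>t. t \<ge> 0 \<Longrightarrow> (nF (\<gamma> t))\<^sup>2 \<le> M1 * nE (\<gamma> t)"
    using bound_on_ray[of _ N1 "\<lambda>t. nE (\<gamma> t)", OF N1 _ cF] lie_invariants(3)[OF \<gamma>(2)] by blast
  obtain N2 where N2: "\<forall>\<^sub>F t in at_top. nE (\<delta> t) \<le> N2 * \<bar>nF (\<delta> t)\<bar>"
    using \<delta>(4) unfolding wall2_def by blast
  obtain M2 where M2: "M2 \<ge> 1" "\<And>t. t \<ge> 0 \<Longrightarrow> nE (\<delta> t) \<le> M2 * \<bar>nF (\<delta> t)\<bar>"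
    using bound_on_ray[of _ N2 "\<lambda>t. \<bar>nF (\<delta> t)\<bar>", OF N2 _ cE] lie_invariants(1)[OF \<delta>(2)] by blast
  define M where "M = max M1 M2"
  have M: "M \<ge> 1" using M1 by (simp add: M_def)
  have w1: "(nF (\<gamma> t))\<^sup>2 \<le> M * nE (\<gamma> t)" if "t \<ge> 0" for t
    by (rule order_trans[OF M1(2)[OF that] mult_right_mono])
       (use lie_invariants(2)[OF \<gamma>(2), of t] in \<open>auto simp: M_def\<close>)
  have w2: "nE (\<delta> t) \<le> M * \<bar>nF (\<delta> t)\<bar>" if "t \<ge> 0" for t
    by (rule order_trans[OF M2(2)[OF that] mult_right_mono]) (auto simp: M_def)
  define c where "c = ln (2 * M)"
  have c: "c \<ge> 0" using M by (simp add: c_def)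
  show ?thesis
  proof (rule cartan_decompositionI)
    show "2 * M \<ge> 1" using M by simp
    fix g :: "real^('k idx)^('k idx)" assume g: "g \<in> carrier SO2n"
    note gi = SO2n_invariants[OF g]
    \<comment> \<open>Halving \<open>esq\<close> puts the identity, where it equals 2, at the origin
      of the logarithmic coordinates.\<close>
    define e0 f0 where "e0 = ln (esq g / 2)" and "f0 = ln \<bar>edet g\<bar>"
    have f0: "0 \<le> f0" "f0 \<le> e0" "e0 \<le> 2 * f0"
    proof -
      show "0 \<le> f0" using gi by (simp add: f0_def)
      show "f0 \<le> e0" unfolding e0_def f0_def using gi by (intro ln_mono) auto
      have "esq g / 2 \<le> (edet g)\<^sup>2"
        using gi(3) one_le_power[OF gi(1), of 2] by simp
      then have "e0 \<le> ln (\<bar>edet g\<bar>\<^sup>2)"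
        unfolding e0_def using gi by (intro ln_mono) auto
      also have "\<dots> = 2 * f0"
        using gi(1) unfolding f0_def by (subst ln_realpow) auto
      finally show "e0 \<le> 2 * f0" .
    qed
    \<comment> \<open>The slope of the ray through the target. In these coordinates the chamber has
      slopes from 1/2 to 1, attained up to bounded error along \<open>\<gamma>\<close> and
      \<open>\<delta>\<close>. If \<open>e0\<close> is 0, so is \<open>f0\<close>, and any slope in
      this range would do.\<close>
    define \<kappa> where "\<kappa> = (if e0 = 0 then 1 else f0 / e0)"
    have \<kappa>: "f0 = \<kappa> * e0" "1 / 2 \<le> \<kappa>" "\<kappa> \<le> 1"
      using f0 by (auto simp: \<kappa>_def field_simps)
    define R where "R = max 1 (esq g)"
    have R: "R \<ge> 1" "R \<ge> esq g" by (auto simp: R_def)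
    \<comment> \<open>The bound of \<open>nE_proper\<close>: where the squared norm exceeds
      \<open>B\<close>, the value of \<open>nE\<close> is at least \<open>R\<close> and hence at
      least \<open>esq g\<close>.\<close>
    define B where "B = 14 * R + 12 * R * (1 + R)\<^sup>2"
    obtain T where T: "T \<ge> 0" "\<And>s. s \<in> {0..1} \<Longrightarrow> norm ((1 - s) *\<^sub>R \<gamma> T + s *\<^sub>R \<delta> T) \<ge> sqrt (B + 1)"
      using proper by blast
    define \<Phi> where "\<Phi> q = (1 - fst q) *\<^sub>R \<gamma> (snd q * T) + fst q *\<^sub>R \<delta> (snd q * T)" for q :: "real \<times> real"
    have \<Phi>lie: "\<Phi> q \<in> lie" for q
      unfolding \<Phi>_def by (intro subspace_add[OF subspace_lie] lie_scaleR \<gamma> \<delta>)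
    have \<Phi>c: "continuous_on S \<Phi>" for S
      unfolding \<Phi>_def
      by (intro continuous_intros continuous_on_compose2[OF \<gamma>(1)] continuous_on_compose2[OF \<delta>(1)]) auto
    define L where "L q = ln (nE (\<Phi> q) / 2)" for q
    have nEp: "nE (\<Phi> q) > 0" and nF0: "nF (\<Phi> q) \<noteq> 0" and L0: "L q \<ge> 0" for q
      using lie_invariants[OF \<Phi>lie, of q] by (auto simp: L_def)
    \<comment> \<open>The last term of \<open>f1\<close> goes from - c on the edge of
      \<open>\<gamma>\<close> to + c on the edge of \<open>\<delta>\<close>. It absorbs the error of
      the two wall estimates, so that the signs required on the edges are exact, and costs at most
      the factor 2 M in the end.\<close>
    define f1 f2 where "f1 q = ln \<bar>nF (\<Phi> q)\<bar> - \<kappa> * L q - (1 - 2 * fst q) * c" and "f2 q = nE (\<Phi> q) - esq g" for q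
    have cont: "continuous_on S (\<lambda>q. nE (\<Phi> q))" "continuous_on S (\<lambda>q. nF (\<Phi> q))" for S
      by (intro continuous_on_compose2[OF continuous_on_nE[of UNIV]] continuous_on_compose2[OF continuous_on_nF[of UNIV]] \<Phi>c; simp)+
    have "\<exists>s\<in>{0..1}. \<exists>y\<in>{0..1}. f1 (s, y) = 0 \<and> f2 (s, y) = 0"
    proof (rule poincare_miranda)
      show "continuous_on ({0..1} \<times> {0..1}) f1"
        unfolding f1_def L_def using nF0 nEp
        by (intro continuous_intros cont) (auto simp: less_imp_neq[THEN not_sym])
      show "continuous_on ({0..1} \<times> {0..1}) f2"
        unfolding f2_def by (intro continuous_intros cont)
      fix y :: real assume y: "y \<in> {0..1}"
      have yT: "y * T \<ge> 0" using y T by simp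
      show "f1 (0, y) \<le> 0"
      proof -
        have "\<bar>nF (\<Phi> (0, y))\<bar>\<^sup>2 \<le> 2 * M * (nE (\<Phi> (0, y)) / 2)"
          using w1[OF yT] by (simp add: \<Phi>_def)
        then have "ln (\<bar>nF (\<Phi> (0, y))\<bar>\<^sup>2) \<le> ln (2 * M * (nE (\<Phi> (0, y)) / 2))"
          using nF0 by (intro ln_mono) auto
        moreover have "ln (\<bar>nF (\<Phi> (0, y))\<bar>\<^sup>2) = 2 * ln \<bar>nF (\<Phi> (0, y))\<bar>"
          using nF0 by (subst ln_realpow) auto
        moreover have "ln (2 * M * (nE (\<Phi> (0, y)) / 2)) = c + L (0, y)"
          using M nEp[of "(0, y)"] unfolding c_def L_def by (subst ln_mult) auto
        ultimately have "2 * ln \<bar>nF (\<Phi> (0, y))\<bar> \<le> c + L (0, y)" by simp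
        moreover have "(1/2) * L (0, y) \<le> \<kappa> * L (0, y)"
          by (intro mult_right_mono \<kappa> L0)
        ultimately show ?thesis using c by (simp add: f1_def)
      qed
      show "f1 (1, y) \<ge> 0"
      proof -
        have "nE (\<Phi> (1, y)) / 2 \<le> 2 * M * \<bar>nF (\<Phi> (1, y))\<bar>"
        proof -
          have "M * \<bar>nF (\<Phi> (1, y))\<bar> \<ge> 0" using M by simp
          then show ?thesis using w2[OF yT] nEp[of "(1, y)"] by (simp add: \<Phi>_def)
        qed
        then have "L (1, y) \<le> ln (2 * M * \<bar>nF (\<Phi> (1, y))\<bar>)"
          unfolding L_def using nEp by (intro ln_mono) auto
        also have "\<dots> = c + ln \<bar>nF (\<Phi> (1, y))\<bar>"
          using M nF0 unfolding c_def by (subst ln_mult) auto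
        finally have "L (1, y) \<le> c + ln \<bar>nF (\<Phi> (1, y))\<bar>" .
        moreover have "\<kappa> * L (1, y) \<le> 1 * L (1, y)"
          by (intro mult_right_mono \<kappa> L0)
        ultimately show ?thesis by (simp add: f1_def)
      qed
    next
      fix s :: real assume s: "s \<in> {0..1}"
      show "f2 (s, 0) \<le> 0"
        using gi by (simp add: f2_def \<Phi>_def \<gamma>(3) \<delta>(3) nE_0)
      show "f2 (s, 1) \<ge> 0"
      proof (rule ccontr)
        assume "\<not> ?thesis"
        then have "nE (\<Phi> (s, 1)) < R" using R by (simp add: f2_def)
        from nE_proper[OF R(1) this] have "(norm (\<Phi> (s, 1)))\<^sup>2 \<le> B" by (simp add: B_def)
        moreover have "B \<ge> 0" using R by (simp add: B_def)
        then have "(sqrt (B + 1))\<^sup>2 \<le> (norm (\<Phi> (s, 1)))\<^sup>2"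
          using T(2)[OF s] by (intro power_mono) (auto simp: \<Phi>_def)
        ultimately show False using \<open>B \<ge> 0\<close> by simp
      qed
    qed
    then obtain s y where sy: "s \<in> {0..1}" "f1 (s, y) = 0" "f2 (s, y) = 0" by blast
    have E: "nE (\<Phi> (s, y)) = esq g" using sy by (simp add: f2_def)
    then have "L (s, y) = e0" by (simp add: L_def e0_def)
    then have "ln \<bar>nF (\<Phi> (s, y))\<bar> = f0 + (1 - 2 * s) * c"
      using sy(2) by (simp add: f1_def \<kappa>(1))
    moreover have "0 \<le> s * c" "0 \<le> (1 - s) * c"
      using sy(1) c by simp_all
    then have "(1 - 2 * s) * c \<le> c" "- c \<le> (1 - 2 * s) * c"
      by (simp_all add: algebra_simps)
    ultimately have "ln \<bar>nF (\<Phi> (s, y))\<bar> \<le> c + ln \<bar>edet g\<bar>" "ln \<bar>edet g\<bar> \<le> c + ln \<bar>nF (\<Phi> (s, y))\<bar>"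
      by (simp_all add: f0_def)
    moreover have "c + ln \<bar>edet g\<bar> = ln (2 * M * \<bar>edet g\<bar>)" "c + ln \<bar>nF (\<Phi> (s, y))\<bar> = ln (2 * M * \<bar>nF (\<Phi> (s, y))\<bar>)"
      using M gi nF0[of "(s, y)"] unfolding c_def by (subst ln_mult; auto)+
    ultimately have "ln \<bar>nF (\<Phi> (s, y))\<bar> \<le> ln (2 * M * \<bar>edet g\<bar>)" "ln \<bar>edet g\<bar> \<le> ln (2 * M * \<bar>nF (\<Phi> (s, y))\<bar>)"
      by simp_all
    then have "\<bar>nF (\<Phi> (s, y))\<bar> \<le> 2 * M * \<bar>edet g\<bar>" "\<bar>edet g\<bar> \<le> 2 * M * \<bar>nF (\<Phi> (s, y))\<bar>"
      using M gi nF0[of "(s, y)"] by (subst (asm) ln_le_cancel_iff; auto)+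
    with E \<Phi>lie show "\<exists>v\<in>lie. nE v = esq g \<and> \<bar>nF v\<bar> \<le> 2 * M * \<bar>edet g\<bar> \<and> \<bar>edet g\<bar> \<le> 2 * M * \<bar>nF v\<bar>"
      by blast
  qed
qed

end

subsection \<open>Curves along the walls\<close>

lemma tendsto_at_inverse:
  fixes p :: "real \<Rightarrow> real"
  assumes "isCont p 0"
  shows "((\<lambda>t. p (1 / t)) \<longlongrightarrow> p 0) at_top"
proof (rule isCont_tendsto_compose[OF assms])
  show "((\<lambda>t :: real. 1 / t) \<longlongrightarrow> 0) at_top"
    using tendsto_inverse_0_at_top[OF filterlim_ident[of "at_top :: real filter"]] by (simp add: inverse_eq_divide)
qed

text \<open>A polynomial of degree at most k is written as t^k times a function of 1/t, so that its
  leading coefficient is the value at 0 and growth rates follow from continuity there. For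
  \<open>nE\<close> a lower bound by the square of one block entry suffices.\<close>

lemma wall1I:
  assumes p: "isCont p 0" and q: "isCont q 0" "q 0 \<noteq> 0"
    and F: "\<And>t. t > 0 \<Longrightarrow> nF (\<gamma> t) = t ^ k * p (1 / t)"
    and E: "\<And>t. t > 0 \<Longrightarrow> (t ^ k * q (1 / t))\<^sup>2 \<le> 4 * nE (\<gamma> t)"
  shows "wall1 \<gamma>"
proof -
  define K where "K = (p 0)\<^sup>2 / (q 0)\<^sup>2 + 1"
  have "((\<lambda>t. (p (1 / t))\<^sup>2 / (q (1 / t))\<^sup>2) \<longlongrightarrow> (p 0)\<^sup>2 / (q 0)\<^sup>2) at_top"
    using q(2) by (intro tendsto_intros tendsto_at_inverse p q) auto
  then have "\<forall>\<^sub>F t in at_top. (p (1 / t))\<^sup>2 / (q (1 / t))\<^sup>2 < K"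
    by (rule order_tendstoD) (simp add: K_def)
  moreover have "\<forall>\<^sub>F t in at_top. q (1 / t) \<noteq> 0"
    by (rule tendsto_imp_eventually_ne[OF tendsto_at_inverse[OF q(1)] q(2)])
  ultimately have "\<forall>\<^sub>F t in at_top. (nF (\<gamma> t))\<^sup>2 \<le> (K * 4) * nE (\<gamma> t)"
    using eventually_gt_at_top[of 0]
  proof eventually_elim
    case (elim t)
    have "(p (1 / t))\<^sup>2 \<le> K * (q (1 / t))\<^sup>2"
      using elim(1,2) by (simp add: field_simps)
    then have "(t ^ k)\<^sup>2 * (p (1 / t))\<^sup>2 \<le> (t ^ k)\<^sup>2 * (K * (q (1 / t))\<^sup>2)"
      by (rule mult_left_mono) simp
    then have "(nF (\<gamma> t))\<^sup>2 \<le> K * (t ^ k * q (1 / t))\<^sup>2"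
      unfolding F[OF elim(3)] power_mult_distrib by (simp only: ac_simps)
    also have "\<dots> \<le> K * (4 * nE (\<gamma> t))"
      using E[OF elim(3)] by (intro mult_left_mono) (auto simp: K_def)
    finally show ?case by simp
  qed
  then show ?thesis unfolding wall1_def by blast
qed

lemma wall2I:
  assumes p: "isCont p 0" "p 0 \<noteq> 0" and q: "isCont q 0"
    and F: "\<And>t. t > 0 \<Longrightarrow> nF (\<gamma> t) = t ^ k * p (1 / t)"
    and E: "\<And>t. t > 0 \<Longrightarrow> nE (\<gamma> t) = t ^ k * q (1 / t)"
  shows "wall2 \<gamma>"
proof -
  define K where "K = q 0 / \<bar>p 0\<bar> + 1"
  have "((\<lambda>t. q (1 / t) / \<bar>p (1 / t)\<bar>) \<longlongrightarrow> q 0 / \<bar>p 0\<bar>) at_top"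
    using p(2) by (intro tendsto_intros tendsto_at_inverse p q) auto
  then have "\<forall>\<^sub>F t in at_top. q (1 / t) / \<bar>p (1 / t)\<bar> < K"
    by (rule order_tendstoD) (simp add: K_def)
  moreover have "\<forall>\<^sub>F t in at_top. p (1 / t) \<noteq> 0"
    by (rule tendsto_imp_eventually_ne[OF tendsto_at_inverse[OF p(1)] p(2)])
  ultimately have "\<forall>\<^sub>F t in at_top. nE (\<gamma> t) \<le> K * \<bar>nF (\<gamma> t)\<bar>"
    using eventually_gt_at_top[of 0]
  proof eventually_elim
    case (elim t)
    have "q (1 / t) \<le> K * \<bar>p (1 / t)\<bar>"
      using elim(1,2) by (simp add: field_simps)
    then have "t ^ k * q (1 / t) \<le> t ^ k * (K * \<bar>p (1 / t)\<bar>)"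
      using elim(3) by (intro mult_left_mono) auto
    then show ?case
      using elim(3) by (simp add: F E abs_mult ac_simps)
  qed
  then show ?thesis unfolding wall2_def by blast
qed

lemma four_nE_ge:
  "(2 + \<phi> * \<eta> + (x \<bullet> x) / 2 - \<phi>\<^sup>2 * (y \<bullet> y) / 24)\<^sup>2 \<le> 4 * nE (\<phi>, x, y, \<eta>)"
  "(2 + (y \<bullet> y) / 2)\<^sup>2 \<le> 4 * nE (\<phi>, x, y, \<eta>)"
  by (simp_all add: nE_eq)

text \<open>Because the Gram determinant is 0, the terms of degree four in \<open>nF\<close> cancel.
  So \<open>nF\<close> has degree two, the same as the entry with \<open>x \<bullet> x\<close> or
  \<open>y \<bullet> y\<close> that bounds \<open>nE\<close> from below.\<close>

lemma wall1_ray: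
  assumes g: "gram x y = 0" and nz: "x \<noteq> 0 \<or> y \<noteq> 0"
  shows "wall1 (\<lambda>t. t *\<^sub>R (0, x, y, \<eta>))"
proof (rule wall1I)
  define p where "p r = (4 * r\<^sup>2 + x \<bullet> x + y \<bullet> y + \<eta>\<^sup>2) / 4" for r :: real
  define q where "q r = 2 * r\<^sup>2 + (if x = 0 then y \<bullet> y else x \<bullet> x) / 2" for r :: real
  show "isCont p 0" "isCont q 0"
    unfolding p_def q_def by (intro continuous_intros; simp)+
  show "q 0 \<noteq> 0" using nz by (auto simp: q_def)
  fix t :: real assume t: "t > 0"
  have "(x \<bullet> y)\<^sup>2 = (x \<bullet> x) * (y \<bullet> y)" using g by (simp add: gram_def)
  then show "nF (t *\<^sub>R (0, x, y, \<eta>)) = t ^ 2 * p (1 / t)"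
    using t by (simp add: nF_eq p_def power_mult_distrib) (simp add: field_simps eval_nat_numeral)
  have "(t ^ 2 * q (1 / t)) = (if x = 0 then 2 + ((t *\<^sub>R y) \<bullet> (t *\<^sub>R y)) / 2 else 2 + ((t *\<^sub>R x) \<bullet> (t *\<^sub>R x)) / 2)"
    using t by (simp add: q_def field_simps power2_eq_square)
  then show "(t ^ 2 * q (1 / t))\<^sup>2 \<le> 4 * nE (t *\<^sub>R (0, x, y, \<eta>))"
    using four_nE_ge(1)[of 0 "t * \<eta>" "t *\<^sub>R x" "t *\<^sub>R y"]
      four_nE_ge(2)[where \<phi> = 0 and x = "t *\<^sub>R x" and y = "t *\<^sub>R y" and \<eta> = "t * \<eta>"]
    by (cases "x = 0") simp_all
qed

text \<open>The leading coefficient of \<open>nF\<close>, in degree four, is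
  \<open>gram x y / 16\<close>, and \<open>nE\<close> has no higher degree.\<close>

lemma wall2_ray_gram:
  assumes g: "gram x y \<noteq> 0"
  shows "wall2 (\<lambda>t. t *\<^sub>R (0, x, y, \<eta>))"
proof (rule wall2I)
  define p where "p r = ((2 * r\<^sup>2 + (x \<bullet> x) / 2) * (2 * r\<^sup>2 + (y \<bullet> y) / 2) + r\<^sup>2 * \<eta>\<^sup>2 - (x \<bullet> y)\<^sup>2 / 4) / 4" for r :: real
  define q where "q r = ((2 * r\<^sup>2 + (x \<bullet> x) / 2)\<^sup>2 + (2 * r\<^sup>2 + (y \<bullet> y) / 2)\<^sup>2 + 2 * r\<^sup>2 * \<eta>\<^sup>2 + (x \<bullet> y)\<^sup>2 / 2) / 4" for r :: real
  show "isCont p 0" "isCont q 0"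
    unfolding p_def q_def by (intro continuous_intros; simp)+
  show "p 0 \<noteq> 0" using g by (simp add: p_def gram_def)
  fix t :: real assume t: "t > 0"
  show "nF (t *\<^sub>R (0, x, y, \<eta>)) = t ^ 4 * p (1 / t)"
    using t by (simp add: nF_eq p_def) (simp add: field_simps eval_nat_numeral)
  show "nE (t *\<^sub>R (0, x, y, \<eta>)) = t ^ 4 * q (1 / t)"
    using t by (simp add: nE_eq q_def) (simp add: field_simps eval_nat_numeral)
qed

lemma wall2_ray_center:
  assumes "\<eta> \<noteq> 0"
  shows "wall2 (\<lambda>t. t *\<^sub>R (0, 0, 0, \<eta>))"
proof -
  have "nE (t *\<^sub>R (0, 0, 0, \<eta>)) \<le> 2 * \<bar>nF (t *\<^sub>R (0, 0, 0, \<eta>))\<bar>" for t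
    using zero_le_power2[of "t * \<eta>"] by (simp add: nE_eq nF_eq power_mult_distrib)
  then show ?thesis
    unfolding wall2_def by (intro exI[of _ 2] always_eventually allI)
qed

lemma wall1_ray_commutative:
  assumes "\<phi> * \<eta> + (x \<bullet> x) / 2 \<noteq> 0"
  shows "wall1 (\<lambda>t. t *\<^sub>R (\<phi>, x, 0, \<eta>))"
proof (rule wall1I)
  define Q where "Q = \<phi> * \<eta> + (x \<bullet> x) / 2"
  define p where "p r = (4 * r\<^sup>2 + 2 * Q + (\<phi> - \<eta>)\<^sup>2) / 4" for r :: real
  define q where "q r = 2 * r\<^sup>2 + Q" for r :: real
  show "isCont p 0" "isCont q 0"
    unfolding p_def q_def by (intro continuous_intros; simp)+
  show "q 0 \<noteq> 0" using assms by (simp add: q_def Q_def)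
  fix t :: real assume t: "t > 0"
  show "nF (t *\<^sub>R (\<phi>, x, 0, \<eta>)) = t ^ 2 * p (1 / t)"
    using t by (simp add: nF_eq p_def Q_def) (simp add: field_simps power2_eq_square)
  have "(t ^ 2 * q (1 / t)) = 2 + (t * \<phi>) * (t * \<eta>) + ((t *\<^sub>R x) \<bullet> (t *\<^sub>R x)) / 2"
    using t by (simp add: q_def Q_def field_simps power2_eq_square)
  then show "(t ^ 2 * q (1 / t))\<^sup>2 \<le> 4 * nE (t *\<^sub>R (\<phi>, x, 0, \<eta>))"
    using four_nE_ge(1)[of "t * \<phi>" "t * \<eta>" "t *\<^sub>R x" 0] by simp
qed

text \<open>The corner entry is constant along the ray, which gives \<open>nE\<close> = 2
  \<open>nF\<close>: the ray runs in the wall a = b itself.\<close>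

lemma wall2_ray_commutative:
  assumes Q: "\<phi> * \<eta> + (x \<bullet> x) / 2 = 0"
  shows "wall2 (\<lambda>t. t *\<^sub>R (\<phi>, x, 0, \<eta>))"
proof -
  have "nE (t *\<^sub>R (\<phi>, x, 0, \<eta>)) \<le> 2 * \<bar>nF (t *\<^sub>R (\<phi>, x, 0, \<eta>))\<bar>" for t
  proof -
    define z where "z = t * \<phi> * (t * \<eta>) + t * (t * (x \<bullet> x)) / 2"
    have "z = t\<^sup>2 * (\<phi> * \<eta> + (x \<bullet> x) / 2)"
      by (simp add: z_def power2_eq_square algebra_simps)
    then have z: "z = 0" unfolding Q by simp
    have "nE (t *\<^sub>R (\<phi>, x, 0, \<eta>)) = ((2 + z)\<^sup>2 + 2\<^sup>2 + 2 * (t * \<phi> - t * \<eta>)\<^sup>2) / 4"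
      "nF (t *\<^sub>R (\<phi>, x, 0, \<eta>)) = ((2 + z) * 2 + (t * \<phi> - t * \<eta>)\<^sup>2) / 4"
      by (simp_all add: nE_eq nF_eq z_def add.assoc)
    then have "nE (t *\<^sub>R (\<phi>, x, 0, \<eta>)) = 2 * nF (t *\<^sub>R (\<phi>, x, 0, \<eta>))"
      unfolding z by simp
    then show ?thesis by simp
  qed
  then show ?thesis
    unfolding wall2_def by (intro exI[of _ 2] always_eventually allI)
qed

text \<open>Along this curve \<open>nF\<close> is a quadratic polynomial in the last coordinate \<open>\<eta>\<close>; its minimum is near
  \<open>\<eta> = - t\<^sup>3 (y \<bullet> y) / 12\<close>, and there the terms of degree six cancel.\<close>

lemma wall1_curve:
  assumes "y \<noteq> 0"
  shows "wall1 (\<lambda>t. (t, t *\<^sub>R x, t *\<^sub>R y, - (t ^ 3 * (y \<bullet> y) / 12)))"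
proof (rule wall1I)
  define Y where "Y = y \<bullet> y"
  have Y: "Y > 0" using assms by (simp add: Y_def)
  define p where "p r = (4 * r ^ 4 + r\<^sup>2 * (x \<bullet> x + Y + 1) + (Y / 4 + (x \<bullet> x) * Y / 4 - (x \<bullet> y)\<^sup>2 / 4)) / 4" for r :: real
  define q where "q r = 2 * r ^ 4 + r\<^sup>2 * (x \<bullet> x) / 2 - Y / 8" for r :: real
  show "isCont p 0" "isCont q 0"
    unfolding p_def q_def by (intro continuous_intros; simp)+
  show "q 0 \<noteq> 0" using Y by (simp add: q_def)
  fix t :: real assume t: "t > 0"
  show "nF (t, t *\<^sub>R x, t *\<^sub>R y, - (t ^ 3 * (y \<bullet> y) / 12)) = t ^ 4 * p (1 / t)"
    using t unfolding Y_def[symmetric] by (simp add: nF_eq p_def Y_def[symmetric]) (simp add: field_simps eval_nat_numeral)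
  have "t ^ 4 * q (1 / t) = 2 + t * (- (t ^ 3 * (y \<bullet> y) / 12)) + ((t *\<^sub>R x) \<bullet> (t *\<^sub>R x)) / 2 - t\<^sup>2 * ((t *\<^sub>R y) \<bullet> (t *\<^sub>R y)) / 24"
    using t unfolding q_def Y_def by (simp add: field_simps eval_nat_numeral)
  then show "(t ^ 4 * q (1 / t))\<^sup>2 \<le> 4 * nE (t, t *\<^sub>R x, t *\<^sub>R y, - (t ^ 3 * (y \<bullet> y) / 12))"
    using four_nE_ge(1)[of t "- (t ^ 3 * (y \<bullet> y) / 12)" "t *\<^sub>R x" "t *\<^sub>R y"] by simp
qed

text \<open>To be interpolated with the curve of \<open>wall1_curve\<close>: the last coordinates
  have the same sign and the same growth, so they do not cancel.\<close>

lemma wall2_curve_center: "wall2 (\<lambda>t. (0, 0, 0, - (t ^ 3)))"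
proof -
  have "nE (0, 0, 0, - (t ^ 3)) \<le> 2 * \<bar>nF (0, 0, 0, - (t ^ 3))\<bar>" for t :: real
    using zero_le_power2[of "t ^ 3"] by (simp add: nE_eq nF_eq)
  then show ?thesis
    unfolding wall2_def by (intro exI[of _ 2] always_eventually allI)
qed

text \<open>A ray run through at quadratic speed, to match the quadratic term of the curve in
  \<open>wall2_curve\<close>, with which it will be interpolated.\<close>

lemma wall1_square_ray:
  assumes "v \<noteq> 0"
  shows "wall1 (\<lambda>t. t\<^sup>2 *\<^sub>R (0, v, 0, \<eta>))"
proof (rule wall1I)
  define p where "p r = (4 * r ^ 4 + v \<bullet> v + \<eta>\<^sup>2) / 4" for r :: real
  define q where "q r = 2 * r ^ 4 + (v \<bullet> v) / 2" for r :: real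
  show "isCont p 0" "isCont q 0"
    unfolding p_def q_def by (intro continuous_intros; simp)+
  show "q 0 \<noteq> 0" using assms by (simp add: q_def)
  fix t :: real assume t: "t > 0"
  show "nF (t\<^sup>2 *\<^sub>R (0, v, 0, \<eta>)) = t ^ 4 * p (1 / t)"
    using t by (simp add: nF_eq p_def) (simp add: field_simps eval_nat_numeral)
  have "t ^ 4 * q (1 / t) = 2 + ((t\<^sup>2 *\<^sub>R v) \<bullet> (t\<^sup>2 *\<^sub>R v)) / 2"
    using t by (simp add: q_def field_simps eval_nat_numeral)
  then show "(t ^ 4 * q (1 / t))\<^sup>2 \<le> 4 * nE (t\<^sup>2 *\<^sub>R (0, v, 0, \<eta>))"
    using four_nE_ge(1)[of 0 "t\<^sup>2 * \<eta>" "t\<^sup>2 *\<^sub>R v" 0] by simp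
qed

text \<open>The choice of \<open>\<kappa>\<close> cancels the terms of degree four in the entry that otherwise dominates \<open>nE\<close>.\<close>

lemma wall2_curve:
  assumes y: "y \<noteq> 0" and vy: "v \<bullet> y = 0" and \<kappa>: "\<kappa>\<^sup>2 * (v \<bullet> v) = (y \<bullet> y) / 12"
  shows "wall2 (\<lambda>t. t *\<^sub>R (1, x, y, \<eta>) + (\<kappa> * t\<^sup>2) *\<^sub>R (0, v, 0, \<zeta>))"
proof (rule wall2I)
  define Y where "Y = y \<bullet> y"
  have Y: "Y > 0" using y by (simp add: Y_def)
  define a where "a r = r * (2 * r\<^sup>2 + \<eta> + (x \<bullet> x) / 2) + \<kappa> * \<zeta> + \<kappa> * (x \<bullet> v)" for r :: real
  define d where "d r = 2 * r\<^sup>2 + Y / 2" for r :: real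
  define m where "m r = r\<^sup>2 * (1 - \<eta>) - \<kappa> * \<zeta> * r + Y / 6" for r :: real
  \<comment> \<open>With the cancellation built into \<open>a\<close>, all of \<open>nF\<close> and
    \<open>nE\<close> has degree at most six. In \<open>p 0\<close> only the square of
    \<open>m 0\<close>, which is Y/6, survives, so \<open>nF\<close> attains this degree.\<close>
  define p where "p r = (r * (a r * d r) + (m r)\<^sup>2 - r\<^sup>2 * (x \<bullet> y)\<^sup>2 / 4) / 4" for r
  define q where "q r = ((a r)\<^sup>2 + r\<^sup>2 * (d r)\<^sup>2 + 2 * (m r)\<^sup>2 + r\<^sup>2 * (x \<bullet> y)\<^sup>2 / 2) / 4" for r
  show "isCont p 0" "isCont q 0"
    unfolding p_def q_def a_def d_def m_def by (intro continuous_intros; simp)+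
  show "p 0 \<noteq> 0" using Y by (simp add: p_def m_def)
  fix t :: real assume t: "t > 0"
  let ?X = "t *\<^sub>R x + (\<kappa> * t\<^sup>2) *\<^sub>R v" and ?h = "t * \<eta> + \<kappa> * t\<^sup>2 * \<zeta>"
  have e: "t *\<^sub>R (1, x, y, \<eta>) + (\<kappa> * t\<^sup>2) *\<^sub>R (0, v, 0, \<zeta>) = (t, ?X, t *\<^sub>R y, ?h)"
    by simp
  have "?X \<bullet> ?X = t\<^sup>2 * (x \<bullet> x) + 2 * \<kappa> * t ^ 3 * (x \<bullet> v) + t ^ 4 * (\<kappa>\<^sup>2 * (v \<bullet> v))"
    by (simp add: inner_add_left inner_add_right inner_commute[of v x] algebra_simps eval_nat_numeral)
  then have "2 + t * ?h + (?X \<bullet> ?X) / 2 - t\<^sup>2 * ((t *\<^sub>R y) \<bullet> (t *\<^sub>R y)) / 24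
      = 2 + t * ?h + (t\<^sup>2 * (x \<bullet> x) + 2 * \<kappa> * t ^ 3 * (x \<bullet> v)) / 2"
    unfolding \<kappa> by (simp add: field_simps eval_nat_numeral)
  also have "\<dots> = t ^ 3 * a (1 / t)"
    using t by (simp add: a_def field_simps eval_nat_numeral)
  finally have A: "2 + t * ?h + (?X \<bullet> ?X) / 2 - t\<^sup>2 * ((t *\<^sub>R y) \<bullet> (t *\<^sub>R y)) / 24 = t ^ 3 * a (1 / t)" .
  have D: "2 + ((t *\<^sub>R y) \<bullet> (t *\<^sub>R y)) / 2 = t\<^sup>2 * d (1 / t)"
    using t by (simp add: d_def Y_def field_simps power2_eq_square)
  have m: "t - ?h + t * ((t *\<^sub>R y) \<bullet> (t *\<^sub>R y)) / 6 = t ^ 3 * m (1 / t)"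
    using t by (simp add: m_def Y_def[symmetric]) (simp add: field_simps eval_nat_numeral Y_def)
  have xy: "?X \<bullet> (t *\<^sub>R y) = t\<^sup>2 * (x \<bullet> y)"
    by (simp add: inner_add_left vy power2_eq_square)
  show "nF (t *\<^sub>R (1, x, y, \<eta>) + (\<kappa> * t\<^sup>2) *\<^sub>R (0, v, 0, \<zeta>)) = t ^ 6 * p (1 / t)"
    unfolding e nF_eq A D m xy using t by (simp add: p_def field_simps eval_nat_numeral)
  show "nE (t *\<^sub>R (1, x, y, \<eta>) + (\<kappa> * t\<^sup>2) *\<^sub>R (0, v, 0, \<zeta>)) = t ^ 6 * q (1 / t)"
    unfolding e nE_eq A D m xy using t by (simp add: q_def field_simps eval_nat_numeral)
qed

subsection \<open>Subgroups that are Cartan-decomposition subgroups\<close>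

lemma norm_proj_le: "norm (fst w) \<le> norm w" "norm (snd w) \<le> norm w"
  by (cases w; simp add: norm_fst_le norm_snd_le)+

context unipotent_subgroup
begin

text \<open>Independence keeps the segment from \<open>X\<close> to \<open>Z\<close> away from the
  origin, so its minimal norm is positive and the interpolation of the two rays grows linearly in
  t.\<close>

lemma cartan_of_rays:
  assumes X: "X \<in> lie" "wall1 (\<lambda>t. t *\<^sub>R X)" "X \<noteq> 0" and Z: "Z \<in> lie" "wall2 (\<lambda>t. t *\<^sub>R Z)" and ind: "\<And>c. Z \<noteq> c *\<^sub>R X"
  shows "cartan_decomposition_subgroup SO2n H"
proof (rule filling)
  show "continuous_on UNIV (\<lambda>t :: real. t *\<^sub>R X)" "continuous_on UNIV (\<lambda>t :: real. t *\<^sub>R Z)"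
    by (intro continuous_intros)+
  show "t *\<^sub>R X \<in> lie" "t *\<^sub>R Z \<in> lie" for t
    by (intro lie_scaleR X Z)+
  show "wall1 (\<lambda>t. t *\<^sub>R X)" "wall2 (\<lambda>t. t *\<^sub>R Z)" by (rule X Z)+
  fix R :: real
  let ?f = "\<lambda>s :: real. norm ((1 - s) *\<^sub>R X + s *\<^sub>R Z)"
  have "continuous_on {0..1} ?f" by (intro continuous_intros)
  then obtain s0 where s0: "\<forall>s\<in>{0..1}. ?f s0 \<le> ?f s"
    using continuous_attains_inf[of "{0..1::real}" ?f] by auto
  have pos: "?f s0 > 0"
  proof (rule ccontr)
    assume "\<not> ?thesis"
    then have z: "(1 - s0) *\<^sub>R X + s0 *\<^sub>R Z = 0" by simp
    show False
    proof (cases "s0 = 0")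
      case True
      with z X show False by simp
    next
      case False
      have "Z = (1 / s0) *\<^sub>R (s0 *\<^sub>R Z)" using False by simp
      also have "s0 *\<^sub>R Z = - ((1 - s0) *\<^sub>R X)"
        using z by (simp add: eq_neg_iff_add_eq_0 add.commute)
      finally have "Z = (- ((1 - s0) / s0)) *\<^sub>R X" by simp
      then show False using ind by blast
    qed
  qed
  show "\<exists>t\<ge>0. \<forall>s\<in>{0..1}. norm ((1 - s) *\<^sub>R t *\<^sub>R X + s *\<^sub>R t *\<^sub>R Z) \<ge> R"
  proof (intro exI[of _ "\<bar>R\<bar> / ?f s0"] conjI ballI)
    show "0 \<le> \<bar>R\<bar> / ?f s0" using pos by simp
    fix s :: real assume s: "s \<in> {0..1}"
    define t where "t = \<bar>R\<bar> / ?f s0"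
    have t: "t \<ge> 0" using pos by (simp add: t_def)
    have "R \<le> t * ?f s0" using pos by (simp add: t_def)
    also have "\<dots> \<le> t * ?f s" using s0 s t by (intro mult_left_mono) auto
    also have "\<dots> = norm (t *\<^sub>R ((1 - s) *\<^sub>R X + s *\<^sub>R Z))" using t by simp
    also have "t *\<^sub>R ((1 - s) *\<^sub>R X + s *\<^sub>R Z) = (1 - s) *\<^sub>R t *\<^sub>R X + s *\<^sub>R t *\<^sub>R Z"
      by (simp add: scaleR_add_right mult.commute)
    finally show "R \<le> norm ((1 - s) *\<^sub>R (\<bar>R\<bar> / ?f s0) *\<^sub>R X + s *\<^sub>R (\<bar>R\<bar> / ?f s0) *\<^sub>R Z)"
      unfolding t_def .
  qed
qed simp_all

lemma cartan_of_center:
  assumes Z: "(0, 0, 0, \<zeta>) \<in> lie" "\<zeta> \<noteq> 0" and W: "(0, w, 0, \<omega>) \<in> lie" "w \<noteq> 0"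
  shows "cartan_decomposition_subgroup SO2n H"
proof (rule cartan_of_rays)
  show "(0, w, 0, \<omega>) \<in> lie" "(0, 0, 0, \<zeta>) \<in> lie" by (rule W Z)+
  show "wall1 (\<lambda>t. t *\<^sub>R (0, w, 0, \<omega>))"
    using W by (intro wall1_ray) (auto simp: gram_def)
  show "wall2 (\<lambda>t. t *\<^sub>R (0, 0, 0, \<zeta>))"
    by (rule wall2_ray_center[OF Z(2)])
  show "(0, 0, 0, \<zeta>) \<noteq> c *\<^sub>R (0, w, 0, \<omega>)" for c
    using W Z by auto
qed (use W in \<open>simp add: zero_prod_def\<close>)

lemma lie_normalize_phi:
  assumes "(\<phi>, x, y, \<eta>) \<in> lie" "\<phi> \<noteq> 0"
  shows "\<exists>x' y' \<eta>'. (1, x', y', \<eta>') \<in> lie \<and> y' = (1 / \<phi>) *\<^sub>R y"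
  using lie_scaleR[OF assms(1), of "1 / \<phi>"] assms(2) by auto

lemma lie_kernel_element:
  assumes dim: "dim lie \<ge> 2" and U: "(1, x, y, \<eta>) \<in> lie"
  shows "\<exists>x' y' \<eta>'. (0, x', y', \<eta>') \<in> lie \<and> (0, x', y', \<eta>') \<noteq> (0 :: 'k nvec)"
proof -
  have "\<not> lie \<subseteq> span {(1, x, y, \<eta>)}"
  proof
    assume "lie \<subseteq> span {(1, x, y, \<eta>)}"
    then have "dim lie \<le> dim {(1 :: real, x, y, \<eta>)}"
      by (metis dim_span dim_subset)
    also have "\<dots> \<le> card {(1 :: real, x, y, \<eta>)}"
      by (rule dim_le_card') simp
    finally show False using dim by simp
  qed
  then obtain w where w: "w \<in> lie" "w \<notin> span {(1, x, y, \<eta>)}" by blast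
  define v where "v = w - fst w *\<^sub>R (1, x, y, \<eta>)"
  have "v \<in> lie"
    unfolding v_def using w U by (intro subspace_diff[OF subspace_lie] lie_scaleR)
  moreover have "v \<noteq> 0"
    using w(2) by (auto simp: v_def span_singleton)
  moreover have "fst v = 0" by (simp add: v_def)
  ultimately show ?thesis by (cases v) auto
qed

lemma cartan_of_no_phi:
  assumes \<phi>: "\<And>\<phi> x y \<eta>. (\<phi>, x, y, \<eta>) \<in> lie \<Longrightarrow> \<phi> = 0"
    and X: "(0, x, y, \<eta>) \<in> lie" "x \<noteq> 0 \<or> y \<noteq> 0" "gram x y = 0"
    and Z: "(0, x', y', \<eta>') \<in> lie" "(0, x', y', \<eta>') \<noteq> (0 :: 'k nvec)" "x' = 0 \<and> y' = 0 \<or> gram x' y' \<noteq> 0"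
  shows "cartan_decomposition_subgroup SO2n H"
proof (rule cartan_of_rays)
  show "(0, x, y, \<eta>) \<in> lie" "(0, x', y', \<eta>') \<in> lie" by (rule X Z)+
  show "wall1 (\<lambda>t. t *\<^sub>R (0, x, y, \<eta>))" by (rule wall1_ray[OF X(3,2)])
  show "(0, x, y, \<eta>) \<noteq> 0" using X(2) by (auto simp: zero_prod_def)
  show "wall2 (\<lambda>t. t *\<^sub>R (0, x', y', \<eta>'))"
  proof (cases "gram x' y' = 0")
    case True
    then show ?thesis
      using Z(2,3) wall2_ray_center[of \<eta>'] by (auto simp: zero_prod_def)
  next
    case False
    then show ?thesis by (rule wall2_ray_gram)
  qed
  fix c
  show "(0, x', y', \<eta>') \<noteq> c *\<^sub>R (0, x, y, \<eta>)"
  proof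
    assume e: "(0, x', y', \<eta>') = c *\<^sub>R (0, x, y, \<eta>)"
    then have xy: "x' = c *\<^sub>R x" "y' = c *\<^sub>R y" by simp_all
    have "gram x' y' = c ^ 4 * gram x y"
      unfolding xy gram_def by (simp add: power2_eq_square eval_nat_numeral algebra_simps)
    then have "c = 0" using X Z(3) xy by auto
    then show False using e Z(2) by (simp add: zero_prod_def)
  qed
qed

text \<open>If some element has \<open>\<phi> = 0\<close> and y nonzero, brackets produce a central
  element and an element with y = 0, and rays suffice. Otherwise y is a multiple of
  \<open>yU\<close> with factor \<open>\<phi>\<close>, and a second vector has the form
  \<open>(0, v, 0, \<zeta>)\<close>. If v = 0, the centre is the wall a = b and bends the ray of
  \<open>U\<close> to the other wall. If v is not orthogonal to \<open>yU\<close>, a bracket is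
  central and rays suffice again. If it is orthogonal, the ray of the second vector follows b = 1
  and bends the ray of \<open>U\<close> to a = b.\<close>

lemma cartan_of_noncommutative:
  assumes dim: "dim lie \<ge> 2" and \<phi>: "(\<phi>, x1, y1, \<eta>1) \<in> lie" "\<phi> \<noteq> 0" and y: "(\<phi>2, x2, y2, \<eta>2) \<in> lie" "y2 \<noteq> 0"
  shows "cartan_decomposition_subgroup SO2n H"
proof -
  obtain xU yU \<eta>U where U: "(1, xU, yU, \<eta>U) \<in> lie"
    using lie_normalize_phi[OF \<phi>] by blast
  show ?thesis
  proof (cases "\<exists>x y \<eta>. (0, x, y, \<eta>) \<in> lie \<and> y \<noteq> 0")
    case True
    then obtain x y \<eta> where V: "(0, x, y, \<eta>) \<in> lie" "y \<noteq> 0" by blast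
    have W: "(0, y, 0, x \<bullet> yU - xU \<bullet> y) \<in> lie"
      using br_lie[OF U V(1)] by (simp add: br_def)
    have "(0, 0, 0, y \<bullet> y) \<in> lie"
      using br_lie[OF V(1) W] by (simp add: br_def)
    then show ?thesis
      using W V(2) by (intro cartan_of_center[of "y \<bullet> y" y]) auto
  next
    case False
    then have y0: "y = 0" if "(0, x, y, \<eta>) \<in> lie" for x y \<eta> using that by blast
    have "y2 - \<phi>2 *\<^sub>R yU = 0"
      using subspace_diff[OF subspace_lie y(1) lie_scaleR[OF U, of \<phi>2]] by (intro y0) simp
    then have yU: "yU \<noteq> 0" using y(2) by auto
    obtain v y' \<zeta> where "(0, v, y', \<zeta>) \<in> lie" "(0, v, y', \<zeta>) \<noteq> (0 :: 'k nvec)"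
      using lie_kernel_element[OF dim U] by blast
    then have V: "(0, v, 0, \<zeta>) \<in> lie" "(0, v, 0, \<zeta>) \<noteq> (0 :: 'k nvec)"
      using y0 by (auto simp: zero_prod_def)
    have brUV: "(0, 0, 0, v \<bullet> yU) \<in> lie"
      using br_lie[OF U V(1)] by (simp add: br_def)
    show ?thesis
    proof (cases "v = 0")
      case True
      then have "\<zeta> \<noteq> 0" "(0, 0, 0, \<zeta>) \<in> lie" using V by (auto simp: zero_prod_def)
      then have Z: "(0, 0, 0, r) \<in> lie" for r
        using lie_scaleR[of "(0, 0, 0, \<zeta>)" "r / \<zeta>"] by simp
      define \<gamma> where "\<gamma> t = (t, t *\<^sub>R xU, t *\<^sub>R yU, - (t ^ 3 * (yU \<bullet> yU) / 12))" for t :: real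
      define \<delta> where "\<delta> t = (0 :: real, 0 :: (real, 'k) vec, 0 :: (real, 'k) vec, - (t ^ 3))" for t :: real
      show ?thesis
      proof (rule filling)
        show "continuous_on UNIV \<gamma>" "continuous_on UNIV \<delta>"
          unfolding \<gamma>_def \<delta>_def by (intro continuous_intros; simp)+
        show "\<gamma> t \<in> lie" for t
          using subspace_add[OF subspace_lie lie_scaleR[OF U, of t] Z[of "- (t ^ 3 * (yU \<bullet> yU) / 12) - t * \<eta>U"]]
          by (simp add: \<gamma>_def)
        show "\<delta> t \<in> lie" for t by (simp add: \<delta>_def Z)
        show "\<gamma> 0 = 0" "\<delta> 0 = 0" by (simp_all add: \<gamma>_def \<delta>_def zero_prod_def)
        show "wall1 \<gamma>" unfolding \<gamma>_def by (rule wall1_curve[OF yU])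
        show "wall2 \<delta>" unfolding \<delta>_def by (rule wall2_curve_center)
        fix R :: real
        define t where "t = max 1 (2 * R)"
        have t: "t \<ge> 1" "t \<ge> 2 * R" by (simp_all add: t_def)
        have t3: "t ^ 3 \<ge> t"
          using t self_le_power[of t 3] by simp
        have "norm ((1 - s) *\<^sub>R \<gamma> t + s *\<^sub>R \<delta> t) \<ge> R" if s: "s \<in> {0..1}" for s
        \<comment> \<open>For small s the first coordinate of the interpolation is large, for large
          s the last one; in the last one both summands have the same sign.\<close>
        proof (cases "s \<le> 1 / 2")
          case True
          have "R \<le> (1 / 2) * t" using t by simp
          also have "\<dots> \<le> (1 - s) * t" using True t by (intro mult_right_mono) auto
          also have "\<dots> = fst ((1 - s) *\<^sub>R \<gamma> t + s *\<^sub>R \<delta> t)" by (simp add: \<gamma>_def \<delta>_def)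
          also have "\<dots> \<le> norm ((1 - s) *\<^sub>R \<gamma> t + s *\<^sub>R \<delta> t)"
            using norm_proj_le(1)[of "(1 - s) *\<^sub>R \<gamma> t + s *\<^sub>R \<delta> t"]
            unfolding real_norm_def by (rule order_trans[OF abs_ge_self])
          finally show ?thesis .
        next
          case False
          define z where "z = snd (snd (snd ((1 - s) *\<^sub>R \<gamma> t + s *\<^sub>R \<delta> t)))"
          have "0 \<le> (1 - s) * (t ^ 3 * (yU \<bullet> yU) / 12)" using s t by simp
          moreover have "- z = (1 - s) * (t ^ 3 * (yU \<bullet> yU) / 12) + s * t ^ 3"
            by (simp add: z_def \<gamma>_def \<delta>_def)
          moreover have "(1 / 2) * t \<le> s * t ^ 3"
            using False t t3 by (intro mult_mono) auto
          ultimately have "R \<le> - z" using t by simp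
          also have "\<dots> \<le> norm z" by simp
          also have "\<dots> \<le> norm ((1 - s) *\<^sub>R \<gamma> t + s *\<^sub>R \<delta> t)"
            unfolding z_def by (rule order_trans[OF norm_proj_le(2) order_trans[OF norm_proj_le(2) norm_proj_le(2)]])
          finally show ?thesis .
        qed
        then show "\<exists>t\<ge>0. \<forall>s\<in>{0..1}. norm ((1 - s) *\<^sub>R \<gamma> t + s *\<^sub>R \<delta> t) \<ge> R"
          using t by (intro exI[of _ t]) auto
      qed
    next
      case v: False
      show ?thesis
      proof (cases "v \<bullet> yU = 0")
        case False
        then show ?thesis
          using V(1) brUV v by (intro cartan_of_center[of "v \<bullet> yU" v]) auto
      next
        case True
        define \<kappa> where "\<kappa> = sqrt ((yU \<bullet> yU) / 12 / (v \<bullet> v))"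
        have \<kappa>0: "\<kappa> > 0" using yU v by (simp add: \<kappa>_def)
        have "\<kappa>\<^sup>2 = (yU \<bullet> yU) / 12 / (v \<bullet> v)" by (simp add: \<kappa>_def)
        then have \<kappa>: "\<kappa>\<^sup>2 * (v \<bullet> v) = (yU \<bullet> yU) / 12" using v by simp
        define \<gamma> where "\<gamma> t = t\<^sup>2 *\<^sub>R (0 :: real, v, 0 :: (real, 'k) vec, \<zeta>)" for t :: real
        define \<delta> where "\<delta> t = t *\<^sub>R (1 :: real, xU, yU, \<eta>U) + (\<kappa> * t\<^sup>2) *\<^sub>R (0, v, 0, \<zeta>)" for t :: real
        show ?thesis
        proof (rule filling)
          show "continuous_on UNIV \<gamma>" "continuous_on UNIV \<delta>"
            unfolding \<gamma>_def \<delta>_def by (intro continuous_intros)+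
          show "\<gamma> t \<in> lie" "\<delta> t \<in> lie" for t
            unfolding \<gamma>_def \<delta>_def by (intro subspace_add[OF subspace_lie] lie_scaleR V U)+
          show "\<gamma> 0 = 0" "\<delta> 0 = 0" by (simp_all add: \<gamma>_def \<delta>_def zero_prod_def)
          show "wall1 \<gamma>" unfolding \<gamma>_def by (rule wall1_square_ray[OF v])
          show "wall2 \<delta>" unfolding \<delta>_def by (rule wall2_curve[OF yU True \<kappa>])
          fix R :: real
          define \<mu> where "\<mu> = min 1 \<kappa> * norm v"
          have \<mu>: "\<mu> > 0" using \<kappa>0 v by (simp add: \<mu>_def)
          \<comment> \<open>If the norm were below R, the first coordinate would bound s t, so the
            contribution of \<open>xU\<close> would be at most R times its norm. The part along
            \<open>v\<close>, which is at least \<open>\<mu>\<close> times t^2 in norm, then exceeds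
            what is allowed as soon as it reaches \<open>S\<close>.\<close>
          define S where "S = \<bar>R\<bar> + \<bar>R\<bar> * norm xU + 1"
          define t where "t = max 1 (S / \<mu>)"
          have t: "t \<ge> 1" "t \<ge> S / \<mu>" by (simp_all add: t_def)
          have "t \<le> t\<^sup>2" using t by (simp add: power2_eq_square)
          then have "t * \<mu> \<le> t\<^sup>2 * \<mu>"
            using \<mu> by (intro mult_right_mono) auto
          moreover have "S \<le> t * \<mu>"
            using t(2) \<mu> by (simp add: pos_divide_le_eq)
          ultimately have t2: "t\<^sup>2 * \<mu> \<ge> S" by (rule order_trans[rotated])
          have "norm ((1 - s) *\<^sub>R \<gamma> t + s *\<^sub>R \<delta> t) \<ge> R" if s: "s \<in> {0..1}" for s
          proof (rule ccontr)
            define w where "w = (1 - s) *\<^sub>R \<gamma> t + s *\<^sub>R \<delta> t"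
            assume "\<not> ?thesis"
            then have wR: "norm w < R" by (simp add: w_def)
            have "norm (fst w) \<le> norm w" "norm (fst (snd w)) \<le> norm w"
              using norm_proj_le(1)[of w] norm_proj_le(1)[of "snd w"] norm_proj_le(2)[of w] by auto
            moreover have w1: "fst w = s * t" and w2: "fst (snd w) = (s * t) *\<^sub>R xU + ((1 - s) * t\<^sup>2 + s * (\<kappa> * t\<^sup>2)) *\<^sub>R v"
              by (simp_all add: w_def \<gamma>_def \<delta>_def algebra_simps)
            ultimately have st: "\<bar>s * t\<bar> \<le> R" and n2: "norm ((s * t) *\<^sub>R xU + ((1 - s) * t\<^sup>2 + s * (\<kappa> * t\<^sup>2)) *\<^sub>R v) \<le> R"
              using wR by auto
            have c: "t\<^sup>2 * min 1 \<kappa> \<le> (1 - s) * t\<^sup>2 + s * (\<kappa> * t\<^sup>2)"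
            proof -
              have "(1 - s) * (t\<^sup>2 * min 1 \<kappa>) \<le> (1 - s) * t\<^sup>2" "s * (t\<^sup>2 * min 1 \<kappa>) \<le> s * (\<kappa> * t\<^sup>2)"
                using s by (auto intro!: mult_left_mono simp: mult.commute[of \<kappa>] mult_left_le)
              then show ?thesis by (simp add: algebra_simps)
            qed
            have "S \<le> (t\<^sup>2 * min 1 \<kappa>) * norm v" using t2 by (simp add: \<mu>_def mult.assoc)
            also have "\<dots> \<le> ((1 - s) * t\<^sup>2 + s * (\<kappa> * t\<^sup>2)) * norm v"
              using c by (rule mult_right_mono) simp
            also have "\<dots> \<le> norm (((1 - s) * t\<^sup>2 + s * (\<kappa> * t\<^sup>2)) *\<^sub>R v)"
              by (simp add: mult_right_mono)
            also have "\<dots> \<le> norm ((s * t) *\<^sub>R xU + ((1 - s) * t\<^sup>2 + s * (\<kappa> * t\<^sup>2)) *\<^sub>R v) + norm ((s * t) *\<^sub>R xU)"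
              using norm_triangle_ineq4[of "(s * t) *\<^sub>R xU + ((1 - s) * t\<^sup>2 + s * (\<kappa> * t\<^sup>2)) *\<^sub>R v" "(s * t) *\<^sub>R xU"] by simp
            also have "\<dots> \<le> R + R * norm xU"
              using n2 st by (intro add_mono) (auto intro: mult_right_mono)
            also have "\<dots> \<le> \<bar>R\<bar> + \<bar>R\<bar> * norm xU"
              by (intro add_mono mult_right_mono) auto
            finally show False by (simp add: S_def)
          qed
          then show "\<exists>t\<ge>0. \<forall>s\<in>{0..1}. norm ((1 - s) *\<^sub>R \<gamma> t + s *\<^sub>R \<delta> t) \<ge> R"
            using t by (intro exI[of _ t]) auto
        qed
      qed
    qed
  qed
qed

end

section \<open>The commutative case and its quadratic form\<close>

lemma linear_functional_inner:
  fixes f :: "'a::euclidean_space \<Rightarrow> real"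
  assumes "linear f"
  shows "\<exists>b. \<forall>x. f x = b \<bullet> x"
  using adjoint_works[OF assms, of _ 1] by (intro exI[of _ "adjoint f 1"]) (simp add: inner_commute)

text \<open>For y = 0 this is minus the corner entry of \<open>nexp\<close>. A ray on which it is
  nonzero follows the wall b = 1, and a nonzero isotropic vector gives the wall a = b.\<close>

definition Qform :: "'k::finite nvec \<Rightarrow> real" where
  "Qform = (\<lambda>(\<phi>, x, y, \<eta>). \<phi> * \<eta> + (x \<bullet> x) / 2)"

lemma Qform_scaleR: "Qform (c *\<^sub>R v) = c\<^sup>2 * Qform v"
  by (cases v) (simp add: Qform_def power2_eq_square algebra_simps)

context unipotent_subgroup
begin

lemma cartan_of_commutative:
  assumes y: "\<And>\<phi> x y \<eta>. (\<phi>, x, y, \<eta>) \<in> lie \<Longrightarrow> y = 0"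
    and X: "X \<in> lie" "Qform X \<noteq> 0" and Z: "Z \<in> lie" "Qform Z = 0" "Z \<noteq> 0"
  shows "cartan_decomposition_subgroup SO2n H"
proof (rule cartan_of_rays)
  show "X \<in> lie" "Z \<in> lie" by (rule X Z)+
  obtain \<phi> x y1 \<eta> where Xe: "X = (\<phi>, x, y1, \<eta>)" by (cases X)
  moreover from this have "y1 = 0" using X(1) y by blast
  ultimately show "wall1 (\<lambda>t. t *\<^sub>R X)"
    using X wall1_ray_commutative[of \<phi> \<eta> x] by (auto simp: Qform_def)
  obtain \<phi>' x' y1' \<eta>' where Ze: "Z = (\<phi>', x', y1', \<eta>')" by (cases Z)
  moreover from this have "y1' = 0" using Z(1) y by blast
  ultimately show "wall2 (\<lambda>t. t *\<^sub>R Z)"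
    using Z wall2_ray_commutative[of \<phi>' \<eta>' x'] by (auto simp: Qform_def)
  show "X \<noteq> 0" using X(2) by (auto simp: Qform_def zero_prod_def)
  show "Z \<noteq> c *\<^sub>R X" for c
    using X(2) Z(2,3) by (auto simp: Qform_scaleR)
qed

text \<open>The quadratic form \<open>Qform\<close> has only one negative direction, so on a subspace of dimension at least two it
  either has both zeros and non-zeros or is positive definite.\<close>

lemma Qform_positive:
  assumes dim: "dim lie \<ge> 2" and y: "\<And>\<phi> x y \<eta>. (\<phi>, x, y, \<eta>) \<in> lie \<Longrightarrow> y = 0"
    and \<phi>: "(\<phi>0, x0, y0, \<eta>0) \<in> lie" "\<phi>0 \<noteq> 0" and ncds: "\<not> cartan_decomposition_subgroup SO2n H"
    and w: "w \<in> lie" "w \<noteq> 0"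
  shows "Qform w > 0"
proof -
  obtain xU yU \<eta>U where "(1, xU, yU, \<eta>U) \<in> lie"
    using lie_normalize_phi[OF \<phi>] by blast
  then have U: "(1, xU, 0, \<eta>U) \<in> lie" using y by blast
  obtain v y' \<zeta> where "(0, v, y', \<zeta>) \<in> lie" "(0, v, y', \<zeta>) \<noteq> (0 :: 'k nvec)"
    using lie_kernel_element[OF dim U] by blast
  then have V: "(0, v, 0, \<zeta>) \<in> lie" "(0, v, 0, \<zeta>) \<noteq> (0 :: 'k nvec)"
    using y by blast+
  have alt: "(\<forall>X\<in>lie. Qform X = 0) \<or> (\<forall>Z\<in>lie. Z \<noteq> 0 \<longrightarrow> Qform Z \<noteq> 0)"
  proof (rule ccontr)
    assume "\<not> ?thesis"
    then obtain X Z where "X \<in> lie" "Qform X \<noteq> 0" "Z \<in> lie" "Qform Z = 0" "Z \<noteq> 0" by blast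
    then have "cartan_decomposition_subgroup SO2n H"
      by (rule cartan_of_commutative[rotated]) (rule y)
    with ncds show False ..
  qed
  have nz: "Qform Z \<noteq> 0" if "Z \<in> lie" "Z \<noteq> 0" for Z
  proof -
    have False if all: "\<forall>X\<in>lie. Qform X = 0"
    proof -
      have "Qform (0, v, 0, \<zeta>) = 0" using all V by blast
      then have "v = 0" by (simp add: Qform_def)
      then have "\<zeta> \<noteq> 0" using V(2) by (auto simp: zero_prod_def)
      have "(1, xU, 0, \<eta>U + \<zeta>) \<in> lie"
        using subspace_add[OF subspace_lie U V(1)] \<open>v = 0\<close> by simp
      then have "Qform (1, xU, 0, \<eta>U + \<zeta>) = 0" "Qform (1, xU, 0, \<eta>U) = 0" using all U by blast+
      then show False using \<open>\<zeta> \<noteq> 0\<close> by (simp add: Qform_def)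
    qed
    with alt that show ?thesis by blast
  qed
  have V0: "Qform (0, v, 0, \<zeta>) > 0"
    using nz[OF V] by (simp add: Qform_def)
  show ?thesis
  proof (rule ccontr)
    assume "\<not> ?thesis"
    then have wneg: "Qform w < 0" using nz[OF w] by simp
    \<comment> \<open>The form changes sign along the segment from \<open>w\<close> to the vector of
      the kernel. Its zero there can only be the zero vector, so the two ends would be proportional,
      although the form has opposite signs on them.\<close>
    define f where "f s = Qform ((1 - s) *\<^sub>R w + s *\<^sub>R (0, v, 0, \<zeta>))" for s :: real
    have "continuous_on {0..1} f"
      unfolding f_def Qform_def case_prod_beta by (intro continuous_intros) auto
    moreover have "f 0 = Qform w" "f 1 = Qform (0, v, 0, \<zeta>)"
      by (cases w; simp add: f_def)+
    then have "f 0 \<le> 0" "f 1 \<ge> 0"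
      using wneg V0 by simp_all
    ultimately obtain s where s: "0 \<le> s" "s \<le> 1" "f s = 0"
      using IVT'[of f 0 0 1] by auto
    have "(1 - s) *\<^sub>R w + s *\<^sub>R (0, v, 0, \<zeta>) = 0"
      using nz[of "(1 - s) *\<^sub>R w + s *\<^sub>R (0, v, 0, \<zeta>)"] s(3) w(1) V(1)
      unfolding f_def by (meson subspace_add[OF subspace_lie] lie_scaleR)
    then have "(1 - s) *\<^sub>R w = (- s) *\<^sub>R (0, v, 0, \<zeta>)"
      by (metis add_eq_0_iff2 scaleR_minus_left)
    then have "(1 - s)\<^sup>2 * Qform w = s\<^sup>2 * Qform (0, v, 0, \<zeta>)"
      using Qform_scaleR[of "1 - s" w] Qform_scaleR[of "- s" "(0, v, 0, \<zeta>)"] by simp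
    moreover have "(1 - s)\<^sup>2 * Qform w \<le> 0" "s\<^sup>2 * Qform (0, v, 0, \<zeta>) \<ge> 0"
      using wneg V0 by (simp_all add: mult_nonneg_nonpos)
    ultimately have "(1 - s)\<^sup>2 * Qform w = 0" "s\<^sup>2 * Qform (0, v, 0, \<zeta>) = 0" by linarith+
    then show False using wneg V0 by simp
  qed
qed

text \<open>On the kernel \<open>L\<close> of \<open>\<phi>\<close> the form is half of
  \<open>x \<bullet> x\<close>, so definiteness makes x determine the element, and
  \<open>\<eta>\<close> is a linear functional of x, represented by \<open>b\<close> after
  projection to \<open>X0\<close>. Subtracting an element of \<open>L\<close> from \<open>U\<close>
  makes its x-part orthogonal to \<open>X0\<close>: this is \<open>c\<close>, and \<open>p\<close>
  is the last coordinate that results.\<close>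

lemma positive_definite_structure:
  assumes y: "\<And>\<phi> x y \<eta>. (\<phi>, x, y, \<eta>) \<in> lie \<Longrightarrow> y = 0"
    and U: "(1, xU, 0, \<eta>U) \<in> lie" and pos: "\<And>w. w \<in> lie \<Longrightarrow> w \<noteq> 0 \<Longrightarrow> Qform w > 0"
  shows "\<exists>X0 b c (p :: real). subspace X0 \<and> b \<in> X0 \<and> c \<in> orthogonal_comp X0 \<and>
         (norm b)\<^sup>2 - (norm c)\<^sup>2 - 2 * p < 0 \<and>
         (\<forall>\<phi> x y \<eta>. (\<phi>, x, y, \<eta>) \<in> lie \<longrightarrow> y = 0 \<and> x \<in> (\<lambda>u. \<phi> *\<^sub>R c + u) ` X0 \<and> \<eta> = p * \<phi> + b \<bullet> x)"
proof -
  define L where "L = {v \<in> lie. fst v = 0}"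
  define f where "f v = fst (snd v)" for v :: "'k nvec"
  define X0 where "X0 = f ` L"
  have L: "subspace L"
    using subspace_lie by (auto simp: L_def subspace_def)
  have f: "linear f"
    by (auto simp: f_def linear_iff)
  have X0: "subspace X0"
    unfolding X0_def using f L by (rule linear_subspace_image)
  have inj: "inj_on f L"
  proof (subst linear_injective_on_subspace_0[OF f L], intro ballI impI)
    fix v assume v: "v \<in> L" "f v = 0"
    obtain \<phi> x y \<eta> where e: "v = (\<phi>, x, y, \<eta>)" by (cases v)
    show "v = 0"
      using pos[of v] v by (auto simp: L_def f_def e Qform_def)
  qed
  obtain g where g: "linear g" "\<And>v. v \<in> L \<Longrightarrow> g (f v) = v"
    using linear_exists_left_inverse_on[OF f L inj] by blast
  have "linear (\<lambda>x. snd (snd (snd (g x))))"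
    using g(1) by (auto simp: linear_iff)
  then obtain b0 where b0: "\<And>x. snd (snd (snd (g x))) = b0 \<bullet> x"
    using linear_functional_inner by blast
  have X0span: "span X0 = X0" using X0 by (simp add: span_eq_iff)
  obtain b b1 where b: "b \<in> X0" "\<And>w. w \<in> X0 \<Longrightarrow> orthogonal b1 w" "b0 = b + b1"
    using orthogonal_subspace_decomp_exists[of X0 b0] unfolding X0span by metis
  obtain u c where c: "u \<in> X0" "\<And>w. w \<in> X0 \<Longrightarrow> orthogonal c w" "xU = u + c"
    using orthogonal_subspace_decomp_exists[of X0 xU] unfolding X0span by metis
  have kernel: "x \<in> X0 \<and> \<eta> = b \<bullet> x" if "(0, x, 0, \<eta>) \<in> lie" for x \<eta>
  proof -
    have m: "(0, x, 0, \<eta>) \<in> L" using that by (simp add: L_def)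
    then have x: "x \<in> X0" unfolding X0_def f_def by force
    have "g x = (0, x, 0, \<eta>)" using g(2)[OF m] by (simp add: f_def)
    then have "\<eta> = b0 \<bullet> x" using b0[of x] by simp
    also have "\<dots> = b \<bullet> x" using b(2)[OF x] by (simp add: b(3) inner_add_left orthogonal_def)
    finally show ?thesis using x by simp
  qed
  have mem: "(0, x, 0, b \<bullet> x) \<in> lie" if x: "x \<in> X0" for x
  proof -
    obtain v where v: "v \<in> L" "x = f v" using x unfolding X0_def by blast
    obtain \<phi> x' y' \<eta> where e: "v = (\<phi>, x', y', \<eta>)" by (cases v)
    have "(0, x, 0, \<eta>) \<in> lie"
      using v y[of \<phi> x' y' \<eta>] by (auto simp: L_def f_def e)
    then show ?thesis using kernel by metis
  qed
  have bc: "b \<bullet> c = 0" using c(2)[OF b(1)] by (simp add: orthogonal_def inner_commute)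
  define p where "p = \<eta>U - b \<bullet> u"
  have U': "(1, c, 0, p) \<in> lie"
    using subspace_diff[OF subspace_lie U mem[OF c(1)]] by (simp add: c(3) p_def)
  \<comment> \<open>The vector with \<open>\<phi> = 1\<close> at which \<open>Qform\<close> is
    minimal; positivity there is exactly the required strict inequality.\<close>
  have "(1, c - b, 0, p - b \<bullet> b) \<in> lie"
    using subspace_diff[OF subspace_lie U' mem[OF b(1)]] by simp
  then have "Qform (1, c - b, 0, p - b \<bullet> b) > 0"
    by (rule pos) (simp add: zero_prod_def)
  then have "(norm b)\<^sup>2 - (norm c)\<^sup>2 - 2 * p < 0"
    by (simp add: Qform_def inner_diff_left inner_diff_right bc inner_commute[of c b] power2_norm_eq_inner field_simps)
  moreover have "c \<in> orthogonal_comp X0"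
    using c(2) by (auto simp: orthogonal_comp_def orthogonal_commute)
  moreover have "y = 0 \<and> x \<in> (\<lambda>u. \<phi> *\<^sub>R c + u) ` X0 \<and> \<eta> = p * \<phi> + b \<bullet> x" if w: "(\<phi>, x, y, \<eta>) \<in> lie" for \<phi> x y \<eta>
  proof -
    have y0: "y = 0" by (rule y[OF w])
    have "(0, x - \<phi> *\<^sub>R c, 0, \<eta> - \<phi> * p) \<in> lie"
      using subspace_diff[OF subspace_lie w lie_scaleR[OF U', of \<phi>]] by (simp add: y0)
    from kernel[OF this] have "x - \<phi> *\<^sub>R c \<in> X0" "\<eta> - \<phi> * p = b \<bullet> (x - \<phi> *\<^sub>R c)" by auto
    then show ?thesis
      using y0 by (auto simp: inner_diff_right bc algebra_simps intro!: image_eqI[of _ _ "x - \<phi> *\<^sub>R c"])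
  qed
  ultimately show ?thesis
    using X0 b(1) by blast
qed

lemma lie_line:
  assumes "dim lie \<le> 1"
  shows "\<exists>v. \<forall>w\<in>lie. \<exists>t. w = t *\<^sub>R v"
proof (cases "lie \<subseteq> {0}")
  case True
  then show ?thesis by (intro exI[of _ 0]) auto
next
  case False
  then obtain v where v: "v \<in> lie" "v \<noteq> 0" by blast
  have "w \<in> span {v}" if w: "w \<in> lie" for w
  proof (rule ccontr)
    assume n: "w \<notin> span {v}"
    then have "independent {w, v}" "w \<noteq> v"
      using v by (auto simp: independent_insert span_base)
    then have "card {w, v} \<le> dim lie"
      using w v by (intro independent_card_le_dim) auto
    with assms \<open>w \<noteq> v\<close> show False by simp
  qed
  then have "\<exists>t. w = t *\<^sub>R v" if "w \<in> lie" for w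
    using that unfolding span_singleton by blast
  then show ?thesis by blast
qed

text \<open>Completing the square in the part \<open>u\<close> of x in \<open>X0\<close>: twice the
  form is the squared norm of \<open>u + \<phi> *\<^sub>R b\<close> plus the square of
  \<open>\<phi>\<close> times a constant that is positive by the strict inequality.\<close>

lemma not_cartan_graph:
  assumes X0: "subspace X0" "b \<in> X0" "c \<in> orthogonal_comp X0" "(norm b)\<^sup>2 - (norm c)\<^sup>2 - 2 * p < 0"
    and lie: "\<And>\<phi> x y \<eta>. (\<phi>, x, y, \<eta>) \<in> lie \<Longrightarrow> y = 0 \<and> x \<in> (\<lambda>u. \<phi> *\<^sub>R c + u) ` X0 \<and> \<eta> = p * \<phi> + b \<bullet> x"
  shows "\<not> cartan_decomposition_subgroup SO2n H"
proof (rule not_cartan_positive_definite)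
  show "y = 0" if "(\<phi>, x, y, \<eta>) \<in> lie" for \<phi> x y \<eta>
    using lie[OF that] by simp
  fix \<phi> x y \<eta> assume w: "(\<phi>, x, y, \<eta>) \<in> lie" "(\<phi>, x, y, \<eta>) \<noteq> (0 :: 'k nvec)"
  obtain u where u: "u \<in> X0" "x = \<phi> *\<^sub>R c + u" and \<eta>: "\<eta> = p * \<phi> + b \<bullet> x" and y: "y = 0"
    using lie[OF w(1)] by blast
  have c: "c \<bullet> z = 0" if "z \<in> X0" for z
    using X0(3) that by (auto simp: orthogonal_comp_def orthogonal_def inner_commute)
  have bc: "b \<bullet> c = 0" "c \<bullet> u = 0" "u \<bullet> c = 0"
    using c[OF X0(2)] c[OF u(1)] by (simp_all add: inner_commute)
  have e: "2 * (\<phi> * \<eta> + (x \<bullet> x) / 2) = (u + \<phi> *\<^sub>R b) \<bullet> (u + \<phi> *\<^sub>R b) + \<phi>\<^sup>2 * (2 * p + c \<bullet> c - b \<bullet> b)"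
    unfolding \<eta> u(2)
    by (simp add: inner_add_left inner_add_right bc inner_commute[of u b] power2_eq_square algebra_simps)
  have d: "2 * p + c \<bullet> c - b \<bullet> b > 0"
    using X0(4) by (simp add: power2_norm_eq_inner)
  have "0 < 2 * (\<phi> * \<eta> + (x \<bullet> x) / 2)"
  proof (cases "\<phi> = 0")
    case True
    then have "u \<noteq> 0" using w(2) \<eta> u(2) y by (auto simp: zero_prod_def)
    then show ?thesis unfolding e using True by simp
  next
    case False
    then show ?thesis unfolding e using d by (intro add_nonneg_pos) auto
  qed
  then show "\<phi> * \<eta> + (x \<bullet> x) / 2 > 0" by simp
qed

section \<open>The four conditions in coordinates, and the conclusion\<close>

lemma ball_lie_algebra: "(\<forall>X\<in>lie_algebra H. P X) \<longleftrightarrow> (\<forall>\<phi> x y \<eta>. (\<phi>, x, y, \<eta>) \<in> lie \<longrightarrow> P (nmat (\<phi>, x, y, \<eta>)))"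
  unfolding lie_algebra_eq by auto

lemma nmat_eq_0: "nmat v = 0 \<longleftrightarrow> v = 0"
  unfolding nmat_inject[of v 0, symmetric] using nmat_scaleR[of 0 v] by (simp del: nmat_inject)

end

theorem theorem5p5:
  fixes H :: "(real^('k::{finite,linorder} idx)^('k idx)) set"
  assumes "subgroup H SO2n" and "H \<subseteq> unipotent_N"
    and "closedin (top_of_set unipotent_N) H" and "connected H"
  shows "\<not> cartan_decomposition_subgroup SO2n H \<longleftrightarrow>
      dim (lie_algebra H) \<le> 1
    \<or> (\<forall>X\<in>lie_algebra H. X \<noteq> 0 \<longrightarrow> phi_of X = 0 \<and> dim (span {x_of X, y_of X}) \<noteq> 1)
    \<or> (\<forall>X\<in>lie_algebra H. X \<noteq> 0 \<longrightarrow> phi_of X = 0 \<and> dim (span {x_of X, y_of X}) = 1)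
    \<or> (\<exists>X0 b c (p :: real).
         subspace X0 \<and> b \<in> X0 \<and> c \<in> orthogonal_comp X0 \<and>
         (norm b)\<^sup>2 - (norm c)\<^sup>2 - 2 * p < 0 \<and>
         (\<forall>X\<in>lie_algebra H. y_of X = 0 \<and> x_of X \<in> (\<lambda>u. phi_of X *\<^sub>R c + u) ` X0 \<and>
                 eta_of X = p * phi_of X + b \<bullet> x_of X))"
proof -
  interpret unipotent_subgroup H
    using assms by (rule unipotent_subgroup.intro)
  let ?D2 = "\<forall>\<phi> x y \<eta>. (\<phi>, x, y, \<eta>) \<in> lie \<longrightarrow> (\<phi>, x, y, \<eta>) \<noteq> (0 :: 'k nvec) \<longrightarrow> \<phi> = 0 \<and> dim (span {x, y}) \<noteq> 1"
  let ?D3 = "\<forall>\<phi> x y \<eta>. (\<phi>, x, y, \<eta>) \<in> lie \<longrightarrow> (\<phi>, x, y, \<eta>) \<noteq> (0 :: 'k nvec) \<longrightarrow> \<phi> = 0 \<and> dim (span {x, y}) = 1"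
  let ?D4 = "\<exists>X0 b c (p :: real). subspace X0 \<and> b \<in> X0 \<and> c \<in> orthogonal_comp X0 \<and>
         (norm b)\<^sup>2 - (norm c)\<^sup>2 - 2 * p < 0 \<and>
         (\<forall>\<phi> x y \<eta>. (\<phi>, x, y, \<eta>) \<in> lie \<longrightarrow> y = 0 \<and> x \<in> (\<lambda>u. \<phi> *\<^sub>R c + u) ` X0 \<and> \<eta> = p * \<phi> + b \<bullet> x)"
  show ?thesis
    unfolding ball_lie_algebra dim_lie_algebra nmat_eq_0 nmat_parameters
  proof
    assume ncds: "\<not> cartan_decomposition_subgroup SO2n H"
    show "dim lie \<le> 1 \<or> ?D2 \<or> ?D3 \<or> ?D4"
    proof (rule ccontr)
      assume n: "\<not> ?thesis"
      then have dim: "dim lie \<ge> 2" by simp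
      show False
      proof (cases "\<exists>\<phi> x y \<eta>. (\<phi>, x, y, \<eta>) \<in> lie \<and> \<phi> \<noteq> 0")
        case False
        then have \<phi>: "\<phi> = 0" if "(\<phi>, x, y, \<eta>) \<in> lie" for \<phi> x y \<eta> using that by blast
        note n' = n[unfolded de_Morgan_disj]
        note nD = n'[THEN conjunct2, THEN conjunct1] n'[THEN conjunct2, THEN conjunct2, THEN conjunct1]
        \<comment> \<open>As \<open>\<phi>\<close> vanishes throughout, a violation of the second
          condition gives a ray along the wall b = 1, and a violation of the third one gives a ray
          along the wall a = b.\<close>
        obtain \<phi>1 x y \<eta> where 1: "(\<phi>1, x, y, \<eta>) \<in> lie" "\<not> (\<phi>1 = 0 \<and> dim (span {x, y}) \<noteq> 1)"
          using nD(1) unfolding not_all not_imp by (elim exE conjE)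
        obtain \<phi>2 x' y' \<eta>' where 2: "(\<phi>2, x', y', \<eta>') \<in> lie" "(\<phi>2, x', y', \<eta>') \<noteq> 0"
            "\<not> (\<phi>2 = 0 \<and> dim (span {x', y'}) = 1)"
          using nD(2) unfolding not_all not_imp by (elim exE conjE)
        have X: "(\<phi>1, x, y, \<eta>) \<in> lie" "dim (span {x, y}) = 1"
          using 1 \<phi>[OF 1(1)] by simp_all
        have Z: "(\<phi>2, x', y', \<eta>') \<in> lie" "(\<phi>2, x', y', \<eta>') \<noteq> 0" "dim (span {x', y'}) \<noteq> 1"
          using 2 \<phi>[OF 2(1)] by simp_all
        have "cartan_decomposition_subgroup SO2n H"
          using X Z \<phi>[OF X(1)] \<phi>[OF Z(1)] unfolding dim_span_pair_eq_1
          by (intro cartan_of_no_phi[OF \<phi>, where x = x and y = y and \<eta> = \<eta> and x' = x' and y' = y' and \<eta>' = \<eta>']) auto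
        with ncds show False by blast
      next
        case True
        then obtain \<phi>1 x1 y1 \<eta>1 where U: "(\<phi>1, x1, y1, \<eta>1) \<in> lie" "\<phi>1 \<noteq> 0" by blast
        have y: "y = 0" if "(\<phi>, x, y, \<eta>) \<in> lie" for \<phi> x y \<eta>
          using cartan_of_noncommutative[OF dim U that] ncds by blast
        obtain xU yU \<eta>U where "(1, xU, yU, \<eta>U) \<in> lie"
          using lie_normalize_phi[OF U] by blast
        then have U1: "(1, xU, 0, \<eta>U) \<in> lie" using y by blast
        have "?D4"
        proof (rule positive_definite_structure[OF _ U1])
          show "y = 0" if "(\<phi>, x, y, \<eta>) \<in> lie" for \<phi> x y \<eta> by (rule y[OF that])
          show "Qform w > 0" if "w \<in> lie" "w \<noteq> 0" for w
            by (rule Qform_positive[OF dim _ U ncds that]) (rule y)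
        qed
        with n show False by blast
      qed
    qed
  next
    assume "dim lie \<le> 1 \<or> ?D2 \<or> ?D3 \<or> ?D4"
    then show "\<not> cartan_decomposition_subgroup SO2n H"
    proof (elim disjE)
      assume "dim lie \<le> 1"
      then obtain v where "\<forall>w\<in>lie. \<exists>t. w = t *\<^sub>R v"
        using lie_line by blast
      then show ?thesis
        by (intro not_cartan_line[of v]) blast
    next
      assume D: ?D2
      show ?thesis
      proof (rule not_cartan_independent)
        fix \<phi> x y \<eta> assume w: "(\<phi>, x, y, \<eta>) \<in> lie"
        show "\<phi> = 0 \<and> ((x, y) \<noteq> 0 \<longrightarrow> gram x y \<noteq> 0)"
        proof (cases "(\<phi>, x, y, \<eta>) = 0")
          case True
          then show ?thesis by (simp add: zero_prod_def)
        next
          case False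
          then have "\<phi> = 0" "dim (span {x, y}) \<noteq> 1" using D w by blast+
          then show ?thesis unfolding dim_span_pair_eq_1 by (auto simp: zero_prod_def)
        qed
      qed
    next
      assume D: ?D3
      show ?thesis
      proof (rule not_cartan_dependent)
        fix \<phi> x y \<eta> assume w: "(\<phi>, x, y, \<eta>) \<in> lie"
        have D': "\<phi> = 0 \<and> (x \<noteq> 0 \<or> y \<noteq> 0) \<and> gram x y = 0" if "(\<phi>, x, y, \<eta>) \<noteq> 0"
          using D w that unfolding dim_span_pair_eq_1 by blast
        show "\<phi> = 0 \<and> gram x y = 0"
        proof (cases "(\<phi>, x, y, \<eta>) = 0")
          case True
          then show ?thesis by (simp add: zero_prod_def gram_def)
        qed (use D' in blast)
        show "\<eta> = 0" if "x = 0" "y = 0"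
        proof (cases "(\<phi>, x, y, \<eta>) = 0")
          case True
          then show ?thesis by (simp add: zero_prod_def)
        qed (use D' that in blast)
      qed
    next
      assume ?D4
      then obtain X0 b c and p :: real where *: "subspace X0" "b \<in> X0" "c \<in> orthogonal_comp X0"
        "(norm b)\<^sup>2 - (norm c)\<^sup>2 - 2 * p < 0"
        "\<And>\<phi> x y \<eta>. (\<phi>, x, y, \<eta>) \<in> lie \<Longrightarrow> y = 0 \<and> x \<in> (\<lambda>u. \<phi> *\<^sub>R c + u) ` X0 \<and> \<eta> = p * \<phi> + b \<bullet> x"
        by blast
      show ?thesis
        by (rule not_cartan_graph[OF *])
    qed
  qed
qed

end
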